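(* Let $d\ge1$ be an integer and let $(X,T)$ be a minimal topological dynamical system that is a proximal extension of an inverse limit of minimal $d$-step nilsystems. Then there is an injective group homomorphism from $\mathrm{Aut}(X,T)$ to $\mathrm{Aut}(Z_d(X),T_d)$, where $(Z_d(X),T_d)$ is the maximal $d$-step nilfactor of $(X,T)$. In particular, $\mathrm{Aut}(X,T)$ is a $d$-step nilpotent group.
   Context: A topological dynamical system $(X,T)$ is a homeomorphism $T$ of a compact metric space $X$; minimal means every orbit is dense. $\mathrm{Aut}(X,T)$ is the group of homeomorphisms of $X$ commuting with $T$. A factor map $\pi:(X,T)\to(Y,S)$ is a continuous onto map with $\pi\circ T=S\circ\pi$. Points $x,x'$ are proximal if $\lim_i\mathrm{dist}(T^{n_i}x,T^{n_i}x')=0$ for some sequence $(n_i)$ in $\mathbb Z$. $(X,T)$ is a proximal extension of $(Y,S)$ via $\pi$ if $\pi(x)=\pi(x')$ implies $x,x'$ are proximal. For a group $G$, put $G_1=G$, $G_{j+1}=[G,G_j]$; $G$ is $d$-step nilpotent if $G_{d+1}$ is trivial. A $d$-step nilsystem is $(G/\Gamma,x\mapsto\tau x)$ with $G$ a $d$-step nilpotent Lie group, $\Gamma$ a discrete cocompact subgroup, $\tau\in G$. Inverse limits are taken with bonding maps that are factor maps. Points $x,y\in X$ are regionally proximal of order $d$, written $(x,y)\in\mathbf{RP}^{[d]}(X)$, if for every $\delta>0$ there exist $x',y'\in X$ and $\vec n\in\mathbb Z^d$ with $\mathrm{dist}(x,x')<\delta$, $\mathrm{dist}(y,y')<\delta$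 and $\mathrm{dist}(T^{\vec n\cdot\epsilon}x',T^{\vec n\cdot\epsilon}y')<\delta$ for all $\epsilon\in\{0,1\}^d\setminus\{(0,\dots,0)\}$, where $\vec n\cdot\epsilon=\sum_i n_i\epsilon_i$. For minimal $(X,T)$ it is a known fact (Host–Kra–Maass, Shao–Ye) that this is a $T$-invariant closed equivalence relation, and that the quotient $Z_d(X)=X/\mathbf{RP}^{[d]}(X)$ with the induced map $T_d$ is the maximal factor of $(X,T)$ that is conjugate to an inverse limit of minimal $d$-step nilsystems; it is called the maximal $d$-step nilfactor. *)

theory Defs
  imports "HOL-Analysis.Analysis" "HOL-Algebra.Bij" "HOL-Algebra.Generated_Groups"
begin

section \<open>Topological dynamical systems\<close>

text \<open>A system is a topology \<open>X\<close> together with a map \<open>T\<close>; only the values of \<open>T\<close>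
  on \<open>topspace X\<close> matter.\<close>

definition tds :: "'a topology \<Rightarrow> ('a \<Rightarrow> 'a) \<Rightarrow> bool" where
  "tds X T \<longleftrightarrow> compact_space X \<and> metrizable_space X \<and> homeomorphic_map X X T"

text \<open>The integer power \<open>T\<^sup>n\<close> of a bijection \<open>T\<close> of the set \<open>S\<close>, meaningful on \<open>S\<close>.\<close>

definition ipow :: "'a set \<Rightarrow> ('a \<Rightarrow> 'a) \<Rightarrow> int \<Rightarrow> 'a \<Rightarrow> 'a" where
  "ipow S T n = (if 0 \<le> n then T ^^ nat n else inv_into S T ^^ nat (- n))"

definition minimal :: "'a topology \<Rightarrow> ('a \<Rightarrow> 'a) \<Rightarrow> bool" where
  "minimal X T \<longleftrightarrow>
     (\<forall>x\<in>topspace X. X closure_of (range (\<lambda>n. ipow (topspace X) T n x)) = topspace X)"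

text \<open>Automorphisms are taken extensional (constantly \<open>undefined\<close> off \<open>topspace X\<close>), as in
  \<^const>\<open>BijGroup\<close>, so that they are determined by their values on the space.\<close>

definition Aut :: "'a topology \<Rightarrow> ('a \<Rightarrow> 'a) \<Rightarrow> ('a \<Rightarrow> 'a) monoid" where
  "Aut X T = BijGroup (topspace X)
     \<lparr>carrier := {f \<in> Bij (topspace X).
        homeomorphic_map X X f \<and> (\<forall>x\<in>topspace X. f (T x) = T (f x))}\<rparr>"

definition factor_map ::
  "'a topology \<Rightarrow> ('a \<Rightarrow> 'a) \<Rightarrow> 'b topology \<Rightarrow> ('b \<Rightarrow> 'b) \<Rightarrow> ('a \<Rightarrow> 'b) \<Rightarrow> bool" where
  "factor_map X T Y S \<pi> \<longleftrightarrow>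
     continuous_map X Y \<pi> \<and> \<pi> ` topspace X = topspace Y \<and>
     (\<forall>x\<in>topspace X. \<pi> (T x) = S (\<pi> x))"

definition conjugate ::
  "'a topology \<Rightarrow> ('a \<Rightarrow> 'a) \<Rightarrow> 'b topology \<Rightarrow> ('b \<Rightarrow> 'b) \<Rightarrow> bool" where
  "conjugate X T Y S \<longleftrightarrow>
     (\<exists>h. homeomorphic_map X Y h \<and> (\<forall>x\<in>topspace X. h (T x) = S (h x)))"

definition proximal ::
  "'a::metric_space set \<Rightarrow> ('a \<Rightarrow> 'a) \<Rightarrow> 'a \<Rightarrow> 'a \<Rightarrow> bool" where
  "proximal X T x x' \<longleftrightarrow>
     (\<exists>n :: nat \<Rightarrow> int. (\<lambda>i. dist (ipow X T (n i) x) (ipow X T (n i) x')) \<longlonglongrightarrow> 0)"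

definition proximal_extension ::
  "'a::metric_space set \<Rightarrow> ('a \<Rightarrow> 'a) \<Rightarrow> 'b topology \<Rightarrow> ('b \<Rightarrow> 'b) \<Rightarrow> ('a \<Rightarrow> 'b) \<Rightarrow> bool" where
  "proximal_extension X T Y S \<pi> \<longleftrightarrow>
     factor_map (top_of_set X) T Y S \<pi> \<and>
     (\<forall>x\<in>X. \<forall>x'\<in>X. \<pi> x = \<pi> x' \<longrightarrow> proximal X T x x')"

lemma group_Aut:
  assumes "homeomorphic_map X X T"
  shows "group (Aut X T)"
proof -
  let ?S = "topspace X"
  let ?A = "{f \<in> Bij ?S. homeomorphic_map X X f \<and> (\<forall>x\<in>?S. f (T x) = T (f x))}"
  have T: "\<And>x. x \<in> ?S \<Longrightarrow> T x \<in> ?S"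
    using homeomorphic_imp_surjective_map[OF assms] by blast
  have "subgroup ?A (BijGroup ?S)"
  proof (rule group.subgroupI[OF group_BijGroup])
    show "?A \<subseteq> carrier (BijGroup ?S)" by (auto simp: BijGroup_def)
    have "homeomorphic_map X X (\<lambda>x\<in>?S. x)"
      by (rule homeomorphic_map_eq[of X X id]) (simp_all add: homeomorphic_map_id)
    then have "(\<lambda>x\<in>?S. x) \<in> ?A" using T by (simp add: id_Bij)
    then show "?A \<noteq> {}" by blast
  next
    fix f assume f: "f \<in> ?A"
    then have fB: "f \<in> Bij ?S" and fh: "homeomorphic_map X X f" by auto
    have bij: "bij_betw f ?S ?S" using fB by (simp add: Bij_def)
    let ?g = "\<lambda>x\<in>?S. inv_into ?S f x"
    have "inv\<^bsub>BijGroup ?S\<^esub> f = ?g" by (rule inv_BijGroup[OF fB])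
    moreover have "?g \<in> Bij ?S" by (rule restrict_inv_into_Bij[OF fB])
    moreover have "homeomorphic_map X X ?g"
    proof -
      obtain g where g: "homeomorphic_maps X X f g"
        using fh homeomorphic_map_maps by blast
      then have "homeomorphic_map X X g"
        using homeomorphic_maps_map by blast
      moreover have "g x = ?g x" if "x \<in> ?S" for x
      proof -
        have "g x \<in> ?S" "f (g x) = x"
          using g that by (auto simp: homeomorphic_maps_def continuous_map_def)
        then show ?thesis using that bij bij_betw_inv_into_left by fastforce
      qed
      ultimately show ?thesis by (metis homeomorphic_map_eq)
    qed
    moreover have "?g (T x) = T (?g x)" if x: "x \<in> ?S" for x
    proof -
      have 1: "inv_into ?S f x \<in> ?S" "f (inv_into ?S f x) = x"
        using bij x bij_betw_inv_into_right bij_betwE bij_betw_inv_into by fast+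
      then have "f (T (inv_into ?S f x)) = T x" using f by auto
      then have "inv_into ?S f (T x) = T (inv_into ?S f x)"
        using bij 1 T bij_betw_inv_into_left by metis
      then show ?thesis using x T by simp
    qed
    ultimately show "inv\<^bsub>BijGroup ?S\<^esub> f \<in> ?A" by simp
  next
    fix f g assume f: "f \<in> ?A" and g: "g \<in> ?A"
    have gS: "\<And>x. x \<in> ?S \<Longrightarrow> g x \<in> ?S" using g by (auto simp: Bij_def bij_betw_def)
    have "homeomorphic_map X X (f \<circ> g)"
      using f g homeomorphic_map_compose by blast
    then have "homeomorphic_map X X (compose ?S f g)"
      by (rule homeomorphic_map_eq) (simp add: compose_def)
    moreover have "compose ?S f g \<in> Bij ?S" using f g compose_Bij by blast
    ultimately show "f \<otimes>\<^bsub>BijGroup ?S\<^esub> g \<in> ?A"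
      using f g T gS by (auto simp: BijGroup_def compose_def)
  qed
  then have "group (BijGroup ?S \<lparr>carrier := ?A\<rparr>)"
    by (rule subgroup.subgroup_is_group) (rule group_BijGroup)
  then show ?thesis by (simp add: Aut_def)
qed


section \<open>The quotient topology\<close>

definition quotient_top :: "'a topology \<Rightarrow> ('a \<Rightarrow> 'b) \<Rightarrow> 'b topology" where
  "quotient_top X q =
     topology (\<lambda>V. V \<subseteq> q ` topspace X \<and> openin X {x \<in> topspace X. q x \<in> V})"

lemma openin_quotient_top:
  "openin (quotient_top X q) V \<longleftrightarrow>
     V \<subseteq> q ` topspace X \<and> openin X {x \<in> topspace X. q x \<in> V}"
proof -
  let ?P = "\<lambda>V. V \<subseteq> q ` topspace X \<and> openin X {x \<in> topspace X. q x \<in> V}"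
  have "?P (U \<inter> V)" if "?P U" "?P V" for U V
  proof -
    have "{x \<in> topspace X. q x \<in> U \<inter> V} =
        {x \<in> topspace X. q x \<in> U} \<inter> {x \<in> topspace X. q x \<in> V}" by auto
    then show ?thesis using that by (auto intro: openin_Int)
  qed
  moreover have "?P (\<Union>\<K>)" if "\<forall>K\<in>\<K>. ?P K" for \<K>
  proof -
    have "{x \<in> topspace X. q x \<in> \<Union>\<K>} = (\<Union>K\<in>\<K>. {x \<in> topspace X. q x \<in> K})" by auto
    then show ?thesis using that by (auto intro!: openin_Union)
  qed
  ultimately have "istopology ?P" unfolding istopology_def by blast
  then show ?thesis by (simp add: quotient_top_def topology_inverse')
qed

lemma topspace_quotient_top: "topspace (quotient_top X q) = q ` topspace X"
proof -
  have "{x \<in> topspace X. q x \<in> q ` topspace X} = topspace X" by auto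
  then have "openin (quotient_top X q) (q ` topspace X)"
    by (simp add: openin_quotient_top)
  then show ?thesis
    by (metis openin_quotient_top openin_subset openin_topspace subset_antisym)
qed

lemma quotient_map_quotient_top: "quotient_map X (quotient_top X q) q"
  by (simp add: quotient_map_def topspace_quotient_top openin_quotient_top)


section \<open>Nilpotent groups\<close>

definition commutator_subgroup ::
  "('g, 'm) monoid_scheme \<Rightarrow> 'g set \<Rightarrow> 'g set \<Rightarrow> 'g set" where
  "commutator_subgroup G H K =
     generate G {h \<otimes>\<^bsub>G\<^esub> k \<otimes>\<^bsub>G\<^esub> inv\<^bsub>G\<^esub> h \<otimes>\<^bsub>G\<^esub> inv\<^bsub>G\<^esub> k | h k. h \<in> H \<and> k \<in> K}"

text \<open>Indexing is shifted: \<open>lower_central G j\<close> is the group usually written \<open>G\<^bsub>j+1\<^esub>\<close>, where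
  \<open>G\<^sub>1 = G\<close> and \<open>G\<^bsub>j+1\<^esub> = [G, G\<^sub>j]\<close>.\<close>

primrec lower_central :: "('g, 'm) monoid_scheme \<Rightarrow> nat \<Rightarrow> 'g set" where
  "lower_central G 0 = carrier G"
| "lower_central G (Suc j) = commutator_subgroup G (carrier G) (lower_central G j)"

definition nilpotent :: "nat \<Rightarrow> ('g, 'm) monoid_scheme \<Rightarrow> bool" where
  "nilpotent d G \<longleftrightarrow> group G \<and> lower_central G d = {\<one>\<^bsub>G\<^esub>}"


section \<open>Lie groups\<close>

text \<open>\<open>\<real>\<^sup>n\<close> is \<^term>\<open>Euclidean_space n\<close>: sequences vanishing from index \<open>n\<close> on.
  \<open>Ck_on n k S f\<close> says that \<open>f\<close> is of class \<open>C\<^sup>k\<close> on the open set \<open>S\<close> of \<open>\<real>\<^sup>n\<close>,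
  by means of iterated partial derivatives.\<close>

primrec Ck_on ::
  "nat \<Rightarrow> nat \<Rightarrow> (nat \<Rightarrow> real) set \<Rightarrow> ((nat \<Rightarrow> real) \<Rightarrow> real) \<Rightarrow> bool" where
  "Ck_on n 0 S f \<longleftrightarrow> continuous_map (subtopology (Euclidean_space n) S) euclideanreal f"
| "Ck_on n (Suc k) S f \<longleftrightarrow>
     continuous_map (subtopology (Euclidean_space n) S) euclideanreal f \<and>
     (\<forall>i<n. \<exists>g. (\<forall>x\<in>S. ((\<lambda>t. f (x(i := t))) has_real_derivative g x) (at (x i))) \<and>
                Ck_on n k S g)"

definition smooth_on ::
  "nat \<Rightarrow> nat \<Rightarrow> (nat \<Rightarrow> real) set \<Rightarrow> ((nat \<Rightarrow> real) \<Rightarrow> (nat \<Rightarrow> real)) \<Rightarrow> bool" where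
  "smooth_on n m S f \<longleftrightarrow>
     openin (Euclidean_space n) S \<and> (\<forall>k. \<forall>j<m. Ck_on n k S (\<lambda>x. f x j))"

type_synonym 'p chart = "'p set \<times> ('p \<Rightarrow> nat \<Rightarrow> real)"

text \<open>The openness built into \<^const>\<open>smooth_on\<close> makes a map that is smooth in this sense
  continuous, since the chart domains of \<open>B\<close> cover the target.\<close>

definition smooth_map ::
  "nat \<Rightarrow> 'p chart set \<Rightarrow> nat \<Rightarrow> 'q chart set \<Rightarrow> ('p \<Rightarrow> 'q) \<Rightarrow> bool" where
  "smooth_map n A m B f \<longleftrightarrow>
     (\<forall>(U, \<phi>)\<in>A. \<forall>(V, \<psi>)\<in>B.
        smooth_on n m (\<phi> ` {p \<in> U. f p \<in> V}) (\<lambda>x. \<psi> (f (inv_into U \<phi> x))))"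

text \<open>Compatibility of charts is smoothness of the identity from the atlas to itself.\<close>

definition smooth_atlas :: "'p topology \<Rightarrow> nat \<Rightarrow> 'p chart set \<Rightarrow> bool" where
  "smooth_atlas M n A \<longleftrightarrow>
     (\<Union>(U, \<phi>)\<in>A. U) = topspace M \<and>
     (\<forall>(U, \<phi>)\<in>A. openin M U \<and> openin (Euclidean_space n) (\<phi> ` U) \<and>
        homeomorphic_map (subtopology M U) (subtopology (Euclidean_space n) (\<phi> ` U)) \<phi>) \<and>
     smooth_map n A n A (\<lambda>p. p)"

text \<open>Product charts, with values in \<open>\<real>\<^bsup>n+m\<^esup>\<close> when those of \<open>B\<close> take values in \<open>\<real>\<^sup>m\<close>.\<close>

definition prod_atlas :: "nat \<Rightarrow> 'p chart set \<Rightarrow> 'q chart set \<Rightarrow> ('p \<times> 'q) chart set" where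
  "prod_atlas n A B =
     {(U \<times> V, \<lambda>(p, q) i. if i < n then \<phi> p i else \<psi> q (i - n)) | U \<phi> V \<psi>.
        (U, \<phi>) \<in> A \<and> (V, \<psi>) \<in> B}"

definition lie_group :: "('g, 'm) monoid_scheme \<Rightarrow> 'g topology \<Rightarrow> bool" where
  "lie_group G M \<longleftrightarrow>
     group G \<and> topspace M = carrier G \<and> Hausdorff_space M \<and> second_countable M \<and>
     (\<exists>n A. smooth_atlas M n A \<and>
        smooth_map (n + n) (prod_atlas n A A) n A (\<lambda>(g, h). g \<otimes>\<^bsub>G\<^esub> h) \<and>
        smooth_map n A n A (\<lambda>g. inv\<^bsub>G\<^esub> g))"


section \<open>Nilsystems and their inverse limits\<close>

text \<open>Points of \<open>G/\<Gamma>\<close> are the left cosets \<open>g\<Gamma>\<close>, and \<open>\<tau>\<close> acts by \<open>g\<Gamma> \<mapsto> \<tau>g\<Gamma>\<close>.\<close>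

definition nil_space ::
  "('g, 'm) monoid_scheme \<Rightarrow> 'g topology \<Rightarrow> 'g set \<Rightarrow> 'g set topology" where
  "nil_space G M \<Gamma> = quotient_top M (\<lambda>g. g <#\<^bsub>G\<^esub> \<Gamma>)"

definition nil_map :: "('g, 'm) monoid_scheme \<Rightarrow> 'g \<Rightarrow> 'g set \<Rightarrow> 'g set" where
  "nil_map G \<tau> C = \<tau> <#\<^bsub>G\<^esub> C"

definition nilsystem ::
  "nat \<Rightarrow> ('g, 'm) monoid_scheme \<Rightarrow> 'g topology \<Rightarrow> 'g set \<Rightarrow> 'g \<Rightarrow> bool" where
  "nilsystem d G M \<Gamma> \<tau> \<longleftrightarrow>
     lie_group G M \<and> nilpotent d G \<and>
     subgroup \<Gamma> G \<and> subtopology M \<Gamma> = discrete_topology \<Gamma> \<and>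
     compact_space (nil_space G M \<Gamma>) \<and> \<tau> \<in> carrier G"

definition inverse_limit_space ::
  "(nat \<Rightarrow> 'a topology) \<Rightarrow> (nat \<Rightarrow> 'a \<Rightarrow> 'a) \<Rightarrow> (nat \<Rightarrow> 'a) topology" where
  "inverse_limit_space N p =
     subtopology (product_topology N UNIV) {x. \<forall>i. p i (x (Suc i)) = x i}"

text \<open>The type argument is the type containing the groups of the inverse sequence; as a free
  type variable in a hypothesis it imposes no restriction on them.\<close>

definition inverse_limit_of_minimal_nilsystems ::
  "'g itself \<Rightarrow> nat \<Rightarrow> 'b topology \<Rightarrow> ('b \<Rightarrow> 'b) \<Rightarrow> bool" where
  "inverse_limit_of_minimal_nilsystems _ d Y S \<longleftrightarrow>
     (\<exists>(G :: nat \<Rightarrow> 'g monoid) M \<Gamma> \<tau> p.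
        (\<forall>i. nilsystem d (G i) (M i) (\<Gamma> i) (\<tau> i) \<and>
             minimal (nil_space (G i) (M i) (\<Gamma> i)) (nil_map (G i) (\<tau> i))) \<and>
        (\<forall>i. factor_map
               (nil_space (G (Suc i)) (M (Suc i)) (\<Gamma> (Suc i))) (nil_map (G (Suc i)) (\<tau> (Suc i)))
               (nil_space (G i) (M i) (\<Gamma> i)) (nil_map (G i) (\<tau> i)) (p i)) \<and>
        conjugate Y S
          (inverse_limit_space (\<lambda>i. nil_space (G i) (M i) (\<Gamma> i)) p)
          (\<lambda>x i. nil_map (G i) (\<tau> i) (x i)))"


section \<open>Regional proximality and the maximal nilfactor\<close>

definition RP :: "nat \<Rightarrow> 'a::metric_space set \<Rightarrow> ('a \<Rightarrow> 'a) \<Rightarrow> ('a \<times> 'a) set" where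
  "RP d X T = {(x, y). x \<in> X \<and> y \<in> X \<and>
     (\<forall>\<delta>>0. \<exists>x'\<in>X. \<exists>y'\<in>X. \<exists>n :: nat \<Rightarrow> int.
        dist x x' < \<delta> \<and> dist y y' < \<delta> \<and>
        (\<forall>\<epsilon> :: nat \<Rightarrow> int. (\<forall>i<d. \<epsilon> i \<in> {0, 1}) \<and> (\<exists>i<d. \<epsilon> i \<noteq> 0) \<longrightarrow>
           dist (ipow X T (\<Sum>i<d. n i * \<epsilon> i) x') (ipow X T (\<Sum>i<d. n i * \<epsilon> i) y') < \<delta>))}"

definition nilfactor_space ::
  "nat \<Rightarrow> 'a::metric_space set \<Rightarrow> ('a \<Rightarrow> 'a) \<Rightarrow> 'a set topology" where
  "nilfactor_space d X T = quotient_top (top_of_set X) (\<lambda>x. RP d X T `` {x})"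

text \<open>The induced map on classes: when \<^term>\<open>RP d X T\<close> is a \<open>T\<close>-invariant equivalence relation,
  the saturation of \<open>T ` C\<close> is the class of \<open>T x\<close> for any \<open>x \<in> C\<close>.\<close>

definition nilfactor_map ::
  "nat \<Rightarrow> 'a::metric_space set \<Rightarrow> ('a \<Rightarrow> 'a) \<Rightarrow> 'a set \<Rightarrow> 'a set" where
  "nilfactor_map d X T C = RP d X T `` (T ` C)"

end

theory Submission
  imports Defs
begin

text \<open>An automorphism \<open>\<phi>\<close> with \<open>(x, \<phi> x)\<close> proximal for some \<open>x\<close> fixes a cluster point of the orbit of \<open>x\<close>,
  so it is the identity by minimality. The heart of the matter is therefore that \<open>RP\<^sup>[\<^sup>d\<^sup>]\<close> is contained
  in the fibre relation of \<open>\<pi>\<close>, i.e. that it is trivial on a \<open>d\<close>-step nilsystem \<open>G/\<Gamma>\<close>. After passing to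
  an open compactly generated subgroup, put \<open>N\<^sub>j = {x \<in> Z\<^bsub>d+1-j\<^esub> : [x, Z\<^sub>i] \<subseteq> Z\<^bsub>i-j\<^esub> for all i}\<close> with \<open>Z\<^sub>i\<close> the upper
  central series. This is a filtration of length \<open>d\<close>, and each \<open>\<Gamma> \<inter> N\<^sub>j\<close> is cocompact in \<open>N\<^sub>j\<close>: a Lie group
  has no small subgroups and all subgroups of \<open>\<Gamma>\<close> are finitely generated. Hence limits of pairs of parallel
  \<open>d\<close>-cubes come from pairs of cubes of \<open>G\<close>, and these are determined at one vertex by the others, modulo \<open>\<Gamma>\<close>.
  Finally, automorphisms acting on faces preserve the closure of the \<open>(d+1)\<close>-cubes of \<open>X\<close>, so a \<open>(d+1)\<close>-fold
  commutator \<open>\<psi>\<close> acts on a single vertex, which gives \<open>(x, \<psi> x) \<in> RP\<^sup>[\<^sup>d\<^sup>]\<close>.\<close>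

section \<open>Commutators and the upper central series\<close>

text \<open>The group of a nilsystem is not assumed connected, and this shapes the algebraic half.
  The terms of the lower central series are generated subgroups: neither their closedness nor the
  cocompactness of their intersections with \<Gamma> comes for free. The terms of the upper central
  series are centralizers, hence closed, but read backwards they form in general no filtration: if
  \<open>G\<close> has a direct factor of smaller step, commutators do not drop far enough. The
  stabilizer condition in \<open>N_j\<close> restores additivity of degrees and is again a
  centralizer condition. Cocompactness is deduced from discreteness of \<Gamma> modulo
  \<open>N_j\<close>. Finite generation reduces this to finitely many commutators, which are
  elements of \<Gamma>; the remaining commutators are only known to be small together with all their
  powers, and nilpotency provides the starting point for removing them.\<close>

context group
begin

lemma mult_inv_cancel [simp]:
  assumes "x \<in> carrier G" "y \<in> carrier G"
  shows "inv x \<otimes> (x \<otimes> y) = y" "x \<otimes> (inv x \<otimes> y) = y"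
  using assms by (simp_all flip: m_assoc)

definition comm :: "'a \<Rightarrow> 'a \<Rightarrow> 'a" where
  "comm x y = x \<otimes> y \<otimes> inv x \<otimes> inv y"

lemma comm_closed [simp, intro]:
  "x \<in> carrier G \<Longrightarrow> y \<in> carrier G \<Longrightarrow> comm x y \<in> carrier G"
  by (simp add: comm_def)

lemma comm_one [simp]: "x \<in> carrier G \<Longrightarrow> comm x \<one> = \<one>" "x \<in> carrier G \<Longrightarrow> comm \<one> x = \<one>"
  by (simp_all add: comm_def)

lemma inv_comm: "x \<in> carrier G \<Longrightarrow> y \<in> carrier G \<Longrightarrow> inv (comm x y) = comm y x"
  by (simp add: comm_def inv_mult_group m_assoc)

lemma comm_mult_right:
  "x \<in> carrier G \<Longrightarrow> y \<in> carrier G \<Longrightarrow> z \<in> carrier G \<Longrightarrow>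
    comm x (y \<otimes> z) = comm x y \<otimes> (y \<otimes> comm x z \<otimes> inv y)"
  by (simp add: comm_def inv_mult_group m_assoc)

lemma comm_mult_left:
  "x \<in> carrier G \<Longrightarrow> y \<in> carrier G \<Longrightarrow> z \<in> carrier G \<Longrightarrow>
    comm (x \<otimes> y) z = (x \<otimes> comm y z \<otimes> inv x) \<otimes> comm x z"
  by (simp add: comm_def inv_mult_group m_assoc)

lemma comm_inv_left:
  "x \<in> carrier G \<Longrightarrow> y \<in> carrier G \<Longrightarrow> comm (inv x) y = inv x \<otimes> inv (comm x y) \<otimes> x"
  by (simp add: comm_def inv_mult_group m_assoc)

lemma conj_eq_comm: "x \<in> carrier G \<Longrightarrow> y \<in> carrier G \<Longrightarrow> x \<otimes> y \<otimes> inv x = comm x y \<otimes> y"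
  by (simp add: comm_def m_assoc)

lemma comm_conj:
  "g \<in> carrier G \<Longrightarrow> x \<in> carrier G \<Longrightarrow> y \<in> carrier G \<Longrightarrow>
    g \<otimes> comm x y \<otimes> inv g = comm (g \<otimes> x \<otimes> inv g) (g \<otimes> y \<otimes> inv g)"
  by (simp add: comm_def inv_mult_group m_assoc)

text \<open>Equality in \<open>G/N\<close>, kept at the level of representatives: neighbourhoods of
  the unit of \<open>G\<close> can then be mixed with congruences without a topology on the
  quotient. Membership in the carrier is built in, so that later rules need few side
  conditions.\<close>

definition ceq :: "'a set \<Rightarrow> 'a \<Rightarrow> 'a \<Rightarrow> bool" where
  "ceq N x y \<longleftrightarrow> x \<in> carrier G \<and> y \<in> carrier G \<and> x \<otimes> inv y \<in> N"

end

section \<open>Congruences modulo a normal subgroup\<close>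

lemma (in normal) mem_mult: "x \<in> H \<Longrightarrow> y \<in> H \<Longrightarrow> x \<otimes> y \<in> H"
  by (rule subgroup.m_closed[OF subgroup_axioms])

lemma (in normal) ceq_refl [simp]: "x \<in> carrier G \<Longrightarrow> ceq H x x"
  by (simp add: ceq_def)

lemma (in normal) ceq_sym: "ceq H x y \<Longrightarrow> ceq H y x"
  unfolding ceq_def using m_inv_closed[of "x \<otimes> inv y"] by (auto simp: inv_mult_group)

lemma (in normal) ceq_trans:
  assumes "ceq H x y" "ceq H y z" shows "ceq H x z"
proof -
  have "(x \<otimes> inv y) \<otimes> (y \<otimes> inv z) \<in> H" using assms unfolding ceq_def by (meson mem_mult)
  then show ?thesis using assms unfolding ceq_def by (simp add: m_assoc)
qed

lemma (in normal) conj_mem: "g \<in> carrier G \<Longrightarrow> h \<in> H \<Longrightarrow> g \<otimes> h \<otimes> inv g \<in> H"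
  by (rule inv_op_closed2)

lemma (in normal) ceq_mult:
  assumes "ceq H x y" "ceq H z w" shows "ceq H (x \<otimes> z) (y \<otimes> w)"
proof -
  have c: "x \<in> carrier G" "y \<in> carrier G" "z \<in> carrier G" "w \<in> carrier G"
    using assms by (auto simp: ceq_def)
  have "x \<otimes> (z \<otimes> inv w) \<otimes> inv x \<otimes> (x \<otimes> inv y) \<in> H"
    using assms unfolding ceq_def by (blast intro: mem_mult conj_mem)
  then show ?thesis using c by (simp add: ceq_def m_assoc inv_mult_group)
qed

lemma (in normal) ceq_inv:
  assumes "ceq H x y" shows "ceq H (inv x) (inv y)"
proof -
  have c: "x \<in> carrier G" "y \<in> carrier G" using assms by (auto simp: ceq_def)
  have "inv x \<otimes> inv (inv (x \<otimes> inv y)) \<otimes> inv (inv x) \<in> H"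
    using assms c by (intro conj_mem) (auto simp: ceq_def)
  then have "inv y \<otimes> x \<in> H" using c by (simp add: inv_mult_group m_assoc)
  then have "inv (inv y \<otimes> x) \<in> H" by simp
  then show ?thesis using c by (simp add: ceq_def m_assoc inv_mult_group)
qed

lemma (in normal) ceq_comm:
  assumes "ceq H x y" "ceq H z w" shows "ceq H (comm x z) (comm y w)"
  unfolding comm_def using assms by (intro ceq_mult ceq_inv)

lemma (in normal) ceq_one_iff: "ceq H x \<one> \<longleftrightarrow> x \<in> H"
  by (auto simp: ceq_def)

lemma (in normal) ceq_mem: "ceq H x y \<Longrightarrow> x \<in> H \<Longrightarrow> y \<in> H"
  using ceq_one_iff ceq_sym ceq_trans by blast

lemma (in normal) ceq_mult_right: "x \<in> carrier G \<Longrightarrow> h \<in> H \<Longrightarrow> ceq H (x \<otimes> h) x"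
  using ceq_mult[of x x h \<one>] by (simp add: ceq_one_iff)

lemma (in normal) comm_mem_right: "x \<in> carrier G \<Longrightarrow> h \<in> H \<Longrightarrow> comm x h \<in> H"
  unfolding comm_def by (intro mem_mult conj_mem) auto

lemma (in normal) comm_mem_left: "x \<in> carrier G \<Longrightarrow> h \<in> H \<Longrightarrow> comm h x \<in> H"
  using comm_mem_right[of x h] m_inv_closed by (metis inv_comm mem_carrier)

lemma (in normal) ceq_comm_imp:
  assumes "comm x y \<in> H" "x \<in> carrier G" "y \<in> carrier G"
  shows "ceq H (x \<otimes> y) (y \<otimes> x)"
  using assms by (simp add: ceq_def comm_def inv_mult_group m_assoc)

lemma (in normal) ceq_conj_imp:
  assumes "comm x y \<in> H" "x \<in> carrier G" "y \<in> carrier G"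
  shows "ceq H (x \<otimes> y \<otimes> inv x) y"
  using assms by (simp add: ceq_def comm_def m_assoc)

text \<open>By \<open>comm_mult_right\<close>, going from \<open>n\<close> to \<open>Suc n\<close>
  contributes the conjugate of \<open>comm x y\<close> by \<open>y [^] n\<close>, and modulo
  \<open>H\<close> this conjugation is trivial. So control of commutators with all powers of
  \<open>y\<close> becomes control of all powers of a single commutator.\<close>

lemma (in normal) comm_pow_right:
  assumes "x \<in> carrier G" "y \<in> carrier G" "comm (comm x y) y \<in> H"
  shows "ceq H (comm x (y [^] (n::nat))) (comm x y [^] n)"
proof (induction n)
  case 0 then show ?case using assms by simp
next
  case (Suc n)
  let ?c = "comm x y"
  have c: "?c \<in> carrier G" using assms by simp
  have "comm y ?c \<in> H" using assms m_inv_closed[OF assms(3)] by (simp add: inv_comm)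
  then have 1: "ceq H (y \<otimes> ?c) (?c \<otimes> y)" using ceq_comm_imp assms by simp
  have 2: "ceq H (y [^] n \<otimes> ?c) (?c \<otimes> y [^] n)" for n :: nat
  proof (induction n)
    case 0 show ?case using c assms by simp
  next
    case (Suc n)
    have "ceq H (y [^] n \<otimes> (y \<otimes> ?c)) (y [^] n \<otimes> (?c \<otimes> y))"
      by (rule ceq_mult[OF _ 1]) (use assms in simp)
    moreover have "ceq H ((y [^] n \<otimes> ?c) \<otimes> y) ((?c \<otimes> y [^] n) \<otimes> y)"
      by (rule ceq_mult[OF Suc]) (use assms in simp)
    moreover have "y [^] n \<otimes> (?c \<otimes> y) = (y [^] n \<otimes> ?c) \<otimes> y" "(?c \<otimes> y [^] n) \<otimes> y = ?c \<otimes> y [^] Suc n"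
      "y [^] n \<otimes> (y \<otimes> ?c) = y [^] Suc n \<otimes> ?c"
      using assms c by (simp_all add: m_assoc)
    ultimately show ?case using ceq_trans by metis
  qed
  have "ceq H ((y [^] n \<otimes> ?c) \<otimes> inv (y [^] n)) ((?c \<otimes> y [^] n) \<otimes> inv (y [^] n))"
    by (rule ceq_mult[OF 2]) (use assms in simp)
  then have "ceq H (y [^] n \<otimes> ?c \<otimes> inv (y [^] n)) ?c" using assms by (simp add: m_assoc)
  with Suc have "ceq H (comm x (y [^] n) \<otimes> (y [^] n \<otimes> ?c \<otimes> inv (y [^] n))) (?c [^] n \<otimes> ?c)"
    by (rule ceq_mult)
  then show ?case using assms by (simp add: comm_mult_right)
qed

lemma (in group) normalI_conj:
  assumes "subgroup N G" "\<And>g h. g \<in> carrier G \<Longrightarrow> h \<in> N \<Longrightarrow> g \<otimes> h \<otimes> inv g \<in> N"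
  shows "N \<lhd> G"
  using assms normal_inv_iff by blast

section \<open>Centralizers modulo a subgroup and the upper central series\<close>

context group
begin

text \<open>The centralizer of \<open>M\<close> modulo \<open>N\<close>. The upper central series
  and the filtration used later arise from it by iteration and intersection, so normality,
  closedness and discreteness only have to be checked for these two operations.\<close>

definition cent :: "'a set \<Rightarrow> 'a set \<Rightarrow> 'a set" where
  "cent M N = {x \<in> carrier G. \<forall>m\<in>M. comm x m \<in> N}"

lemma cent_subgroup:
  assumes "M \<subseteq> carrier G" "N \<lhd> G" shows "subgroup (cent M N) G"
proof
  interpret N: normal N G by fact
  show "cent M N \<subseteq> carrier G" by (auto simp: cent_def)
  show "\<one> \<in> cent M N" using assms(1) by (auto simp: cent_def)
  fix x y assume "x \<in> cent M N" "y \<in> cent M N"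
  then show "x \<otimes> y \<in> cent M N"
    using assms(1) by (auto simp: cent_def comm_mult_left subset_iff intro!: N.mem_mult N.conj_mem)
next
  interpret N: normal N G by fact
  fix x assume x: "x \<in> cent M N"
  have "inv x \<otimes> inv (comm x m) \<otimes> inv (inv x) \<in> N" if "m \<in> M" for m
    using x that by (intro N.conj_mem) (auto simp: cent_def)
  then show "inv x \<in> cent M N"
    using x assms(1) by (auto simp: cent_def comm_inv_left subset_iff)
qed

lemma cent_normal:
  assumes "M \<lhd> G" "N \<lhd> G" shows "cent M N \<lhd> G"
proof (rule normalI_conj)
  interpret M: normal M G by fact
  interpret N: normal N G by fact
  show "subgroup (cent M N) G" by (rule cent_subgroup[OF M.subset \<open>N \<lhd> G\<close>])
  fix g h assume g: "g \<in> carrier G" and h: "h \<in> cent M N"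
  have "comm (g \<otimes> h \<otimes> inv g) m \<in> N" if m: "m \<in> M" for m
  proof -
    have "inv g \<otimes> m \<otimes> g \<in> M" using g m by (simp add: M.inv_op_closed1)
    then have "g \<otimes> comm h (inv g \<otimes> m \<otimes> g) \<otimes> inv g \<in> N"
      using g h by (intro N.conj_mem) (auto simp: cent_def)
    moreover have "h \<in> carrier G" "m \<in> carrier G" using h m by (auto simp: cent_def)
    ultimately show ?thesis using g by (simp add: comm_def m_assoc inv_mult_group)
  qed
  then show "g \<otimes> h \<otimes> inv g \<in> cent M N" using g h by (auto simp: cent_def)
qed

lemma normal_Int: "M \<lhd> G \<Longrightarrow> N \<lhd> G \<Longrightarrow> M \<inter> N \<lhd> G"
  by (simp add: normal_inv_iff subgroups_Inter_pair)

lemma trivial_normal: "{\<one>} \<lhd> G"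
  by (rule normalI_conj) (auto simp: triv_subgroup)

primrec uc :: "nat \<Rightarrow> 'a set" where
  "uc 0 = {\<one>}"
| "uc (Suc i) = cent (carrier G) (uc i)"

lemma uc_normal: "uc i \<lhd> G"
  by (induction i) (auto intro: cent_normal trivial_normal normal_self)

lemma uc_carrier: "uc i \<subseteq> carrier G"
  by (metis uc_normal normal_inv_iff subgroup.subset)

lemma uc_comm: "x \<in> uc (Suc i) \<Longrightarrow> y \<in> carrier G \<Longrightarrow> comm x y \<in> uc i"
  by (simp add: cent_def)

lemma uc_comm': "x \<in> uc i \<Longrightarrow> y \<in> carrier G \<Longrightarrow> comm x y \<in> uc (i - 1)"
  by (cases i) (auto simp: cent_def)

lemma uc_Suc: "uc i \<subseteq> uc (Suc i)"
proof
  interpret normal "uc i" G by (rule uc_normal)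
  fix x assume "x \<in> uc i" then show "x \<in> uc (Suc i)" by (auto simp: cent_def intro: comm_mem_left)
qed

lemma uc_mono: "i \<le> j \<Longrightarrow> uc i \<subseteq> uc j"
  using uc_Suc lift_Suc_mono_le[of uc] by blast

text \<open>Induction from the trivial end: commutators of an element of \<open>L j\<close> lie in
  \<open>L (Suc j)\<close>, which is already inside \<open>uc i\<close>. The two series put the
  varying element on opposite sides of the commutator, hence the passage to the inverse.\<close>

lemma lower_central_le_uc:
  assumes "\<And>n. L n \<subseteq> carrier G" "L d \<subseteq> {\<one>}"
    and "\<And>n x y. x \<in> carrier G \<Longrightarrow> y \<in> L n \<Longrightarrow> comm x y \<in> L (Suc n)"
  shows "i + j = d \<Longrightarrow> L j \<subseteq> uc i"
proof (induction i arbitrary: j)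
  case 0 then show ?case using assms by auto
next
  case (Suc i)
  interpret normal "uc i" G by (rule uc_normal)
  show ?case
  proof
    fix x assume x: "x \<in> L j"
    have xc: "x \<in> carrier G" using x assms(1) by blast
    have "comm x y \<in> uc i" if y: "y \<in> carrier G" for y
    proof -
      have "comm y x \<in> uc i" using assms(3)[OF y x] Suc by auto
      then show ?thesis using inv_comm[OF y xc] m_inv_closed by metis
    qed
    then show "x \<in> uc (Suc i)" using xc by (simp add: cent_def)
  qed
qed

lemma commutator_subgroup_eq:
  "commutator_subgroup G H K = generate G {comm h k | h k. h \<in> H \<and> k \<in> K}"
  by (simp add: commutator_subgroup_def comm_def)

lemma commutator_subgroup_carrier:
  "H \<subseteq> carrier G \<Longrightarrow> K \<subseteq> carrier G \<Longrightarrow> commutator_subgroup G H K \<subseteq> carrier G"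
  unfolding commutator_subgroup_eq by (rule generate_incl) auto

lemma commutator_subgroup_incl:
  "h \<in> H \<Longrightarrow> k \<in> K \<Longrightarrow> comm h k \<in> commutator_subgroup G H K"
  unfolding commutator_subgroup_eq by (rule generate.incl) auto

lemma lower_central_carrier: "lower_central G n \<subseteq> carrier G"
  by (induction n) (auto dest!: commutator_subgroup_carrier[OF subset_refl])

lemma nilpotent_imp_uc:
  assumes "nilpotent d G" shows "uc d = carrier G"
proof -
  have "lower_central G 0 \<subseteq> uc d"
    by (rule lower_central_le_uc[where d=d])
      (use assms in \<open>auto simp: nilpotent_def lower_central_carrier[THEN subsetD] intro: commutator_subgroup_incl\<close>)
  then show ?thesis using uc_carrier by auto
qed

text \<open>The sequence \<open>a\<close>, \<open>[a, m]\<close>, \<open>[[a, m], m]\<close>, ...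
  reaches the unit by nilpotency and is then climbed backwards. Once \<open>e (Suc (Suc r))\<close>
  lies in \<open>N\<close>, the power \<open>e (Suc r) [^] n\<close> is congruent to
  \<open>comm (e r) (m [^] n)\<close>, hence to an element of \<open>P\<close>, for every
  \<open>n\<close>; so \<open>e (Suc r)\<close> lies in \<open>N\<close>. In applications
  \<open>P\<close> is a neighbourhood of the unit without nontrivial subgroups modulo
  \<open>N\<close>.\<close>

lemma Engel:
  assumes N: "N \<lhd> G" and nil: "uc d = carrier G"
    and a: "a \<in> carrier G" and m: "m \<in> carrier G"
    and e: "\<And>r. e r = ((\<lambda>x. comm x m) ^^ r) a"
    and P: "\<And>x. x \<in> carrier G \<Longrightarrow> (\<And>n::nat. \<exists>y\<in>P. ceq N (x [^] n) y) \<Longrightarrow> x \<in> N"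
    and *: "\<And>r n::nat. r < d \<Longrightarrow> \<exists>y\<in>P. ceq N (comm (e r) (m [^] n)) y"
  shows "comm a m \<in> N"
proof -
  interpret normal N G by fact
  have ec: "e r \<in> carrier G" for r unfolding e by (induction r) (use a m in auto)
  have es: "e (Suc r) = comm (e r) m" for r by (simp add: e)
  have eu: "e r \<in> uc (d - r)" for r
  proof (induction r)
    case 0 then show ?case using a nil by (simp add: e)
  next
    case (Suc r) then show ?case using uc_comm'[OF Suc m] es[of r] by (metis diff_Suc_eq_diff_pred diff_commute)
  qed
  have step: "e (Suc r) \<in> N" if "e (Suc (Suc r)) \<in> N" "r < d" for r
  proof (rule P)
    show "e (Suc r) \<in> carrier G" by (rule ec)
    fix n :: nat
    obtain y where y: "y \<in> P" "ceq N (comm (e r) (m [^] n)) y" using * \<open>r < d\<close> by blast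
    have "ceq N (comm (e r) (m [^] n)) (comm (e r) m [^] n)"
      using that ec m by (intro comm_pow_right) (simp_all add: es)
    then show "\<exists>y\<in>P. ceq N (e (Suc r) [^] n) y"
      using y ceq_trans ceq_sym unfolding es by meson
  qed
  \<comment> \<open>The descent starts one step beyond the class: \<open>e (Suc d)\<close> lies in
    \<open>uc 0\<close>. At \<open>k = d\<close> it arrives at \<open>e (Suc 0)\<close>, which is
    \<open>comm a m\<close>.\<close>
  have "e (Suc (d - k)) \<in> N" if "k \<le> d" for k
    using that
  proof (induction k)
    case 0
    have "e (Suc d) \<in> uc 0" using eu[of "Suc d"] by simp
    then show ?case by simp
  next
    case (Suc k)
    then have "Suc (d - Suc k) = d - k" by simp
    then show ?case using step[of "d - Suc k"] Suc by simp
  qed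
  from this[of d] show ?thesis using es[of 0] by (simp add: e)
qed

end

section \<open>Subgroups of finitely generated nilpotent groups\<close>

lemma int_subgroup_cyclic:
  fixes A :: "int set"
  assumes "0 \<in> A" and diff: "\<And>a b. a \<in> A \<Longrightarrow> b \<in> A \<Longrightarrow> a - b \<in> A"
  obtains m where "m \<in> A" "\<And>a. a \<in> A \<Longrightarrow> m dvd a"
proof (cases "\<exists>a\<in>A. a > 0")
  case False
  then have "a = 0" if "a \<in> A" for a
    using diff[OF \<open>0 \<in> A\<close> that] that by (metis diff_0 neg_0_less_iff_less linorder_neqE_linordered_idom)
  then show thesis using that[of 0] assms(1) by auto
next
  case True
  define m where "m = (LEAST n. n > 0 \<and> int n \<in> A)"
  obtain a where "a \<in> A" "a > 0" using True by blast
  then have ex: "nat a > 0 \<and> int (nat a) \<in> A" by simp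
  have m: "m > 0" "int m \<in> A" unfolding m_def using LeastI[of "\<lambda>n. n > 0 \<and> int n \<in> A" "nat a"] ex by auto
  have least: "m \<le> n" if "n > 0" "int n \<in> A" for n
    unfolding m_def using that by (auto intro: Least_le)
  have add: "a + b \<in> A" if "a \<in> A" "b \<in> A" for a b
    using diff[OF that(1) diff[OF assms(1) that(2)]] by simp
  have mult: "int m * k \<in> A" for k
  proof (induction k rule: int_induct[where k = 0])
    case (step1 i) then show ?case using add m(2) by (simp add: distrib_left)
  next
    case (step2 i) then show ?case using diff m(2) by (simp add: right_diff_distrib)
  qed (use assms in simp)
  show thesis
  proof (rule that[of "int m"])
    fix a assume a: "a \<in> A"
    have 1: "a mod int m \<in> A"
      using diff[OF a mult[of "a div int m"]] by (simp add: minus_mult_div_eq_mod)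
    have 2: "0 \<le> a mod int m" "a mod int m < int m" using m by simp_all
    have "\<not> 0 < a mod int m"
    proof
      assume pos: "0 < a mod int m"
      then have "m \<le> nat (a mod int m)" using 1 by (intro least) auto
      then show False using 2 pos by linarith
    qed
    then have "a mod int m = 0" using 2 by linarith
    then show "int m dvd a" by auto
  qed (rule m)
qed

context group
begin

definition fin_gen :: "'a set \<Rightarrow> bool" where
  "fin_gen H \<longleftrightarrow> (\<exists>A. finite A \<and> A \<subseteq> H \<and> H = generate G A)"

text \<open>The maximal condition on subgroups in the form of finite generation. \<open>P\<close>
  may be any set, so the property passes trivially to subsets.\<close>

definition noetherian :: "'a set \<Rightarrow> bool" where
  "noetherian P \<longleftrightarrow> (\<forall>H. subgroup H G \<and> H \<subseteq> P \<longrightarrow> fin_gen H)"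

text \<open>Extension by a cyclic group. The exponents of \<open>x\<close> occurring in
  \<open>H\<close> form a subgroup of the integers, generated by some \<open>m\<close>. An element
  \<open>y\<close> of \<open>H\<close> with exponent \<open>m\<close>, together with generators of
  \<open>H \<inter> P\<close>, generates \<open>H\<close>, because every \<open>h\<close> in
  \<open>H\<close> differs from a power of \<open>y\<close> by an element of
  \<open>P\<close>.\<close>

lemma noetherian_step:
  assumes P: "P \<lhd> G" and noe: "noetherian P" and x: "x \<in> carrier G"
    and Q: "\<And>q. q \<in> Q \<Longrightarrow> \<exists>a::int. \<exists>p\<in>P. q = x [^] a \<otimes> p"
  shows "noetherian Q"
  unfolding noetherian_def
proof (intro allI impI, elim conjE)
  fix H assume H: "subgroup H G" and HQ: "H \<subseteq> Q"
  interpret P: normal P G by fact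
  interpret H: subgroup H G by fact
  define A where "A = {a::int. \<exists>p\<in>P. x [^] a \<otimes> p \<in> H}"
  have "0 \<in> A" using P.one_closed by (auto simp: A_def intro!: bexI[of _ \<one>])
  moreover have "a - b \<in> A" if ab: "a \<in> A" "b \<in> A" for a b
  proof -
    obtain p q where p: "p \<in> P" "x [^] a \<otimes> p \<in> H" and q: "q \<in> P" "x [^] b \<otimes> q \<in> H"
      using ab by (auto simp: A_def)
    have pc: "p \<in> carrier G" "q \<in> carrier G" using p q P.mem_carrier by auto
    have "x [^] a \<otimes> p \<otimes> inv (x [^] b \<otimes> q) \<in> H" using p q H.m_closed by blast
    moreover have "x [^] a \<otimes> p \<otimes> inv (x [^] b \<otimes> q) = x [^] (a - b) \<otimes> (x [^] b \<otimes> (p \<otimes> inv q) \<otimes> inv (x [^] b))"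
      using x pc by (simp add: inv_mult_group m_assoc int_pow_diff)
    moreover have "x [^] b \<otimes> (p \<otimes> inv q) \<otimes> inv (x [^] b) \<in> P"
      using p q x by (intro P.conj_mem P.mem_mult) auto
    ultimately show ?thesis by (auto simp: A_def)
  qed
  ultimately obtain m where m: "m \<in> A" "\<And>a. a \<in> A \<Longrightarrow> m dvd a" using int_subgroup_cyclic by metis
  obtain p where p: "p \<in> P" "x [^] m \<otimes> p \<in> H" using m(1) by (auto simp: A_def)
  define y where "y = x [^] m \<otimes> p"
  have y: "y \<in> H" using p by (simp add: y_def)
  have yc: "y \<in> carrier G" by (rule H.mem_carrier[OF y])
  have pc: "p \<in> carrier G" by (rule P.mem_carrier[OF p(1)])
  have "fin_gen (H \<inter> P)"
    using noe H P.subgroup_axioms by (auto simp: noetherian_def subgroups_Inter_pair)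
  then obtain B where B: "finite B" "B \<subseteq> H \<inter> P" "H \<inter> P = generate G B" by (auto simp: fin_gen_def)
  have gen: "subgroup (generate G (insert y B)) G"
    using B y H.subset by (intro generate_is_subgroup) auto
  interpret S: subgroup "generate G (insert y B)" G by fact
  have yS: "y \<in> generate G (insert y B)" by (rule generate.incl) simp
  have BS: "H \<inter> P \<subseteq> generate G (insert y B)" using B(3) mono_generate[of B "insert y B"] by auto
  have ypow: "ceq P (y [^] k) (x [^] (m * k))" for k :: int
  proof -
    have 1: "ceq P y (x [^] m)" unfolding y_def using x p by (intro P.ceq_mult_right) auto
    have n: "ceq P (y [^] (n::nat)) ((x [^] m) [^] n)" for n
      by (induction n) (use 1 x in \<open>auto intro: P.ceq_mult\<close>)
    show ?thesis
    proof (cases k)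
      case (nonneg n)
      have "y [^] k = y [^] n" "x [^] (m * k) = (x [^] m) [^] n"
        using int_pow_pow[OF x, of m k] by (simp_all add: nonneg int_pow_int)
      then show ?thesis using n[of n] by simp
    next
      case (neg n)
      have "y [^] k = inv (y [^] Suc n)" "x [^] (m * k) = inv ((x [^] m) [^] Suc n)"
        using int_pow_neg_int[OF yc, of "Suc n"] int_pow_neg_int[OF int_pow_closed[OF x], of m "Suc n"]
          int_pow_pow[OF x, of m k] by (simp_all add: neg)
      then show ?thesis using P.ceq_inv[OF n[of "Suc n"]] by simp
    qed
  qed
  have "H \<subseteq> generate G (insert y B)"
  proof
    fix h assume h: "h \<in> H"
    obtain a q where q: "q \<in> P" "h = x [^] (a::int) \<otimes> q" using Q h HQ by blast
    have "a \<in> A" using q h by (auto simp: A_def)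
    then obtain k where k: "a = m * k" using m(2) by blast
    have hc: "h \<in> carrier G" by (rule H.mem_carrier[OF h])
    have "ceq P h (x [^] a)" unfolding q(2) using x q by (intro P.ceq_mult_right) auto
    then have "ceq P h (y [^] k)" using ypow[of k] P.ceq_trans P.ceq_sym unfolding k by blast
    then have "h \<otimes> inv (y [^] k) \<in> P" by (simp add: ceq_def)
    moreover have "y [^] k \<in> H" using y H by (simp add: subgroup_int_pow_closed)
    then have "h \<otimes> inv (y [^] k) \<in> H" using h by (meson H.m_closed H.m_inv_closed)
    ultimately have "h \<otimes> inv (y [^] k) \<in> generate G (insert y B)" using BS by blast
    moreover have "y [^] k \<in> generate G (insert y B)" using yS gen by (simp add: subgroup_int_pow_closed)
    ultimately have "h \<otimes> inv (y [^] k) \<otimes> y [^] k \<in> generate G (insert y B)" by (rule S.m_closed)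
    then show "h \<in> generate G (insert y B)" using hc yc by (simp add: m_assoc)
  qed
  moreover have "generate G (insert y B) \<subseteq> H"
    using y B H by (intro generate_subgroup_incl) auto
  ultimately show "fin_gen H" using y B unfolding fin_gen_def
    by (intro exI[of _ "insert y B"]) auto
qed

lemma lower_central_normal: "lower_central G n \<lhd> G"
proof (induction n)
  case 0 then show ?case by (simp add: normal_self)
next
  case (Suc n)
  interpret normal "lower_central G n" G by fact
  show ?case unfolding lower_central.simps commutator_subgroup_eq
  proof (rule normal_generateI)
    show "{comm h k |h k. h \<in> carrier G \<and> k \<in> lower_central G n} \<subseteq> carrier G" by auto
    fix h g assume h: "h \<in> {comm h k |h k. h \<in> carrier G \<and> k \<in> lower_central G n}" and g: "g \<in> carrier G"
    obtain a k where ak: "h = comm a k" "a \<in> carrier G" "k \<in> lower_central G n" using h by blast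
    have "g \<otimes> h \<otimes> inv g = comm (g \<otimes> a \<otimes> inv g) (g \<otimes> k \<otimes> inv g)"
      unfolding ak(1) using g ak by (intro comm_conj) auto
    then show "g \<otimes> h \<otimes> inv g \<in> {comm h k |h k. h \<in> carrier G \<and> k \<in> lower_central G n}"
      using g ak(2) conj_mem[OF g ak(3)] m_closed inv_closed by (intro CollectI exI[of _ "g \<otimes> a \<otimes> inv g"] exI[of _ "g \<otimes> k \<otimes> inv g"] conjI) simp_all
  qed
qed

lemma lower_central_comm:
  "x \<in> carrier G \<Longrightarrow> y \<in> lower_central G n \<Longrightarrow> comm x y \<in> lower_central G (Suc n)"
  by (simp add: commutator_subgroup_incl)

lemma lower_central_Suc: "lower_central G (Suc n) \<subseteq> lower_central G n"
proof -
  interpret normal "lower_central G n" G by (rule lower_central_normal)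
  show ?thesis unfolding lower_central.simps commutator_subgroup_eq
    by (rule generate_subgroup_incl) (auto intro: comm_mem_right subgroup_axioms)
qed

text \<open>Conjugation by \<open>g\<close> multiplies \<open>h\<close> by \<open>comm g h\<close>,
  which already lies in the next term.\<close>

lemma generate_over_lower_central_normal:
  assumes "B \<subseteq> lower_central G n"
  shows "generate G (B \<union> lower_central G (Suc n)) \<lhd> G"
proof (rule normalI_conj)
  interpret L: normal "lower_central G n" G by (rule lower_central_normal)
  let ?P = "generate G (B \<union> lower_central G (Suc n))"
  have sub: "B \<union> lower_central G (Suc n) \<subseteq> lower_central G n" using assms lower_central_Suc by auto
  show P: "subgroup ?P G"
    by (rule generate_is_subgroup) (use sub L.subset in blast)
  interpret P: subgroup ?P G by fact
  have PL: "?P \<subseteq> lower_central G n" by (rule generate_subgroup_incl[OF sub L.subgroup_axioms])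
  fix g h assume g: "g \<in> carrier G" and h: "h \<in> ?P"
  have "comm g h \<in> lower_central G (Suc n)" using g h PL lower_central_comm by blast
  then have "comm g h \<in> ?P" by (intro generate.incl) simp
  then have "comm g h \<otimes> h \<in> ?P" using h by (rule P.m_closed)
  then show "g \<otimes> h \<otimes> inv g \<in> ?P" using conj_eq_comm g P.mem_carrier[OF h] by simp
qed

text \<open>If \<open>B\<close> generates one term modulo the next, the finitely many commutators of
  \<open>A\<close> with \<open>B\<close> do so one level down. Let \<open>?P\<close> be generated by
  them and the term after. For fixed \<open>b\<close>, commuting with \<open>b\<close> modulo
  \<open>?P\<close> is a subgroup condition on \<open>g\<close> that holds on \<open>A\<close>,
  hence everywhere; then commuting with the whole group is one on \<open>k\<close> that holds on
  \<open>B\<close> and on the next term.\<close>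

lemma lower_central_fin_gen:
  assumes "finite A" "A \<subseteq> carrier G" "carrier G = generate G A"
  shows "\<exists>B. finite B \<and> B \<subseteq> lower_central G n \<and> lower_central G n \<subseteq> generate G (B \<union> lower_central G (Suc n))"
proof (induction n)
  case 0
  have "carrier G \<subseteq> generate G (A \<union> lower_central G (Suc 0))"
    unfolding assms(3) by (rule mono_generate) auto
  then show ?case using assms by (auto intro!: exI[of _ A])
next
  case (Suc n)
  then obtain B where B: "finite B" "B \<subseteq> lower_central G n"
    "lower_central G n \<subseteq> generate G (B \<union> lower_central G (Suc n))" by blast
  define C where "C = (\<lambda>(a,b). comm a b) ` (A \<times> B)"
  let ?P = "generate G (C \<union> lower_central G (Suc (Suc n)))"
  have C: "finite C" "C \<subseteq> lower_central G (Suc n)"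
    using assms(1,2) B(1,2) lower_central_comm by (auto simp: C_def subset_iff simp del: lower_central.simps)
  interpret P: normal ?P G by (rule generate_over_lower_central_normal[OF C(2)])
  have Pi: "C \<subseteq> ?P" "lower_central G (Suc (Suc n)) \<subseteq> ?P" by (auto intro: generate.incl)
  have Bc: "B \<subseteq> carrier G" using B lower_central_carrier by blast
  have "carrier G \<subseteq> cent B ?P" unfolding assms(3)
    by (rule generate_subgroup_incl[OF _ cent_subgroup[OF Bc P.normal_axioms]])
      (use Pi assms in \<open>auto simp: cent_def C_def\<close>)
  then have AB: "comm g b \<in> ?P" if "g \<in> carrier G" "b \<in> B" for g b using that by (auto simp: cent_def)
  have "B \<subseteq> cent (carrier G) ?P"
    using AB Bc P.m_inv_closed inv_comm by (fastforce simp: cent_def)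
  moreover have "lower_central G (Suc n) \<subseteq> cent (carrier G) ?P"
  proof
    fix k assume k: "k \<in> lower_central G (Suc n)"
    have kc: "k \<in> carrier G" using k lower_central_carrier by blast
    have "comm k g \<in> ?P" if g: "g \<in> carrier G" for g
    proof -
      have "comm g k \<in> ?P" using lower_central_comm[OF g k] Pi by blast
      then show ?thesis using P.m_inv_closed inv_comm[OF g kc] by metis
    qed
    then show "k \<in> cent (carrier G) ?P" using kc by (simp add: cent_def)
  qed
  ultimately have "generate G (B \<union> lower_central G (Suc n)) \<subseteq> cent (carrier G) ?P"
    by (intro generate_subgroup_incl cent_subgroup P.normal_axioms) auto
  then have all: "comm k g \<in> ?P" if "k \<in> lower_central G n" "g \<in> carrier G" for k g
    using that B by (auto simp: cent_def)
  have "lower_central G (Suc n) \<subseteq> ?P"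
    unfolding lower_central.simps(2)[of G n] commutator_subgroup_eq
  proof (rule generate_subgroup_incl[OF _ P.subgroup_axioms], clarify)
    fix h k assume h: "h \<in> carrier G" and k: "k \<in> lower_central G n"
    have kc: "k \<in> carrier G" using k lower_central_carrier by blast
    show "comm h k \<in> ?P" using all[OF k h] P.m_inv_closed inv_comm[OF kc h] by metis
  qed
  then show ?case using C by blast
qed

text \<open>Finitely generated nilpotent groups are polycyclic: the lower central series is climbed
  from its trivial end, and between two terms the generators are adjoined one at a time, each
  adjunction being an instance of \<open>noetherian_step\<close>.\<close>

lemma fin_gen_nilpotent_subgroup:
  assumes "finite A" "A \<subseteq> carrier G" "carrier G = generate G A" "lower_central G d = {\<one>}"
    and "subgroup H G"
  shows "fin_gen H"
proof -
  have "noetherian (lower_central G (d - n))" if "n \<le> d" for n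
    using that
  proof (induction n)
    case 0
    have "fin_gen K" if "subgroup K G" "K \<subseteq> {\<one>}" for K
    proof -
      have "K = generate G {}" using that subgroup.one_closed[OF that(1)] generate_empty by auto
      then show ?thesis by (auto simp: fin_gen_def)
    qed
    then show ?case by (simp add: noetherian_def assms(4))
  next
    case (Suc n)
    define m where "m = d - Suc n"
    have m: "Suc m = d - n" using Suc by (simp add: m_def)
    then have noe: "noetherian (lower_central G (Suc m))" using Suc by simp
    obtain B where B: "finite B" "B \<subseteq> lower_central G m" "lower_central G m \<subseteq> generate G (B \<union> lower_central G (Suc m))"
      using lower_central_fin_gen assms by metis
    have "noetherian (generate G (B \<union> lower_central G (Suc m)))"
      using B(1,2)
    proof (induction B)
      case empty
      have "generate G (lower_central G (Suc m)) \<subseteq> lower_central G (Suc m)"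
        by (rule generate_subgroup_incl[OF subset_refl]) (metis lower_central_normal normal_inv_iff)
      then show ?case using noe by (auto simp: noetherian_def simp del: lower_central.simps)
    next
      case (insert x B)
      let ?P = "generate G (B \<union> lower_central G (Suc m))"
      have x: "x \<in> carrier G" and BL: "B \<subseteq> lower_central G m" using insert lower_central_carrier by blast+
      interpret P: normal ?P G by (rule generate_over_lower_central_normal[OF BL])
      let ?Q = "{q. \<exists>a::int. \<exists>p\<in>?P. q = x [^] a \<otimes> p}"
      have Q: "subgroup ?Q G"
      proof
        show "?Q \<subseteq> carrier G" using x by auto
        show "\<one> \<in> ?Q" using P.one_closed by (auto intro!: exI[of _ "0::int"] bexI[of _ \<one>])
        fix u v assume "u \<in> ?Q" "v \<in> ?Q"
        then obtain a b p q where u: "p \<in> ?P" "u = x [^] (a::int) \<otimes> p" and v: "q \<in> ?P" "v = x [^] (b::int) \<otimes> q" by blast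
        have c: "p \<in> carrier G" "q \<in> carrier G" using u v by auto
        have "u \<otimes> v = x [^] (a + b) \<otimes> ((inv (x [^] b) \<otimes> p \<otimes> inv (inv (x [^] b))) \<otimes> q)"
          using x c u v by (simp add: m_assoc int_pow_mult)
        moreover have "(inv (x [^] b) \<otimes> p \<otimes> inv (inv (x [^] b))) \<otimes> q \<in> ?P"
          using u v x by (intro P.mem_mult P.conj_mem) auto
        ultimately show "u \<otimes> v \<in> ?Q" by blast
      next
        fix u assume "u \<in> ?Q"
        then obtain a p where u: "p \<in> ?P" "u = x [^] (a::int) \<otimes> p" by blast
        have c: "p \<in> carrier G" using u by auto
        have "inv u = x [^] (- a) \<otimes> (x [^] a \<otimes> inv p \<otimes> inv (x [^] a))"
          using x c u by (simp add: m_assoc inv_mult_group int_pow_neg)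
        moreover have "x [^] a \<otimes> inv p \<otimes> inv (x [^] a) \<in> ?P"
          by (rule P.conj_mem[OF int_pow_closed[OF x] P.m_inv_closed[OF u(1)]])
        ultimately show "inv u \<in> ?Q" by blast
      qed
      have "y \<in> ?Q" if "y \<in> insert x B \<union> lower_central G (Suc m)" for y
      proof (cases "y = x")
        case True
        then show ?thesis using x P.one_closed by (auto intro!: exI[of _ "1::int"] bexI[of _ \<one>])
      next
        case False
        then have "y \<in> ?P" using that by (auto intro: generate.incl)
        then show ?thesis by (auto intro!: exI[of _ "0::int"] bexI[of _ y])
      qed
      then have "generate G (insert x B \<union> lower_central G (Suc m)) \<subseteq> ?Q"
        by (intro generate_subgroup_incl[OF _ Q]) blast
      moreover have "noetherian ?P" using insert by simp
      ultimately show ?case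
        using noetherian_step[OF P.normal_axioms _ x, of "generate G (insert x B \<union> lower_central G (Suc m))"] by (blast dest: subsetD)
    qed
    then have "noetherian (lower_central G m)" using B(3) unfolding noetherian_def by blast
    then show ?case by (simp add: m_def)
  qed
  from this[of d] have "noetherian (carrier G)" by simp
  then show ?thesis using assms(5) subgroup.subset by (auto simp: noetherian_def)
qed

end

section \<open>Cube groups of a filtration\<close>

locale filtration = group G for G (structure) +
  fixes F :: "nat \<Rightarrow> 'a set"
  assumes F_subgroup: "subgroup (F i) G"
    and F_Suc: "F (Suc i) \<subseteq> F i"
    and F_zero: "F 0 = carrier G"
    and F_comm: "\<And>i j x y. x \<in> F i \<Longrightarrow> y \<in> F j \<Longrightarrow> comm x y \<in> F (i + j)"
begin

text \<open>The derivative in direction \<open>d\<close>. It is taken on the right, so for a cube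
  the upper face is the lower face times \<open>diff d p\<close>, whose degree (the index
  \<open>i\<close> in \<open>hk d i\<close>) is one higher.\<close>

definition diff :: "nat \<Rightarrow> (nat set \<Rightarrow> 'a) \<Rightarrow> nat set \<Rightarrow> 'a" where
  "diff d p \<omega> = inv (p \<omega>) \<otimes> p (insert d \<omega>)"

text \<open>\<open>hk d i p\<close> says that \<open>p\<close> is a Host--Kra cube of dimension \<open>d\<close> for the filtration \<open>F\<^bsub>i\<^esub> \<supseteq> F\<^bsub>i+1\<^esub> \<supseteq> \<dots>\<close>.
  Vertices are subsets of \<open>{..<d}\<close>; the values of \<open>p\<close> at other sets only have to lie in the group.\<close>

primrec hk :: "nat \<Rightarrow> nat \<Rightarrow> (nat set \<Rightarrow> 'a) \<Rightarrow> bool" where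
  "hk 0 i p \<longleftrightarrow> (\<forall>\<omega>. p \<omega> \<in> carrier G) \<and> p {} \<in> F i"
| "hk (Suc d) i p \<longleftrightarrow> hk d i p \<and> hk d (Suc i) (diff d p)"

lemma F_carrier: "x \<in> F i \<Longrightarrow> x \<in> carrier G"
  using F_subgroup subgroup.subset by blast

lemma hk_carrier [simp]: "hk d i p \<Longrightarrow> p \<omega> \<in> carrier G"
  by (induction d arbitrary: i p) auto

lemma hk_Suc_mono: "hk d (Suc i) p \<Longrightarrow> hk d i p"
  by (induction d arbitrary: i p) (use F_Suc in auto)

lemma hk_zero_mono: "hk d i p \<Longrightarrow> hk d 0 p"
  by (induction i) (auto dest: hk_Suc_mono)

lemma hk_cong:
  "hk d i p \<Longrightarrow> (\<And>\<omega>. \<omega> \<subseteq> {..<d} \<Longrightarrow> q \<omega> = p \<omega>) \<Longrightarrow> (\<And>\<omega>. q \<omega> \<in> carrier G) \<Longrightarrow> hk d i q"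
proof (induction d arbitrary: i p q)
  case (Suc d)
  have 1: "hk d i q"
    by (rule Suc.IH[of i p]) (use Suc.prems in \<open>auto simp: lessThan_Suc\<close>)
  have "hk d (Suc i) (diff d q)"
  proof (rule Suc.IH[of "Suc i" "diff d p"])
    fix \<omega> assume "\<omega> \<subseteq> {..<d}"
    then have "\<omega> \<subseteq> {..<Suc d}" "insert d \<omega> \<subseteq> {..<Suc d}" by (auto simp: lessThan_Suc)
    then have "q \<omega> = p \<omega>" "q (insert d \<omega>) = p (insert d \<omega>)" using Suc.prems(2) by blast+
    then show "diff d q \<omega> = diff d p \<omega>" by (simp add: diff_def)
  qed (use Suc.prems in \<open>auto simp: diff_def[of d q]\<close>)
  with 1 show ?case by simp
qed auto

text \<open>The three closure properties must be carried through the induction together: the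
  derivative of a product is a product of derivatives up to conjugation, conjugation is
  multiplication by a commutator, and the derivative of a commutator is built from commutators
  involving one derivative, whose degree is one higher.\<close>

lemma hk_group:
  "(\<forall>i p q. hk d i p \<longrightarrow> hk d i q \<longrightarrow> hk d i (\<lambda>\<omega>. p \<omega> \<otimes> q \<omega>)) \<and>
   (\<forall>i p. hk d i p \<longrightarrow> hk d i (\<lambda>\<omega>. inv (p \<omega>))) \<and>
   (\<forall>i j p q. hk d i p \<longrightarrow> hk d j q \<longrightarrow> hk d (i + j) (\<lambda>\<omega>. comm (p \<omega>) (q \<omega>)))"
proof (induction d)
  case 0
  show ?case
    by (auto intro: F_comm subgroup.m_closed[OF F_subgroup] subgroup.m_inv_closed[OF F_subgroup])
next
  case (Suc d)
  have mult: "hk d i (\<lambda>\<omega>. p \<omega> \<otimes> q \<omega>)" if "hk d i p" "hk d i q" for i p q using Suc that by blast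
  have inv: "hk d i (\<lambda>\<omega>. inv (p \<omega>))" if "hk d i p" for i p using Suc that by blast
  have com: "hk d (i + j) (\<lambda>\<omega>. comm (p \<omega>) (q \<omega>))" if "hk d i p" "hk d j q" for i j p q using Suc that by blast
  \<comment> \<open>Conjugation preserves the degree of \<open>u\<close>: the conjugating cube is
    regarded as one of degree \<open>0\<close>, so its commutator with \<open>u\<close> has degree
    \<open>0 + i\<close>.\<close>
  have conj: "hk d i (\<lambda>\<omega>. p \<omega> \<otimes> u \<omega> \<otimes> inv (p \<omega>))" if p: "hk d j p" and u: "hk d i u" for i j p u
  proof -
    have "hk d i (\<lambda>\<omega>. comm (p \<omega>) (u \<omega>) \<otimes> u \<omega>)"
      using mult[OF com[OF hk_zero_mono[OF p] u, simplified] u] .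
    moreover have "(\<lambda>\<omega>. comm (p \<omega>) (u \<omega>) \<otimes> u \<omega>) = (\<lambda>\<omega>. p \<omega> \<otimes> u \<omega> \<otimes> inv (p \<omega>))"
      using p u conj_eq_comm hk_carrier by metis
    ultimately show ?thesis by simp
  qed
  have m: "hk (Suc d) i (\<lambda>\<omega>. p \<omega> \<otimes> q \<omega>)" if p: "hk (Suc d) i p" and q: "hk (Suc d) i q" for i p q
  proof -
    have p1: "hk d i p" "hk d (Suc i) (diff d p)" and q1: "hk d i q" "hk d (Suc i) (diff d q)" using p q by auto
    have "hk d (Suc i) (\<lambda>\<omega>. inv (q \<omega>) \<otimes> diff d p \<omega> \<otimes> inv (inv (q \<omega>)) \<otimes> diff d q \<omega>)"
      by (rule mult[OF conj[OF inv[OF q1(1)] p1(2)] q1(2)])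
    moreover have "(\<lambda>\<omega>. inv (q \<omega>) \<otimes> diff d p \<omega> \<otimes> inv (inv (q \<omega>)) \<otimes> diff d q \<omega>) = diff d (\<lambda>\<omega>. p \<omega> \<otimes> q \<omega>)"
      using p1(1) q1(1) by (simp add: diff_def fun_eq_iff m_assoc inv_mult_group)
    ultimately show ?thesis using mult p1 q1 by simp
  qed
  have iv: "hk (Suc d) i (\<lambda>\<omega>. inv (p \<omega>))" if p: "hk (Suc d) i p" for i p
  proof -
    have p1: "hk d i p" "hk d (Suc i) (diff d p)" using p by auto
    have "hk d (Suc i) (\<lambda>\<omega>. p \<omega> \<otimes> inv (diff d p \<omega>) \<otimes> inv (p \<omega>))"
      by (rule conj[OF p1(1) inv[OF p1(2)]])
    moreover have "(\<lambda>\<omega>. p \<omega> \<otimes> inv (diff d p \<omega>) \<otimes> inv (p \<omega>)) = diff d (\<lambda>\<omega>. inv (p \<omega>))"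
      using p1(1) by (simp add: diff_def fun_eq_iff m_assoc inv_mult_group)
    ultimately show ?thesis using inv p1 by simp
  qed
  have cm: "hk (Suc d) (i + j) (\<lambda>\<omega>. comm (p \<omega>) (q \<omega>))" if p: "hk (Suc d) i p" and q: "hk (Suc d) j q" for i j p q
  proof -
    have p1: "hk d i p" "hk d (Suc i) (diff d p)" and q1: "hk d j q" "hk d (Suc j) (diff d q)" using p q by auto
    \<comment> \<open>The upper face of \<open>p\<close>. The derivative of the commutator is
      assembled from conjugates of \<open>comm (diff d p) q\<close> and
      \<open>comm p' (diff d q)\<close>, of degrees \<open>Suc i + j\<close> and
      \<open>i + Suc j\<close>.\<close>
    define p' where "p' = (\<lambda>\<omega>. p \<omega> \<otimes> diff d p \<omega>)"
    have p': "hk d i p'" unfolding p'_def by (rule mult[OF p1(1) hk_Suc_mono[OF p1(2)]])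
    have pc: "p \<omega> \<in> carrier G" "q \<omega> \<in> carrier G" "p' \<omega> \<in> carrier G" for \<omega> using p1 q1 p' by auto
    have p'': "p (insert d \<omega>) = p' \<omega>" for \<omega> using pc by (simp add: p'_def diff_def)
    have A: "hk d (Suc (i + j)) (\<lambda>\<omega>. p \<omega> \<otimes> comm (diff d p \<omega>) (q \<omega>) \<otimes> inv (p \<omega>))"
      using conj[OF p1(1) com[OF p1(2) q1(1)]] by simp
    have B: "hk d (Suc (i + j)) (\<lambda>\<omega>. q \<omega> \<otimes> comm (p' \<omega>) (diff d q \<omega>) \<otimes> inv (q \<omega>))"
      using conj[OF q1(1) com[OF p' q1(2)]] by simp
    have C: "hk d (i + j) (\<lambda>\<omega>. comm (p \<omega>) (q \<omega>))" using com p1 q1 by simp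
    note D = mult[OF conj[OF inv[OF C] A] B]
    have "(\<lambda>\<omega>. (inv (comm (p \<omega>) (q \<omega>)) \<otimes> (p \<omega> \<otimes> comm (diff d p \<omega>) (q \<omega>) \<otimes> inv (p \<omega>)) \<otimes> inv (inv (comm (p \<omega>) (q \<omega>))))
       \<otimes> (q \<omega> \<otimes> comm (p' \<omega>) (diff d q \<omega>) \<otimes> inv (q \<omega>))) = diff d (\<lambda>\<omega>. comm (p \<omega>) (q \<omega>))"
      using pc by (simp add: fun_eq_iff diff_def p'' comm_def m_assoc inv_mult_group)
    then show ?thesis using C D by simp
  qed
  show ?case using m iv cm by blast
qed

lemma hk_mult: "hk d i p \<Longrightarrow> hk d i q \<Longrightarrow> hk d i (\<lambda>\<omega>. p \<omega> \<otimes> q \<omega>)"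
  using hk_group by blast

lemma hk_inv: "hk d i p \<Longrightarrow> hk d i (\<lambda>\<omega>. inv (p \<omega>))"
  using hk_group by blast

lemma hk_conj:
  assumes "hk d j p" "hk d i u" shows "hk d i (\<lambda>\<omega>. p \<omega> \<otimes> u \<omega> \<otimes> inv (p \<omega>))"
proof -
  have "hk d (0 + i) (\<lambda>\<omega>. comm (p \<omega>) (u \<omega>))" using hk_group hk_zero_mono[OF assms(1)] assms(2) by blast
  then have "hk d i (\<lambda>\<omega>. comm (p \<omega>) (u \<omega>) \<otimes> u \<omega>)" using hk_mult assms(2) by simp
  moreover have "(\<lambda>\<omega>. comm (p \<omega>) (u \<omega>) \<otimes> u \<omega>) = (\<lambda>\<omega>. p \<omega> \<otimes> u \<omega> \<otimes> inv (p \<omega>))"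
    using assms conj_eq_comm hk_carrier by metis
  ultimately show ?thesis by simp
qed

lemma hk_const: "c \<in> F i \<Longrightarrow> hk d i (\<lambda>_. c)"
proof (induction d arbitrary: i c)
  case (Suc d)
  have "\<one> \<in> F (Suc i)" using F_subgroup subgroup.one_closed by blast
  moreover have "diff d (\<lambda>_. c) = (\<lambda>_. \<one>)" using Suc.prems F_carrier by (auto simp: diff_def)
  ultimately show ?case using Suc by simp
qed (auto dest: F_carrier)

text \<open>The derivative in direction \<open>d\<close> is the constant
  \<open>inv g \<otimes> t [^] n d \<otimes> g\<close>, which must lie in \<open>F 1\<close>; this
  is where \<open>F 1 = carrier G\<close> enters. The offset \<open>m\<close> allows the base point
  to sit at a vertex other than the empty one.\<close>

lemma hk_translate:
  assumes "t \<in> carrier G" "g \<in> carrier G" "F 1 = carrier G"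
  shows "hk d 0 (\<lambda>\<omega>. t [^] (m + (\<Sum>j\<in>\<omega> \<inter> {..<d}. n j) :: int) \<otimes> g)"
proof (induction d)
  case 0 then show ?case using assms by (simp add: F_zero)
next
  case (Suc d)
  have 1: "hk d 0 (\<lambda>\<omega>. t [^] (m + (\<Sum>j\<in>\<omega> \<inter> {..<Suc d}. n j)) \<otimes> g)"
    by (rule hk_cong[OF Suc]) (use assms in \<open>auto simp: Int_absorb2 lessThan_Suc subset_insertI2\<close>)
  let ?u = "inv g \<otimes> t [^] n d \<otimes> g"
  have "hk d (Suc 0) (diff d (\<lambda>\<omega>. t [^] (m + (\<Sum>j\<in>\<omega> \<inter> {..<Suc d}. n j)) \<otimes> g))"
  proof (rule hk_cong[where p = "\<lambda>_. ?u"])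
    show "hk d (Suc 0) (\<lambda>_. ?u)" using assms by (intro hk_const) simp
    fix \<omega> assume w: "\<omega> \<subseteq> {..<d}"
    have 1: "\<omega> \<inter> {..<Suc d} = \<omega>" "insert d \<omega> \<inter> {..<Suc d} = insert d \<omega>" using w by auto
    have "d \<notin> \<omega>" "finite \<omega>" using w finite_subset by auto
    then have "sum n (insert d \<omega>) = n d + sum n \<omega>" by simp
    then have s: "m + sum n (insert d \<omega>) = (m + sum n \<omega>) + n d" by simp
    show "diff d (\<lambda>\<omega>. t [^] (m + (\<Sum>j\<in>\<omega> \<inter> {..<Suc d}. n j)) \<otimes> g) \<omega> = ?u"
      unfolding diff_def 1 s using assms by (subst int_pow_mult) (simp_all add: inv_mult_group m_assoc)
  qed (use assms in \<open>auto simp: diff_def\<close>)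
  with 1 show ?case by simp
qed

text \<open>The iterated derivative in all directions lies in \<open>F (i + d)\<close>, which is
  trivial, so the vertex \<open>{..<d}\<close> is a word in the other vertices. In the induction
  \<open>diff d r\<close> has dimension one lower and degree one higher, so their sum is
  preserved.\<close>

lemma hk_full_vertex:
  assumes S: "subgroup S G"
  shows "hk d i r \<Longrightarrow> F (i + d) = {\<one>} \<Longrightarrow> (\<And>\<omega>. \<omega> \<subset> {..<d} \<Longrightarrow> r \<omega> \<in> S) \<Longrightarrow> r {..<d} \<in> S"
proof (induction d arbitrary: i r)
  case 0 then show ?case using subgroup.one_closed[OF S] by simp
next
  case (Suc d)
  have rc: "r \<omega> \<in> carrier G" for \<omega> using Suc.prems(1) hk_carrier by blast
  have rd: "r {..<d} \<in> S" by (rule Suc.prems(3)) (auto simp: lessThan_Suc)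
  have "diff d r {..<d} \<in> S"
  proof (rule Suc.IH[of "Suc i"])
    show "hk d (Suc i) (diff d r)" "F (Suc i + d) = {\<one>}" using Suc.prems by auto
    fix \<omega> assume w: "\<omega> \<subset> {..<d}"
    then have "\<omega> \<subset> {..<Suc d}" "insert d \<omega> \<subset> {..<Suc d}" by (auto simp: lessThan_Suc)
    then have "r \<omega> \<in> S" "r (insert d \<omega>) \<in> S" using Suc.prems(3) by blast+
    then show "diff d r \<omega> \<in> S" unfolding diff_def
      by (simp add: subgroup.m_closed[OF S] subgroup.m_inv_closed[OF S])
  qed
  then have "r {..<d} \<otimes> diff d r {..<d} \<in> S" using rd subgroup.m_closed[OF S] by blast
  then show ?case using rc by (simp add: diff_def lessThan_Suc)
qed

text \<open>The lower face factors as \<open>c\<close> times \<open>\<delta>\<close>; the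
  derivative, conjugated by \<open>\<delta>\<close> so that \<open>\<delta>\<close> can be moved to
  the right, factors as \<open>c'\<close> times \<open>\<delta>'\<close>. The upper face is then
  \<open>(c \<otimes> c') \<otimes> (\<delta>' \<otimes> \<delta>)\<close>, and the faces fit
  together to two cubes of the original degree. Boundedness is an abstract predicate, which becomes
  compactness when the lemma is applied.\<close>

lemma hk_cocompact:
  assumes S: "subgroup S G"
    and bdd_mult: "\<And>A B. bdd A \<Longrightarrow> bdd B \<Longrightarrow> bdd (A <#> B)"
    and bdd_Un: "\<And>A B. bdd A \<Longrightarrow> bdd B \<Longrightarrow> bdd (A \<union> B)"
    and F: "\<And>i. \<exists>K. bdd K \<and> (\<forall>x\<in>F i. \<exists>\<delta>\<in>F i \<inter> S. x \<otimes> inv \<delta> \<in> K)"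
  shows "\<exists>K. bdd K \<and> (\<forall>p. hk d i p \<longrightarrow> (\<exists>c \<delta>. hk d i c \<and> hk d i \<delta> \<and>
     (\<forall>\<omega>. c \<omega> \<in> K \<and> \<delta> \<omega> \<in> S) \<and> (\<forall>\<omega>\<subseteq>{..<d}. p \<omega> = c \<omega> \<otimes> \<delta> \<omega>)))"
proof (induction d arbitrary: i)
  case 0
  obtain K where K: "bdd K" "\<And>x. x\<in>F i \<Longrightarrow> \<exists>\<delta>\<in>F i \<inter> S. x \<otimes> inv \<delta> \<in> K" using F by blast
  show ?case
  proof (intro exI[of _ K] conjI allI impI)
    fix p assume "hk 0 i p"
    then have p: "p {} \<in> F i" by simp
    obtain \<delta> where d: "\<delta> \<in> F i" "\<delta> \<in> S" "p {} \<otimes> inv \<delta> \<in> K" using K(2)[OF p] by blast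
    have c: "p {} \<otimes> inv \<delta> \<in> F i"
      using p d by (simp add: subgroup.m_closed[OF F_subgroup] subgroup.m_inv_closed[OF F_subgroup])
    have "p {} = p {} \<otimes> inv \<delta> \<otimes> \<delta>" using p d F_carrier by (simp add: m_assoc)
    then show "\<exists>c \<delta>. hk 0 i c \<and> hk 0 i \<delta> \<and> (\<forall>\<omega>. c \<omega> \<in> K \<and> \<delta> \<omega> \<in> S) \<and> (\<forall>\<omega>\<subseteq>{..<0}. p \<omega> = c \<omega> \<otimes> \<delta> \<omega>)"
      using c d F_carrier by (intro exI[of _ "\<lambda>_. p {} \<otimes> inv \<delta>"] exI[of _ "\<lambda>_. \<delta>"]) auto
  qed (rule K)
next
  case (Suc d)
  obtain K where K: "bdd K" "\<And>p. hk d i p \<Longrightarrow> \<exists>c \<delta>. hk d i c \<and> hk d i \<delta> \<and>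
     (\<forall>\<omega>. c \<omega> \<in> K \<and> \<delta> \<omega> \<in> S) \<and> (\<forall>\<omega>\<subseteq>{..<d}. p \<omega> = c \<omega> \<otimes> \<delta> \<omega>)" using Suc[of i] by blast
  obtain K' where K': "bdd K'" "\<And>p. hk d (Suc i) p \<Longrightarrow> \<exists>c \<delta>. hk d (Suc i) c \<and> hk d (Suc i) \<delta> \<and>
     (\<forall>\<omega>. c \<omega> \<in> K' \<and> \<delta> \<omega> \<in> S) \<and> (\<forall>\<omega>\<subseteq>{..<d}. p \<omega> = c \<omega> \<otimes> \<delta> \<omega>)" using Suc[of "Suc i"] by blast
  show ?case
  proof (intro exI[of _ "K \<union> (K <#> K')"] conjI allI impI)
    show "bdd (K \<union> (K <#> K'))" using K(1) K'(1) by (intro bdd_Un bdd_mult)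
    fix p assume p: "hk (Suc d) i p"
    then have p1: "hk d i p" and p2: "hk d (Suc i) (diff d p)" by auto
    obtain c \<delta> where c: "hk d i c" "hk d i \<delta>" "\<And>\<omega>. c \<omega> \<in> K" "\<And>\<omega>. \<delta> \<omega> \<in> S"
      "\<And>\<omega>. \<omega> \<subseteq> {..<d} \<Longrightarrow> p \<omega> = c \<omega> \<otimes> \<delta> \<omega>" using K(2)[OF p1] by blast
    note conj = hk_conj[OF c(2) p2]
    obtain c' \<delta>' where c': "hk d (Suc i) c'" "hk d (Suc i) \<delta>'" "\<And>\<omega>. c' \<omega> \<in> K'" "\<And>\<omega>. \<delta>' \<omega> \<in> S"
      "\<And>\<omega>. \<omega> \<subseteq> {..<d} \<Longrightarrow> \<delta> \<omega> \<otimes> diff d p \<omega> \<otimes> inv (\<delta> \<omega>) = c' \<omega> \<otimes> \<delta>' \<omega>" using K'(2)[OF conj] by blast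
    have cc: "c \<omega> \<in> carrier G" "\<delta> \<omega> \<in> carrier G" "c' \<omega> \<in> carrier G" "\<delta>' \<omega> \<in> carrier G" "p \<omega> \<in> carrier G" for \<omega>
      using hk_carrier[OF c(1)] hk_carrier[OF c(2)] hk_carrier[OF c'(1)] hk_carrier[OF c'(2)] hk_carrier[OF p1] by simp_all
    define C where "C \<omega> = (if d \<in> \<omega> then c (\<omega> - {d}) \<otimes> c' (\<omega> - {d}) else c \<omega>)" for \<omega>
    define D where "D \<omega> = (if d \<in> \<omega> then \<delta>' (\<omega> - {d}) \<otimes> \<delta> (\<omega> - {d}) else \<delta> \<omega>)" for \<omega>
    have C1: "C \<omega> \<in> K \<union> (K <#> K')" for \<omega> using c(3) c'(3) unfolding C_def set_mult_def by auto
    have D1: "D \<omega> \<in> S" for \<omega> using c(4) c'(4) subgroup.m_closed[OF S] by (auto simp: D_def)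
    have C2: "C \<omega> \<in> carrier G" "D \<omega> \<in> carrier G" for \<omega> using cc by (auto simp: C_def D_def)
    have nd: "d \<notin> \<omega>" if "\<omega> \<subseteq> {..<d}" for \<omega> using that by auto
    have hC: "hk (Suc d) i C"
    proof -
      have "hk d i C" by (rule hk_cong[OF c(1)]) (use C2 nd in \<open>auto simp: C_def\<close>)
      moreover have "hk d (Suc i) (diff d C)"
        by (rule hk_cong[OF c'(1)]) (use C2 cc nd in \<open>auto simp: C_def diff_def\<close>)
      ultimately show ?thesis by simp
    qed
    have hD: "hk (Suc d) i D"
    proof -
      have "hk d i D" by (rule hk_cong[OF c(2)]) (use C2 nd in \<open>auto simp: D_def\<close>)
      moreover have "hk d (Suc i) (diff d D)"
        by (rule hk_cong[OF hk_conj[OF hk_inv[OF c(2)] c'(2)]])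
          (use C2 cc nd in \<open>auto simp: D_def diff_def m_assoc\<close>)
      ultimately show ?thesis by simp
    qed
    have eq: "p \<omega> = C \<omega> \<otimes> D \<omega>" if w: "\<omega> \<subseteq> {..<Suc d}" for \<omega>
    proof (cases "d \<in> \<omega>")
      case False
      then have "\<omega> \<subseteq> {..<d}" using w by (auto simp: less_Suc_eq)
      then show ?thesis using c(5) False by (simp add: C_def D_def)
    next
      case True
      let ?w = "\<omega> - {d}"
      have ws: "?w \<subseteq> {..<d}" using w by (auto simp: less_Suc_eq)
      have "p \<omega> = p ?w \<otimes> diff d p ?w" using True cc by (simp add: diff_def insert_absorb)
      also have "\<dots> = c ?w \<otimes> (\<delta> ?w \<otimes> diff d p ?w \<otimes> inv (\<delta> ?w)) \<otimes> \<delta> ?w"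
        using c(5)[OF ws] cc hk_carrier[OF p2] by (simp add: m_assoc)
      also have "\<dots> = C \<omega> \<otimes> D \<omega>" unfolding c'(5)[OF ws] using True cc by (simp add: C_def D_def m_assoc)
      finally show ?thesis .
    qed
    show "\<exists>c \<delta>. hk (Suc d) i c \<and> hk (Suc d) i \<delta> \<and> (\<forall>\<omega>. c \<omega> \<in> K \<union> (K <#> K') \<and> \<delta> \<omega> \<in> S) \<and>
         (\<forall>\<omega>\<subseteq>{..<Suc d}. p \<omega> = c \<omega> \<otimes> \<delta> \<omega>)"
      by (rule exI[of _ C], rule exI[of _ D]) (use C1 D1 hC hD eq in blast)
  qed
qed

end

section \<open>The filtration attached to the upper central series\<close>

context group
begin

text \<open>The first factor makes the series end at \<open>Suc d\<close>, the second one makes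
  degrees add under commutators. Subtraction is truncated on purpose: for \<open>i \<le> j\<close>
  the elements centralize \<open>uc i\<close>.\<close>

definition stab_filtration :: "nat \<Rightarrow> nat \<Rightarrow> 'a set" where
  "stab_filtration d j = uc (Suc d - j) \<inter> (\<Inter>i\<le>d. cent (uc i) (uc (i - j)))"

lemma stab_filtration_normal: "stab_filtration d j \<lhd> G"
proof -
  have "(\<Inter>i\<le>n. cent (uc i) (uc (i - j))) \<lhd> G" for n
    by (induction n) (simp_all add: atMost_Suc cent_normal uc_normal normal_Int del: uc.simps)
  then show ?thesis by (simp add: stab_filtration_def uc_normal normal_Int del: uc.simps)
qed

text \<open>A version of the three subgroups argument. For \<open>x\<close>, \<open>y\<close> of
  degrees \<open>i\<close>, \<open>j\<close> and \<open>t\<close> in \<open>uc l\<close>, write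
  \<open>t\<close> as the conjugate of \<open>s\<close> by \<open>y \<otimes> x\<close>. The
  commutator of \<open>comm x y\<close> with \<open>t\<close> becomes a word in
  \<open>a = comm x s\<close> and \<open>b = comm y s\<close> that is congruent to
  \<open>comm b a\<close> modulo \<open>uc (l - (i + j))\<close>, and \<open>comm b a\<close> is
  trivial there too.\<close>

lemma stab_filtration_filtration:
  assumes nil: "uc d = carrier G"
  shows "filtration G (stab_filtration d)"
proof (intro filtration.intro filtration_axioms.intro)
  show "group G" by (rule is_group)
next
  fix i show "subgroup (stab_filtration d i) G" using stab_filtration_normal normal_inv_iff by blast
next
  fix j
  have "uc (Suc d - Suc j) \<subseteq> uc (Suc d - j)" by (rule uc_mono) simp
  moreover have "cent (uc i) (uc (i - Suc j)) \<subseteq> cent (uc i) (uc (i - j))" for i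
    using uc_mono[OF diff_le_mono2[of j "Suc j" i]] by (auto simp: cent_def)
  ultimately show "stab_filtration d (Suc j) \<subseteq> stab_filtration d j"
    unfolding stab_filtration_def by blast
next
  have 1: "uc (Suc d) = carrier G" using uc_Suc[of d] uc_carrier[of "Suc d"] nil by blast
  moreover have "carrier G \<subseteq> cent (uc i) (uc i)" for i
  proof -
    interpret normal "uc i" G by (rule uc_normal)
    show ?thesis by (auto simp: cent_def intro: comm_mem_right)
  qed
  ultimately show "stab_filtration d 0 = carrier G"
    by (auto simp: stab_filtration_def simp del: uc.simps)
next
  fix i j x y assume x: "x \<in> stab_filtration d i" and y: "y \<in> stab_filtration d j"
  have xc: "x \<in> carrier G" and yc: "y \<in> carrier G"
    using x y stab_filtration_normal normal_inv_iff subgroup.subset by blast+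
  have xs: "comm x z \<in> uc (l - i)" if "l \<le> d" "z \<in> uc l" for l z
    using x that by (auto simp: stab_filtration_def cent_def)
  have ys: "comm y z \<in> uc (l - j)" if "l \<le> d" "z \<in> uc l" for l z
    using y that by (auto simp: stab_filtration_def cent_def)
  show "comm x y \<in> stab_filtration d (i + j)"
  \<comment> \<open>In degree \<open>0\<close> normality suffices. Otherwise
    \<open>Suc d - j \<le> d\<close>, so the stabilizer condition on \<open>x\<close> applies to
    \<open>y\<close>.\<close>
  proof (cases "i = 0 \<or> j = 0")
    case True
    interpret I: normal "stab_filtration d i" G by (rule stab_filtration_normal)
    interpret J: normal "stab_filtration d j" G by (rule stab_filtration_normal)
    from True show ?thesis using I.comm_mem_left[OF yc x] J.comm_mem_right[OF xc y] by auto
  next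
    case False
    have "y \<in> uc (Suc d - j)" using y by (simp add: stab_filtration_def)
    moreover have "Suc d - j \<le> d" using False by linarith
    ultimately have "comm x y \<in> uc (Suc d - j - i)" using xs by blast
    moreover have "Suc d - j - i = Suc d - (i + j)" by simp
    ultimately have 1: "comm x y \<in> uc (Suc d - (i + j))" by simp
    have 2: "comm (comm x y) t \<in> uc (l - (i + j))" if l: "l \<le> d" and t: "t \<in> uc l" for l t
    proof -
      interpret L: normal "uc (l - (i + j))" G by (rule uc_normal)
      interpret UL: normal "uc l" G by (rule uc_normal)
      have tc: "t \<in> carrier G" using t uc_carrier by blast
      define s where "s = inv (y \<otimes> x) \<otimes> t \<otimes> (y \<otimes> x)"
      have s: "s \<in> uc l" unfolding s_def using xc yc t by (intro UL.inv_op_closed1) auto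
      have sc: "s \<in> carrier G" using s uc_carrier by blast
      define a where "a = comm x s"
      define b where "b = comm y s"
      have a: "a \<in> uc (l - i)" and b: "b \<in> uc (l - j)" using xs ys l s by (auto simp: a_def b_def)
      have ac: "a \<in> carrier G" and bc: "b \<in> carrier G" using a b uc_carrier by blast+
      have cb: "ceq (uc (l - (i + j))) (x \<otimes> b \<otimes> inv x) b"
        using xs[of "l - j" b] b l xc bc by (intro L.ceq_conj_imp) (auto simp: diff_diff_left add.commute)
      have ca: "ceq (uc (l - (i + j))) (y \<otimes> a \<otimes> inv y) a"
        using ys[of "l - i" a] a l yc ac by (intro L.ceq_conj_imp) (auto simp: diff_diff_left)
      \<comment> \<open>Since this centralizer is normal, it contains \<open>a = comm x s\<close>
        along with \<open>x\<close>; so \<open>a\<close> commutes with \<open>b\<close> modulo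
        \<open>uc (l - (i + j))\<close>.\<close>
      have "x \<in> cent (uc (l - j)) (uc (l - (i + j)))"
        using xs[of "l - j"] xc l by (auto simp: cent_def diff_diff_left add.commute)
      then have "a \<in> cent (uc (l - j)) (uc (l - (i + j)))"
        unfolding a_def using sc cent_normal[OF uc_normal uc_normal] by (intro normal.comm_mem_left) auto
      then have ab: "comm a b \<in> uc (l - (i + j))" using b by (simp add: cent_def)
      have e1: "comm (comm x y) t = (x \<otimes> b \<otimes> inv x) \<otimes> a \<otimes> inv ((y \<otimes> a \<otimes> inv y) \<otimes> b)"
        unfolding a_def b_def s_def using xc yc tc by (simp add: comm_def m_assoc inv_mult_group)
      have "ceq (uc (l - (i + j))) (comm (comm x y) t) (b \<otimes> a \<otimes> inv (a \<otimes> b))"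
        unfolding e1 using ca cb ac bc by (intro L.ceq_mult L.ceq_inv) auto
      moreover have "b \<otimes> a \<otimes> inv (a \<otimes> b) = inv (comm a b)"
        using ac bc by (simp add: comm_def m_assoc inv_mult_group)
      moreover have "inv (comm a b) \<in> uc (l - (i + j))" using ab by simp
      ultimately show ?thesis using L.ceq_sym L.ceq_mem by metis
    qed
    show ?thesis using 1 2 xc yc unfolding stab_filtration_def
      by (auto simp: cent_def simp del: uc.simps)
  qed
qed

lemma stab_filtration_one:
  assumes nil: "uc d = carrier G"
  shows "stab_filtration d 1 = carrier G"
proof -
  have "comm x m \<in> uc (i - 1)" if x: "x \<in> carrier G" and m: "m \<in> uc i" for x m i
  proof -
    interpret normal "uc (i - 1)" G by (rule uc_normal)
    have "inv (comm m x) \<in> uc (i - 1)" using uc_comm'[OF m x] by (rule m_inv_closed)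
    moreover have "m \<in> carrier G" using m uc_carrier by blast
    ultimately show ?thesis using inv_comm[of m x] x by simp
  qed
  then show ?thesis using nil by (auto simp: stab_filtration_def cent_def simp del: uc.simps)
qed

lemma stab_filtration_end: "stab_filtration d (Suc d) = {\<one>}"
proof -
  have "\<one> \<in> stab_filtration d (Suc d)" using stab_filtration_normal normal_inv_iff subgroup.one_closed by blast
  then show ?thesis by (auto simp: stab_filtration_def)
qed

end

section \<open>Topological groups\<close>

locale top_group = group G for G (structure) +
  fixes M :: "'a topology"
  assumes topspace_M [simp]: "topspace M = carrier G"
    and mult_cont: "continuous_map (prod_topology M M) M (\<lambda>(x, y). x \<otimes> y)"
    and inv_cont: "continuous_map M M (\<lambda>x. inv x)"
begin

lemma continuous_map_mult:
  assumes "continuous_map X M f" "continuous_map X M g"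
  shows "continuous_map X M (\<lambda>x. f x \<otimes> g x)"
  using continuous_map_compose[OF continuous_map_pairedI[OF assms] mult_cont] by (simp add: o_def)

lemma continuous_map_inv: "continuous_map X M f \<Longrightarrow> continuous_map X M (\<lambda>x. inv (f x))"
  using continuous_map_compose[OF _ inv_cont] by (simp add: o_def)

lemma continuous_map_comm:
  "continuous_map X M f \<Longrightarrow> continuous_map X M g \<Longrightarrow> continuous_map X M (\<lambda>x. comm (f x) (g x))"
  unfolding comm_def by (intro continuous_map_mult continuous_map_inv)

lemma limitin_carrier: "limitin M f l F \<Longrightarrow> l \<in> carrier G"
  using limitin_topspace by force

lemma limitin_mult:
  assumes "limitin M f a F" "limitin M g b F" shows "limitin M (\<lambda>k. f k \<otimes> g k) (a \<otimes> b) F"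
proof -
  have "limitin (prod_topology M M) (\<lambda>k. (f k, g k)) (a, b) F"
    using assms by (simp add: limitin_pairwise o_def)
  from continuous_map_limit[OF mult_cont this] show ?thesis by (simp add: o_def)
qed

lemma limitin_inv: "limitin M f a F \<Longrightarrow> limitin M (\<lambda>k. inv (f k)) (inv a) F"
  using continuous_map_limit[OF inv_cont, of f a F] by (simp add: o_def)

definition nhd :: "'a set \<Rightarrow> bool" where
  "nhd U \<longleftrightarrow> openin M U \<and> \<one> \<in> U"

lemma nhd_carrier: "nhd U \<Longrightarrow> x \<in> U \<Longrightarrow> x \<in> carrier G"
  unfolding nhd_def using openin_subset by fastforce

lemma nhd_Int: "nhd U \<Longrightarrow> nhd V \<Longrightarrow> nhd (U \<inter> V)"
  by (auto simp: nhd_def)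

lemma nhd_inverse:
  assumes "nhd U" shows "nhd {x \<in> carrier G. inv x \<in> U}"
  using openin_continuous_map_preimage[OF inv_cont, of U] assms by (simp add: nhd_def)

lemma nhd_sym:
  assumes "nhd V" obtains W where "nhd W" "W \<subseteq> V" "\<And>x. x \<in> W \<Longrightarrow> inv x \<in> W"
proof (rule that[of "V \<inter> {x \<in> carrier G. inv x \<in> V}"])
  show "nhd (V \<inter> {x \<in> carrier G. inv x \<in> V})" using assms by (intro nhd_Int nhd_inverse)
qed (use assms nhd_carrier in auto)

text \<open>The tube lemma along \<open>C \<times> {\<one>}\<close>. It makes conjugates and
  commutators uniformly small over compact sets.\<close>

lemma nhd_tube:
  assumes f: "continuous_map (prod_topology M M) M f" and C: "compactin M C"
    and V: "openin M V" and sub: "\<And>c. c \<in> C \<Longrightarrow> f (c, \<one>) \<in> V"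
  obtains W where "nhd W" "\<And>c w. c \<in> C \<Longrightarrow> w \<in> W \<Longrightarrow> f (c, w) \<in> V"
proof -
  let ?P = "{z \<in> topspace (prod_topology M M). f z \<in> V}"
  have "C \<subseteq> carrier G" using compactin_subset_topspace[OF C] by simp
  then have "C \<times> {\<one>} \<subseteq> ?P" using sub by auto
  then obtain A W where "openin M W" "C \<subseteq> A" "\<one> \<in> W" "A \<times> W \<subseteq> ?P"
    using tube_lemma_left[OF openin_continuous_map_preimage[OF f V] C, of \<one>] by auto
  then show thesis by (intro that[of W]) (auto simp: nhd_def)
qed

lemma continuous_map_fst_M: "continuous_map (prod_topology M M) M fst"
  and continuous_map_snd_M: "continuous_map (prod_topology M M) M snd"
  by (rule continuous_map_fst continuous_map_snd)+

lemma nhd_conj: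
  assumes C: "compactin M C" and V: "nhd V"
  obtains W where "nhd W" "\<And>c w. c \<in> C \<Longrightarrow> w \<in> W \<Longrightarrow> c \<otimes> w \<otimes> inv c \<in> V"
proof (rule nhd_tube[of "\<lambda>z. fst z \<otimes> snd z \<otimes> inv (fst z)" C V])
  have "C \<subseteq> carrier G" using compactin_subset_topspace[OF C] by simp
  then show "fst (c, \<one>) \<otimes> snd (c, \<one>) \<otimes> inv (fst (c, \<one>)) \<in> V" if "c \<in> C" for c
    using that V by (auto simp: nhd_def)
qed (use C V that in \<open>auto simp: nhd_def intro!: continuous_map_mult continuous_map_inv continuous_map_fst_M continuous_map_snd_M\<close>)

lemma nhd_comm:
  assumes C: "compactin M C" and V: "nhd V"
  obtains W where "nhd W" "\<And>c w. c \<in> C \<Longrightarrow> w \<in> W \<Longrightarrow> comm c w \<in> V \<and> comm w c \<in> V"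
proof -
  have Cc: "C \<subseteq> carrier G" using compactin_subset_topspace[OF C] by simp
  obtain W1 where W1: "nhd W1" "\<And>c w. c \<in> C \<Longrightarrow> w \<in> W1 \<Longrightarrow> comm c w \<in> V"
    by (rule nhd_tube[of "\<lambda>z. comm (fst z) (snd z)" C V])
      (use C V Cc in \<open>auto simp: nhd_def intro!: continuous_map_comm continuous_map_fst_M continuous_map_snd_M\<close>)
  obtain W2 where W2: "nhd W2" "\<And>c w. c \<in> C \<Longrightarrow> w \<in> W2 \<Longrightarrow> comm w c \<in> V"
    by (rule nhd_tube[of "\<lambda>z. comm (snd z) (fst z)" C V])
      (use C V Cc in \<open>auto simp: nhd_def intro!: continuous_map_comm continuous_map_fst_M continuous_map_snd_M\<close>)
  show thesis by (rule that[of "W1 \<inter> W2"]) (use W1 W2 in \<open>auto intro: nhd_Int\<close>)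
qed

lemma open_near:
  assumes V: "openin M V" and x: "x \<in> V"
  obtains W O' where "nhd W" "openin M O'" "x \<in> O'" "\<And>u y. u \<in> W \<Longrightarrow> y \<in> O' \<Longrightarrow> inv u \<otimes> y \<in> V"
proof -
  let ?f = "\<lambda>z. inv (fst z) \<otimes> snd z"
  have xc: "x \<in> carrier G" using openin_subset[OF V] x by auto
  have "continuous_map (prod_topology M M) M ?f"
    by (intro continuous_map_mult continuous_map_inv continuous_map_fst_M continuous_map_snd_M)
  from openin_continuous_map_preimage[OF this V]
  have "openin (prod_topology M M) {z \<in> topspace (prod_topology M M). ?f z \<in> V}" .
  moreover have "(\<one>, x) \<in> {z \<in> topspace (prod_topology M M). ?f z \<in> V}" using x xc by simp
  ultimately obtain W O' where "openin M W" "openin M O'" "\<one> \<in> W" "x \<in> O'"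
    "W \<times> O' \<subseteq> {z \<in> topspace (prod_topology M M). ?f z \<in> V}"
    unfolding openin_prod_topology_alt by meson
  then show thesis by (intro that[of W O']) (auto simp: nhd_def)
qed

lemma nhd_mult:
  assumes "nhd V"
  obtains W where "nhd W" "W \<subseteq> V" "\<And>x. x \<in> W \<Longrightarrow> inv x \<in> W"
    "\<And>x y. x \<in> W \<Longrightarrow> y \<in> W \<Longrightarrow> inv x \<otimes> y \<in> V \<and> x \<otimes> y \<in> V"
proof -
  obtain W O' where W: "nhd W" "openin M O'" "\<one> \<in> O'" "\<And>u y. u \<in> W \<Longrightarrow> y \<in> O' \<Longrightarrow> inv u \<otimes> y \<in> V"
    using open_near[of V \<one>] assms by (auto simp: nhd_def)
  obtain U where U: "nhd U" "U \<subseteq> W \<inter> O' \<inter> V" "\<And>x. x \<in> U \<Longrightarrow> inv x \<in> U"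
    using nhd_sym[of "W \<inter> O' \<inter> V"] W assms by (auto simp: nhd_def)
  have 1: "inv x \<otimes> y \<in> V" if "x \<in> U" "y \<in> U" for x y using that U W(4) by blast
  have "x \<otimes> y \<in> V" if "x \<in> U" "y \<in> U" for x y
    using 1[of "inv x" y] U(3)[of x] that nhd_carrier[OF U(1)] by simp
  then show thesis using that[of U] U 1 by auto
qed

lemma compactin_set_mult:
  assumes "compactin M A" "compactin M B" shows "compactin M (A <#> B)"
proof -
  have "compactin M ((\<lambda>(x, y). x \<otimes> y) ` (A \<times> B))"
    by (rule image_compactin[OF _ mult_cont]) (use assms in \<open>simp add: compactin_Times\<close>)
  moreover have "(\<lambda>(x, y). x \<otimes> y) ` (A \<times> B) = A <#> B" by (auto simp: set_mult_def)
  ultimately show ?thesis by simp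
qed

lemma openin_translate:
  assumes "openin M W" "c \<in> carrier G" shows "openin M {x \<in> carrier G. inv c \<otimes> x \<in> W}"
proof -
  have "continuous_map M M (\<lambda>x. inv c \<otimes> x)"
    using assms by (intro continuous_map_mult) (auto simp: continuous_map_const)
  from openin_continuous_map_preimage[OF this assms(1)] show ?thesis by simp
qed

lemma compact_translates:
  assumes C: "compactin M C" and W: "nhd W"
  obtains T where "finite T" "T \<subseteq> C" "\<And>x. x \<in> C \<Longrightarrow> \<exists>c\<in>T. inv c \<otimes> x \<in> W"
proof -
  have Cc: "C \<subseteq> carrier G" using compactin_subset_topspace[OF C] by simp
  let ?t = "\<lambda>c. {x \<in> carrier G. inv c \<otimes> x \<in> W}"
  have "\<exists>\<F>. finite \<F> \<and> \<F> \<subseteq> ?t ` C \<and> C \<subseteq> \<Union>\<F>"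
  proof (rule compactinD[OF C])
    show "openin M U" if "U \<in> ?t ` C" for U
      using that Cc W by (auto simp: nhd_def intro!: openin_translate)
    show "C \<subseteq> \<Union>(?t ` C)"
    proof
      fix x assume "x \<in> C"
      then show "x \<in> \<Union>(?t ` C)" using Cc W by (auto simp: nhd_def intro!: bexI[of _ x])
    qed
  qed
  then obtain \<F> where \<F>: "finite \<F>" "\<F> \<subseteq> ?t ` C" "C \<subseteq> \<Union>\<F>" by blast
  obtain T where "T \<subseteq> C" "finite T" "\<F> = ?t ` T" using finite_subset_image[OF \<F>(1,2)] by blast
  then show thesis using \<F>(3) by (intro that[of T]) auto
qed

lemma closedin_cent:
  assumes N: "closedin M N" and M': "M' \<subseteq> carrier G" shows "closedin M (cent M' N)"
proof -
  have "cent M' N = carrier G \<inter> (\<Inter>m\<in>M'. {x \<in> carrier G. comm x m \<in> N})" by (auto simp: cent_def)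
  moreover have "closedin M {x \<in> carrier G. comm x m \<in> N}" if "m \<in> M'" for m
  proof -
    have "continuous_map M M (\<lambda>x. comm x m)"
      using that M' by (intro continuous_map_comm) (auto simp: continuous_map_const)
    from closedin_continuous_map_preimage[OF this N] show ?thesis by simp
  qed
  ultimately show ?thesis
    by (cases "M' = {}") (use closedin_topspace[of M] in \<open>auto intro!: closedin_Int closedin_INT\<close>)
qed

lemma closedin_uc:
  assumes "Hausdorff_space M" shows "closedin M (uc i)"
proof (induction i)
  case 0 then show ?case using assms by (simp add: closedin_Hausdorff_singleton)
next
  case (Suc i)
  show ?case using closedin_cent[OF Suc subset_refl] by simp
qed

lemma closedin_stab_filtration:
  assumes "Hausdorff_space M" shows "closedin M (stab_filtration d j)"
  unfolding stab_filtration_def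
  by (intro closedin_Int closedin_INT closedin_uc closedin_cent assms uc_carrier) auto

end

text \<open>Compactness along arbitrary filters replaces the passage to subsequences.\<close>

lemma compactin_cluster:
  assumes C: "compactin X C" and F: "F \<noteq> bot" and ev: "eventually (\<lambda>k. c k \<in> C) F"
  obtains l F' where "F' \<le> F" "F' \<noteq> bot" "limitin X c l F'" "l \<in> C"
proof -
  have "\<exists>l\<in>C. \<forall>U. openin X U \<and> l \<in> U \<longrightarrow> frequently (\<lambda>k. c k \<in> U) F"
  proof (rule ccontr)
    assume "\<not> ?thesis"
    then have "\<forall>l\<in>C. \<exists>U. openin X U \<and> l \<in> U \<and> eventually (\<lambda>k. c k \<notin> U) F"
      by (auto simp: frequently_def)
    then obtain U where U: "\<And>l. l \<in> C \<Longrightarrow> openin X (U l) \<and> l \<in> U l \<and> eventually (\<lambda>k. c k \<notin> U l) F" by metis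
    have "\<exists>\<F>. finite \<F> \<and> \<F> \<subseteq> U ` C \<and> C \<subseteq> \<Union>\<F>"
      by (rule compactinD[OF C]) (use U in auto)
    then obtain T where T: "finite T" "T \<subseteq> C" "C \<subseteq> \<Union>(U ` T)" by (metis finite_subset_image)
    have "eventually (\<lambda>k. \<forall>l\<in>T. c k \<notin> U l) F"
      by (rule eventually_ball_finite) (use T U in auto)
    with ev have "eventually (\<lambda>k. False) F" by eventually_elim (use T in blast)
    then show False using F by (simp add: trivial_limit_def)
  qed
  then obtain l where l: "l \<in> C" "\<And>U. openin X U \<Longrightarrow> l \<in> U \<Longrightarrow> frequently (\<lambda>k. c k \<in> U) F" by blast
  define \<U> where "\<U> = {U. openin X U \<and> l \<in> U}"
  \<comment> \<open>The coarsest filter finer than \<open>F\<close> along which \<open>c\<close>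
    tends to \<open>l\<close>; it is proper because \<open>c\<close> visits each neighbourhood of
    \<open>l\<close> frequently along \<open>F\<close>.\<close>
  define F' where "F' = inf F (INF U\<in>\<U>. principal (c -` U))"
  have lX: "l \<in> topspace X" using l(1) compactin_subset_topspace[OF C] by auto
  have ev_iff: "eventually P (INF U\<in>\<U>. principal (c -` U)) \<longleftrightarrow> (\<exists>U\<in>\<U>. \<forall>k. c k \<in> U \<longrightarrow> P k)" for P
  proof (subst eventually_INF_base)
    show "\<U> \<noteq> {}" using lX by (auto simp: \<U>_def)
    fix A B assume "A \<in> \<U>" "B \<in> \<U>"
    then show "\<exists>x\<in>\<U>. principal (c -` x) \<le> inf (principal (c -` A)) (principal (c -` B))"
      by (intro bexI[of _ "A \<inter> B"]) (auto simp: \<U>_def)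
  qed (auto simp: eventually_principal)
  have "F' \<noteq> bot"
  proof
    assume "F' = bot"
    then have "eventually (\<lambda>_. False) F'" by simp
    then obtain P Q where PQ: "eventually P F" "eventually Q (INF U\<in>\<U>. principal (c -` U))" "\<And>k. P k \<and> Q k \<Longrightarrow> False"
      unfolding F'_def eventually_inf by blast
    then obtain U where U: "U \<in> \<U>" "\<And>k. c k \<in> U \<Longrightarrow> Q k" using ev_iff by blast
    have "eventually (\<lambda>k. c k \<notin> U) F" using PQ(1) by eventually_elim (use PQ U in blast)
    then show False using l(2)[of U] U(1) by (simp add: \<U>_def frequently_def)
  qed
  moreover have "limitin X c l F'" unfolding limitin_def
  proof (intro conjI allI impI lX)
    fix U assume "openin X U \<and> l \<in> U"
    then have "eventually (\<lambda>k. c k \<in> U) (INF U\<in>\<U>. principal (c -` U))"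
      unfolding ev_iff by (auto simp: \<U>_def)
    then show "eventually (\<lambda>k. c k \<in> U) F'"
      unfolding F'_def by (meson filter_leD inf_le2)
  qed
  ultimately show thesis using l(1) by (intro that[of F' l]) (simp_all add: F'_def)
qed

lemma limitin_mono: "limitin X f l F \<Longrightarrow> F' \<le> F \<Longrightarrow> limitin X f l F'"
  by (auto simp: limitin_def dest: filter_leD)

text \<open>The filter is refined once for each index, and limits found earlier survive by
  \<open>limitin_mono\<close>. The indices will be the vertices of a cube.\<close>

lemma compactin_cluster_finite:
  assumes C: "compactin X C" and "finite A" and F: "F \<noteq> bot"
    and ev: "\<And>\<omega>. \<omega> \<in> A \<Longrightarrow> eventually (\<lambda>k. c k \<omega> \<in> C) F"
  shows "\<exists>F' l. F' \<le> F \<and> F' \<noteq> bot \<and> (\<forall>\<omega>\<in>A. limitin X (\<lambda>k. c k \<omega>) (l \<omega>) F')"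
  using \<open>finite A\<close> ev
proof (induction A)
  case empty then show ?case using F by auto
next
  case (insert \<omega> A)
  then obtain F1 l where 1: "F1 \<le> F" "F1 \<noteq> bot" "\<forall>\<omega>\<in>A. limitin X (\<lambda>k. c k \<omega>) (l \<omega>) F1" by auto
  have "eventually (\<lambda>k. c k \<omega> \<in> C) F1" using insert.prems[of \<omega>] 1(1) filter_leD by auto
  then obtain l' F' where 2: "F' \<le> F1" "F' \<noteq> bot" "limitin X (\<lambda>k. c k \<omega>) l' F'"
    using compactin_cluster[OF C 1(2), of "\<lambda>k. c k \<omega>"] by metis
  have "\<forall>\<eta>\<in>insert \<omega> A. limitin X (\<lambda>k. c k \<eta>) ((l(\<omega> := l')) \<eta>) F'"
    using 1(3) 2(3) limitin_mono[OF _ 2(1)] by (metis fun_upd_apply insert_iff)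
  then show ?case using 1 2 by (intro exI[of _ F'] exI[of _ "l(\<omega> := l')"]) auto
qed

section \<open>Discrete cocompact subgroups\<close>

lemma (in group) lower_central_subgroup:
  assumes H: "subgroup H G"
  shows "lower_central (G\<lparr>carrier := H\<rparr>) n \<subseteq> lower_central G n \<inter> H"
proof (induction n)
  case 0 then show ?case using subgroup.subset[OF H] by simp
next
  case (Suc n)
  interpret H: group "G\<lparr>carrier := H\<rparr>" by (rule subgroup_imp_group[OF H])
  have Hc: "H \<subseteq> carrier G" by (rule subgroup.subset[OF H])
  let ?A = "{H.comm h k |h k. h \<in> H \<and> k \<in> lower_central (G\<lparr>carrier := H\<rparr>) n}"
  have AH: "?A \<subseteq> H" using Suc H.comm_closed by fastforce
  have eq: "H.comm h k = comm h k" if "h \<in> H" "k \<in> H" for h k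
    using that H by (simp add: H.comm_def comm_def)
  have L: "lower_central (G\<lparr>carrier := H\<rparr>) (Suc n) = generate G ?A"
    using generate_consistent[OF AH H] by (simp add: H.commutator_subgroup_eq)
  have "?A \<subseteq> lower_central G (Suc n)"
    using Suc eq lower_central_comm Hc by (auto simp del: lower_central.simps)
      (metis IntE eq lower_central_comm subsetD)
  then have "generate G ?A \<subseteq> lower_central G (Suc n)"
    by (rule generate_subgroup_incl) (use lower_central_normal[of "Suc n"] normal_inv_iff in blast)
  then show ?case unfolding L using generate_subgroup_incl[OF AH H] by blast
qed

lemma (in group) nilpotent_subgroup:
  assumes H: "subgroup H G" and "nilpotent d G" shows "nilpotent d (G\<lparr>carrier := H\<rparr>)"
proof -
  interpret H: group "G\<lparr>carrier := H\<rparr>" by (rule subgroup_imp_group[OF H])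
  have "\<one> \<in> lower_central (G\<lparr>carrier := H\<rparr>) d"
    using H.lower_central_normal H.normal_inv_iff subgroup.one_closed by fastforce
  then show ?thesis using lower_central_subgroup[OF H, of d] assms(2) H.is_group
    by (auto simp: nilpotent_def)
qed

text \<open>Changing \<open>x\<close> by a factor \<open>z\<close> of \<open>uc (Suc i)\<close>
  alters \<open>comm a x\<close> by \<open>comm a z\<close> and a conjugation by \<open>z\<close>,
  both trivial modulo \<open>uc i\<close>. Thus knowing one argument modulo
  \<open>uc (Suc i)\<close> suffices to know the commutator modulo \<open>uc i\<close>.\<close>

lemma (in group) ceq_comm_uc:
  assumes a: "ceq (uc i) a a'" and x: "ceq (uc (Suc i)) x w"
  shows "ceq (uc i) (comm a x) (comm a' w)"
proof -
  interpret N: normal "uc i" G by (rule uc_normal)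
  have c: "a \<in> carrier G" "a' \<in> carrier G" "x \<in> carrier G" "w \<in> carrier G" using a x by (auto simp: ceq_def)
  define z where "z = x \<otimes> inv w"
  have z: "z \<in> uc (Suc i)" using x by (simp add: ceq_def z_def)
  have zc: "z \<in> carrier G" using c by (simp add: z_def)
  have xz: "x = z \<otimes> w" using c by (simp add: z_def m_assoc)
  have zcm: "comm z y \<in> uc i" if "y \<in> carrier G" for y using uc_comm[OF z that] .
  have az: "comm a z \<in> uc i" using N.m_inv_closed[OF zcm[OF c(1)]] inv_comm[OF zc c(1)] by simp
  have "ceq (uc i) (z \<otimes> comm a w \<otimes> inv z) (comm a w)"
    using zcm c zc by (intro N.ceq_conj_imp) auto
  then have "ceq (uc i) (comm a z \<otimes> (z \<otimes> comm a w \<otimes> inv z)) (\<one> \<otimes> comm a w)"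
    using az N.ceq_one_iff by (intro N.ceq_mult) auto
  then have "ceq (uc i) (comm a x) (comm a w)" unfolding xz using c zc by (simp add: comm_mult_right)
  moreover have "ceq (uc i) (comm a w) (comm a' w)" using a c by (intro N.ceq_comm) auto
  ultimately show ?thesis by (rule N.ceq_trans)
qed

text \<open>The same mechanism with \<open>cent M' N\<close> as modulus: a factor \<open>f\<close>
  from it commutes modulo \<open>N\<close> with \<open>m\<close> and also with
  \<open>comm w m\<close>, which stays in \<open>M'\<close> by normality.\<close>

lemma (in group) ceq_comm_cent:
  assumes M': "M' \<lhd> G" and N: "N \<lhd> G" and x: "ceq (cent M' N) x w" and m: "m \<in> M'"
  shows "ceq N (comm x m) (comm w m)"
proof -
  interpret M': normal M' G by (rule M')
  interpret N: normal N G by (rule N)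
  have c: "x \<in> carrier G" "w \<in> carrier G" using x by (auto simp: ceq_def)
  have mc: "m \<in> carrier G" using m by simp
  define f where "f = x \<otimes> inv w"
  have f: "f \<in> cent M' N" using x by (simp add: ceq_def f_def)
  have fc: "f \<in> carrier G" using c by (simp add: f_def)
  have fm: "comm f y \<in> N" if "y \<in> M'" for y using f that by (simp add: cent_def)
  have xf: "x = f \<otimes> w" using c by (simp add: f_def m_assoc)
  have "comm w m \<in> M'" using m c by (intro M'.comm_mem_right)
  then have "ceq N (f \<otimes> comm w m \<otimes> inv f) (comm w m)"
    using fm c fc mc by (intro N.ceq_conj_imp) auto
  then have "ceq N ((f \<otimes> comm w m \<otimes> inv f) \<otimes> comm f m) (comm w m \<otimes> \<one>)"
    using fm[OF m] N.ceq_one_iff by (intro N.ceq_mult) auto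
  then show ?thesis unfolding xf using c fc mc by (simp add: comm_mult_left)
qed

text \<open>What is kept of a compactly generated nilpotent Lie group with a discrete cocompact
  subgroup. Of the manifold structure only the Hausdorff property, local compactness and the absence
  of small subgroups (\<open>nss\<close>) remain. One compact set \<open>K\<close> serves both as a
  fundamental set for \<open>\<Gamma>\<close> and as a generating set of \<open>G\<close>.\<close>

locale lattice = top_group G M for G (structure) and M +
  fixes \<Gamma> K :: "'a set" and d :: nat
  assumes hausdorff: "Hausdorff_space M"
    and loc_compact: "\<exists>U L. nhd U \<and> U \<subseteq> L \<and> compactin M L"
    and nss: "\<exists>V. nhd V \<and> (\<forall>x\<in>carrier G. (\<forall>n::nat. x [^] n \<in> V) \<longrightarrow> x = \<one>)"
    and \<Gamma>_subgroup: "subgroup \<Gamma> G"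
    and discrete: "\<exists>U. nhd U \<and> \<Gamma> \<inter> U \<subseteq> {\<one>}"
    and K_compact: "compactin M K"
    and cover: "\<And>g. g \<in> carrier G \<Longrightarrow> \<exists>k\<in>K. \<exists>\<gamma>\<in>\<Gamma>. g = k \<otimes> \<gamma>"
    and K_gen: "generate G K = carrier G"
    and nil: "nilpotent d G"
begin

sublocale \<Gamma>: subgroup \<Gamma> G by (rule \<Gamma>_subgroup)

lemma uc_top: "uc d = carrier G"
  by (rule nilpotent_imp_uc[OF nil])

lemma K_carrier: "K \<subseteq> carrier G"
  using compactin_subset_topspace[OF K_compact] by simp

text \<open>Neighbourhoods that inject into \<open>G/\<Gamma>\<close>; a left translate of one
  contains at most one element of \<open>\<Gamma>\<close>.\<close>

definition sep :: "'a set \<Rightarrow> bool" where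
  "sep W \<longleftrightarrow> nhd W \<and> (\<forall>x\<in>W. \<forall>y\<in>W. inv x \<otimes> y \<in> \<Gamma> \<longrightarrow> x = y)"

lemma sep_exists: obtains W where "sep W"
proof -
  obtain U where U: "nhd U" "\<Gamma> \<inter> U \<subseteq> {\<one>}" using discrete by blast
  obtain W where W: "nhd W" "\<And>x y. x \<in> W \<Longrightarrow> y \<in> W \<Longrightarrow> inv x \<otimes> y \<in> U" using nhd_mult[OF U(1)] by metis
  have "x = y" if "x \<in> W" "y \<in> W" "inv x \<otimes> y \<in> \<Gamma>" for x y
  proof -
    have "inv x \<otimes> y = \<one>" using W(2) U(2) that by blast
    then show ?thesis using nhd_carrier[OF W(1)] that by (metis inv_equality inv_inv inv_closed)
  qed
  then show thesis using W(1) by (intro that[of W]) (auto simp: sep_def)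
qed

lemma translate_unique:
  assumes "sep W" "c \<in> carrier G" "\<gamma> \<in> \<Gamma>" "\<gamma>' \<in> \<Gamma>" "inv c \<otimes> \<gamma> \<in> W" "inv c \<otimes> \<gamma>' \<in> W"
  shows "\<gamma> = \<gamma>'"
proof -
  have c: "\<gamma> \<in> carrier G" "\<gamma>' \<in> carrier G" using assms by auto
  have "inv (inv c \<otimes> \<gamma>) \<otimes> (inv c \<otimes> \<gamma>') = inv \<gamma> \<otimes> \<gamma>'" using assms(2) c by (simp add: inv_mult_group m_assoc)
  then have "inv (inv c \<otimes> \<gamma>) \<otimes> (inv c \<otimes> \<gamma>') \<in> \<Gamma>" using assms by simp
  then have "inv c \<otimes> \<gamma> = inv c \<otimes> \<gamma>'" using assms by (auto simp: sep_def)
  then show ?thesis using assms(2) c by simp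
qed

lemma finite_\<Gamma>:
  assumes C: "compactin M C" shows "finite (\<Gamma> \<inter> C)"
proof -
  obtain W where W: "sep W" by (rule sep_exists)
  then have "nhd W" by (simp add: sep_def)
  then obtain T where T: "finite T" "T \<subseteq> C" "\<And>x. x \<in> C \<Longrightarrow> \<exists>c\<in>T. inv c \<otimes> x \<in> W"
    using compact_translates[OF C] by metis
  have Tc: "T \<subseteq> carrier G" using T(2) compactin_subset_topspace[OF C] by auto
  have "\<Gamma> \<inter> C \<subseteq> (\<Union>c\<in>T. {\<gamma> \<in> \<Gamma>. inv c \<otimes> \<gamma> \<in> W})" using T by auto
  moreover have "finite {\<gamma> \<in> \<Gamma>. inv c \<otimes> \<gamma> \<in> W}" if "c \<in> T" for c
  proof (cases "{\<gamma> \<in> \<Gamma>. inv c \<otimes> \<gamma> \<in> W} = {}")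
    case False
    then obtain g where "g \<in> \<Gamma>" "inv c \<otimes> g \<in> W" by blast
    then have "{\<gamma> \<in> \<Gamma>. inv c \<otimes> \<gamma> \<in> W} \<subseteq> {g}"
      using translate_unique[OF W, of c] that Tc by blast
    then show ?thesis using finite_subset by blast
  next
    case True then show ?thesis by (metis finite.emptyI)
  qed
  ultimately show ?thesis using T(1) by (meson finite_UN_I finite_subset)
qed

lemma closedin_\<Gamma>: "closedin M \<Gamma>"
proof -
  obtain W where W: "sep W" by (rule sep_exists)
  then have nW: "nhd W" by (simp add: sep_def)
  have "\<exists>T. openin M T \<and> x \<in> T \<and> T \<subseteq> carrier G - \<Gamma>" if x: "x \<in> carrier G - \<Gamma>" for x
  proof -
    let ?t = "{y \<in> carrier G. inv x \<otimes> y \<in> W}"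
    have o: "openin M ?t" using nW x by (intro openin_translate) (auto simp: nhd_def)
    have xt: "x \<in> ?t" using x nW by (simp add: nhd_def)
    show ?thesis
    proof (cases "\<exists>g. g \<in> \<Gamma> \<inter> ?t")
      case False then show ?thesis using o xt by (intro exI[of _ ?t]) auto
    next
      case True
      then obtain g where g: "g \<in> \<Gamma>" "inv x \<otimes> g \<in> W" by auto
      have "y = g" if "y \<in> \<Gamma> \<inter> ?t" for y using translate_unique[OF W, of x y g] g x that by auto
      moreover have "openin M (?t - {g})"
        using o g hausdorff by (intro openin_diff closedin_Hausdorff_singleton) auto
      ultimately show ?thesis using x xt g by (intro exI[of _ "?t - {g}"]) auto
    qed
  qed
  then have "openin M (carrier G - \<Gamma>)" by (subst openin_subopen) blast
  then show ?thesis by (simp add: closedin_def \<Gamma>.subset)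
qed

text \<open>A Schreier argument: for \<open>s\<close> in \<open>K'\<close> and
  \<open>\<kappa>\<close> in \<open>K\<close> the correction \<open>\<gamma>\<close> in
  \<open>s \<otimes> \<kappa> = \<kappa>' \<otimes> \<gamma>\<close> lies in a compact set, hence in
  the finite set \<open>A\<close>. So \<open>K <#> H\<close>, with \<open>H\<close> generated by
  \<open>A\<close>, is stable under left multiplication by generators of \<open>G\<close> and is all
  of \<open>G\<close>. An element of \<open>\<Gamma>\<close> then differs from one of
  \<open>H\<close> by an element of \<open>\<Gamma> \<inter> K\<close>, and that also lies in
  \<open>A\<close>.\<close>

lemma \<Gamma>_fin_gen: "\<exists>A. finite A \<and> A \<subseteq> \<Gamma> \<and> \<Gamma> = generate G A"
proof -
  define K' where "K' = K \<union> (\<lambda>x. inv x) ` K"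
  have Ki: "compactin M ((\<lambda>x. inv x) ` K)" by (rule image_compactin[OF K_compact inv_cont])
  have K': "compactin M K'" unfolding K'_def by (intro compactin_Un K_compact Ki)
  define A where "A = \<Gamma> \<inter> (K \<union> (((\<lambda>x. inv x) ` K <#> K') <#> K))"
  have finA: "finite A"
    unfolding A_def by (intro finite_\<Gamma> compactin_set_mult compactin_Un K_compact K' Ki)
  have AG: "A \<subseteq> \<Gamma>" by (auto simp: A_def)
  have Ac: "A \<subseteq> carrier G" using AG \<Gamma>.subset by blast
  have K'c: "K' \<subseteq> carrier G" using K_carrier by (auto simp: K'_def)
  define H where "H = generate G A"
  have H: "subgroup H G" unfolding H_def by (rule generate_is_subgroup[OF Ac])
  have AH: "A \<subseteq> H" by (auto simp: H_def intro: generate.incl)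
  have Hc: "H \<subseteq> carrier G" by (rule subgroup.subset[OF H])
  have step: "s \<otimes> x \<in> K <#> H" if s: "s \<in> K'" and x: "x \<in> K <#> H" for s x
  proof -
    obtain \<kappa> h where x: "\<kappa> \<in> K" "h \<in> H" "x = \<kappa> \<otimes> h" using x by (auto simp: set_mult_def)
    have c: "s \<in> carrier G" "\<kappa> \<in> carrier G" "h \<in> carrier G" using s x K'c K_carrier Hc by auto
    obtain \<kappa>' \<gamma> where k: "\<kappa>' \<in> K" "\<gamma> \<in> \<Gamma>" "s \<otimes> \<kappa> = \<kappa>' \<otimes> \<gamma>" using cover[of "s \<otimes> \<kappa>"] c by blast
    have kc: "\<kappa>' \<in> carrier G" "\<gamma> \<in> carrier G" using k K_carrier by auto
    have "inv \<kappa>' \<otimes> s \<otimes> \<kappa> = inv \<kappa>' \<otimes> (s \<otimes> \<kappa>)" using kc c by (simp add: m_assoc)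
    also have "\<dots> = \<gamma>" unfolding k(3) using kc by simp
    finally have \<gamma>: "\<gamma> = inv \<kappa>' \<otimes> s \<otimes> \<kappa>" ..
    have "\<gamma> \<in> ((\<lambda>x. inv x) ` K <#> K') <#> K" unfolding \<gamma> set_mult_def using k s x by blast
    then have "\<gamma> \<in> A" using k(2) K_carrier by (simp add: A_def)
    then have "\<gamma> \<otimes> h \<in> H" using AH x subgroup.m_closed[OF H] by blast
    moreover have "s \<otimes> x = \<kappa>' \<otimes> (\<gamma> \<otimes> h)" unfolding x(3) using c kc k(3) by (simp flip: m_assoc)
    ultimately show ?thesis using k by (auto simp: set_mult_def)
  qed
  have KA: "\<gamma> \<in> H" if "\<gamma> \<in> \<Gamma>" "\<gamma> \<in> K" for \<gamma>
  proof -
    have 1: "\<gamma> \<in> carrier G" using that by auto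
    have "\<gamma> \<in> ((\<lambda>x. inv x) ` K <#> K') <#> K"
    proof -
      have "\<gamma> = inv \<gamma> \<otimes> \<gamma> \<otimes> \<gamma>" using 1 by simp
      then show ?thesis using that unfolding set_mult_def K'_def by blast
    qed
    then show ?thesis using that AH by (auto simp: A_def)
  qed
  \<comment> \<open>The translation argument needs a starting point: in a factorization of
    \<open>\<one>\<close> the factor from \<open>K\<close> is inverse to an element of
    \<open>\<Gamma>\<close>, so it lies in \<open>\<Gamma> \<inter> K\<close> and hence in
    \<open>H\<close>.\<close>
  have "\<one> \<in> K <#> H"
  proof -
    obtain \<kappa> \<gamma> where k: "\<kappa> \<in> K" "\<gamma> \<in> \<Gamma>" "\<one> = \<kappa> \<otimes> \<gamma>" using cover[of \<one>] by auto
    have c: "\<kappa> \<in> carrier G" "\<gamma> \<in> carrier G" using k K_carrier by auto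
    have "\<kappa> = inv \<gamma>" using k(3) c by (metis inv_equality)
    then have "\<kappa> \<in> H" using k KA by simp
    then have "inv \<kappa> \<in> H" using subgroup.m_inv_closed[OF H] by blast
    moreover have "\<one> = \<kappa> \<otimes> inv \<kappa>" using c by simp
    ultimately show ?thesis using k(1) unfolding set_mult_def by blast
  qed
  moreover have "g \<otimes> x \<in> K <#> H" if "g \<in> generate G K" "x \<in> K <#> H" for g x
    using that
  proof (induction arbitrary: x rule: generate.induct)
    case one
    have "x \<in> carrier G" using one K_carrier Hc by (auto simp: set_mult_def)
    then show ?case using one by simp
  next
    case (eng g h)
    have "g \<in> carrier G" "h \<in> carrier G" using eng K_gen by auto
    moreover have "x \<in> carrier G" using eng K_carrier Hc by (auto simp: set_mult_def)
    ultimately show ?case using eng by (simp add: m_assoc)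
  qed (auto simp: K'_def intro: step)
  ultimately have all: "g \<in> K <#> H" if "g \<in> carrier G" for g
    using K_gen that r_one[OF that] by metis
  have "\<Gamma> \<subseteq> H"
  proof
    fix \<gamma> assume \<gamma>: "\<gamma> \<in> \<Gamma>"
    obtain \<kappa> h where x: "\<kappa> \<in> K" "h \<in> H" "\<gamma> = \<kappa> \<otimes> h" using all[of \<gamma>] \<gamma> by (auto simp: set_mult_def)
    have HG: "H \<subseteq> \<Gamma>" unfolding H_def by (rule generate_subgroup_incl[OF AG \<Gamma>_subgroup])
    have c: "\<kappa> \<in> carrier G" "h \<in> carrier G" using x K_carrier Hc by auto
    have "\<kappa> = \<gamma> \<otimes> inv h" using x c by (simp add: m_assoc)
    then have "\<kappa> \<in> \<Gamma>" using \<gamma> x HG \<Gamma>.m_inv_closed \<Gamma>.m_closed by (metis subsetD)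
    then show "\<gamma> \<in> H" using x KA subgroup.m_closed[OF H] by blast
  qed
  moreover have "H \<subseteq> \<Gamma>" unfolding H_def by (rule generate_subgroup_incl[OF AG \<Gamma>_subgroup])
  ultimately show ?thesis using finA AG by (auto simp: H_def)
qed

lemma \<Gamma>_subgroup_fin_gen:
  assumes H: "subgroup H G" "H \<subseteq> \<Gamma>" shows "fin_gen H"
proof -
  interpret S: group "G\<lparr>carrier := \<Gamma>\<rparr>" by (rule subgroup_imp_group[OF \<Gamma>_subgroup])
  obtain A where A: "finite A" "A \<subseteq> \<Gamma>" "\<Gamma> = generate G A" using \<Gamma>_fin_gen by blast
  have "S.fin_gen H"
  proof (rule S.fin_gen_nilpotent_subgroup[of A])
    show "carrier (G\<lparr>carrier := \<Gamma>\<rparr>) = generate (G\<lparr>carrier := \<Gamma>\<rparr>) A"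
      using generate_consistent[OF A(2) \<Gamma>_subgroup] A(3) by simp
    show "lower_central (G\<lparr>carrier := \<Gamma>\<rparr>) d = {\<one>\<^bsub>G\<lparr>carrier := \<Gamma>\<rparr>\<^esub>}"
      using nilpotent_subgroup[OF \<Gamma>_subgroup nil] by (simp add: nilpotent_def)
    show "subgroup H (G\<lparr>carrier := \<Gamma>\<rparr>)" by (rule subgroup_incl[OF H(1) \<Gamma>_subgroup H(2)])
  qed (use A in auto)
  then obtain B where B: "finite B" "B \<subseteq> H" "H = generate (G\<lparr>carrier := \<Gamma>\<rparr>) B" by (auto simp: S.fin_gen_def)
  then have "H = generate G B" using generate_consistent[OF _ \<Gamma>_subgroup, of B] H(2) by auto
  then show ?thesis using B by (auto simp: fin_gen_def)
qed

section \<open>Discreteness of \<open>\<Gamma>\<close> and absence of small subgroups modulo normal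
  subgroups\<close>

definition discrete_mod :: "'a set \<Rightarrow> bool" where
  "discrete_mod N \<longleftrightarrow> (\<exists>U. nhd U \<and> (\<forall>\<gamma>\<in>\<Gamma>. \<forall>u\<in>U. ceq N \<gamma> u \<longrightarrow> \<gamma> \<in> N))"

text \<open>Like \<open>discrete_mod\<close>, this is a property of the quotient by \<open>N\<close>
  tested on representatives, so that neighbourhoods of the unit of \<open>G\<close> serve for all
  moduli.\<close>

definition no_small_mod :: "'a set \<Rightarrow> bool" where
  "no_small_mod N \<longleftrightarrow>
     (\<exists>V. nhd V \<and> (\<forall>x\<in>carrier G. (\<forall>n::nat. \<exists>y\<in>V. ceq N (x [^] n) y) \<longrightarrow> x \<in> N))"

text \<open>If all powers of \<open>x\<close> are small modulo \<open>uc (Suc i)\<close>, then for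
  \<open>s\<close> in \<open>K\<close> the iterated commutators of \<open>s\<close> with
  \<open>x\<close> stay, modulo \<open>uc i\<close>, in the compact set \<open>K \<union> L\<close>,
  and their commutators with powers of \<open>x\<close> are small. \<open>Engel\<close> puts
  \<open>comm s x\<close> in \<open>uc i\<close>, and since \<open>K\<close> generates,
  \<open>x\<close> is central modulo \<open>uc i\<close>.\<close>

lemma no_small_mod_uc: "no_small_mod (uc i)"
proof (induction i)
  case 0
  have "ceq {\<one>} x y \<Longrightarrow> x = y" for x y
    unfolding ceq_def by (metis inv_closed inv_equality inv_inv singletonD)
  then show ?case using nss unfolding no_small_mod_def uc.simps by (metis singleton_iff)
next
  case (Suc i)
  interpret N: normal "uc i" G by (rule uc_normal)
  obtain V where V: "nhd V" "\<And>x. x \<in> carrier G \<Longrightarrow> (\<And>n::nat. \<exists>y\<in>V. ceq (uc i) (x [^] n) y) \<Longrightarrow> x \<in> uc i"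
    using Suc unfolding no_small_mod_def by blast
  obtain U L where L: "nhd U" "U \<subseteq> L" "compactin M L" using loc_compact by blast
  \<comment> \<open>Landing in \<open>U\<close>, hence in \<open>L\<close>, keeps the iteration
    inside the compact set for which \<open>W\<close> was chosen; landing in \<open>V\<close> is the
    smallness that \<open>Engel\<close> asks for.\<close>
  obtain W where W: "nhd W" "\<And>c w. c \<in> K \<union> L \<Longrightarrow> w \<in> W \<Longrightarrow> comm c w \<in> V \<inter> U \<and> comm w c \<in> V \<inter> U"
    using nhd_comm[OF compactin_Un[OF K_compact L(3)] nhd_Int[OF V(1) L(1)]] by metis
  have "x \<in> uc (Suc i)" if x: "x \<in> carrier G" and *: "\<And>n::nat. \<exists>y\<in>W. ceq (uc (Suc i)) (x [^] n) y" for x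
  proof -
    obtain w where w: "w \<in> W" "ceq (uc (Suc i)) x w" using *[of 1] x by auto
    have s: "comm s x \<in> uc i" if s: "s \<in> K" for s
    proof (rule Engel[OF uc_normal uc_top _ x refl V(2)])
      show sc: "s \<in> carrier G" using s K_carrier by blast
      fix r n :: nat
      have 1: "ceq (uc i) (((\<lambda>y. comm y x) ^^ r) s) (((\<lambda>y. comm y w) ^^ r) s) \<and> ((\<lambda>y. comm y w) ^^ r) s \<in> K \<union> L" for r
      proof (induction r)
        case (Suc r)
        then show ?case using ceq_comm_uc[OF _ w(2)] W(2)[OF _ w(1)] L(2) by auto
      qed (use s sc in simp)
      obtain w' where w': "w' \<in> W" "ceq (uc (Suc i)) (x [^] n) w'" using * by blast
      show "\<exists>y\<in>V. ceq (uc i) (comm (((\<lambda>y. comm y x) ^^ r) s) (x [^] n)) y"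
        using ceq_comm_uc[OF _ w'(2)] 1[of r] W(2)[OF _ w'(1)] by blast
    qed
    have "K \<subseteq> cent {x} (uc i)" using s K_carrier by (auto simp: cent_def)
    then have "carrier G \<subseteq> cent {x} (uc i)"
      unfolding K_gen[symmetric] using x by (intro generate_subgroup_incl cent_subgroup uc_normal) auto
    then have "comm y x \<in> uc i" if "y \<in> carrier G" for y using that by (auto simp: cent_def)
    then have "comm x y \<in> uc i" if "y \<in> carrier G" for y
      using that x N.m_inv_closed inv_comm by metis
    then show ?thesis using x by (simp add: cent_def)
  qed
  then show ?case unfolding no_small_mod_def using W(1) by blast
qed

text \<open>A conjugate of \<open>comm x m\<close> is a conjugate of \<open>x\<close> times the
  inverse of another one, so smallness of all conjugates by \<open>M'\<close> is inherited by
  commutators with arbitrary \<open>m\<close> in \<open>M'\<close>. This makes \<open>W\<close>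
  uniform in \<open>m\<close> although \<open>M'\<close> need not be compact.\<close>

lemma small_conjugates_iterate:
  assumes N: "N \<lhd> G" and M': "subgroup M' G"
    and C: "\<And>V x. C V x \<longleftrightarrow> x \<in> carrier G \<and> (\<forall>m\<in>M'. \<exists>w\<in>V. ceq N (m \<otimes> x \<otimes> inv m) w)"
  shows "nhd V \<Longrightarrow> \<exists>W. nhd W \<and> (\<forall>x. \<forall>m\<in>M'. C W x \<longrightarrow> (\<forall>r\<le>n. C V (((\<lambda>y. comm y m) ^^ r) x)))"
proof (induction n arbitrary: V)
  case 0 then show ?case by auto
next
  case (Suc n)
  interpret N: normal N G by (rule N)
  obtain V1 where V1: "nhd V1" "V1 \<subseteq> V" "\<And>x. x \<in> V1 \<Longrightarrow> inv x \<in> V1"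
    "\<And>x y. x \<in> V1 \<Longrightarrow> y \<in> V1 \<Longrightarrow> inv x \<otimes> y \<in> V \<and> x \<otimes> y \<in> V" using nhd_mult[OF Suc.prems] by metis
  have one: "C V (comm x m)" if x: "C V1 x" and m: "m \<in> M'" for x m
  proof -
    have xc: "x \<in> carrier G" and mc: "m \<in> carrier G" using x C m subgroup.subset[OF M'] by auto
    have "\<exists>w\<in>V. ceq N (g \<otimes> comm x m \<otimes> inv g) w" if g: "g \<in> M'" for g
    proof -
      have gc: "g \<in> carrier G" using g subgroup.subset[OF M'] by auto
      obtain w where w: "w \<in> V1" "ceq N (g \<otimes> x \<otimes> inv g) w" using x g C by blast
      have "g \<otimes> m \<in> M'" using g m subgroup.m_closed[OF M'] by blast
      then obtain w' where w': "w' \<in> V1" "ceq N ((g \<otimes> m) \<otimes> x \<otimes> inv (g \<otimes> m)) w'" using x C by blast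
      have "ceq N ((g \<otimes> x \<otimes> inv g) \<otimes> inv ((g \<otimes> m) \<otimes> x \<otimes> inv (g \<otimes> m))) (w \<otimes> inv w')"
        using w w' by (intro N.ceq_mult N.ceq_inv)
      moreover have "(g \<otimes> x \<otimes> inv g) \<otimes> inv ((g \<otimes> m) \<otimes> x \<otimes> inv (g \<otimes> m)) = g \<otimes> comm x m \<otimes> inv g"
        using xc mc gc by (simp add: comm_def m_assoc inv_mult_group)
      moreover have "w \<otimes> inv w' \<in> V" using V1(3,4) w w' by blast
      ultimately show ?thesis by auto
    qed
    then show ?thesis using C xc mc by simp
  qed
  obtain W where W: "nhd W" "\<And>x m. m \<in> M' \<Longrightarrow> C W x \<Longrightarrow> (\<forall>r\<le>n. C V1 (((\<lambda>y. comm y m) ^^ r) x))"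
    using Suc.IH[OF V1(1)] by blast
  have "C V (((\<lambda>y. comm y m) ^^ r) x)" if "m \<in> M'" "C W x" "r \<le> Suc n" for x m r
  proof (cases "r \<le> n")
    case True
    then have "C V1 (((\<lambda>y. comm y m) ^^ r) x)" using W that by blast
    then show ?thesis using V1(2) C by (meson subsetD)
  next
    case False
    then have "r = Suc n" using that by simp
    then show ?thesis using one[OF _ that(1)] W(2)[OF that(1,2)] by simp
  qed
  then show ?case using W(1) by blast
qed

text \<open>Let \<open>\<gamma>\<close> be congruent to a small \<open>u\<close> modulo
  \<open>cent M' N\<close>. The commutators of \<open>\<gamma>\<close> with the finitely many
  generators of \<open>M' \<inter> \<Gamma>\<close> belong to \<open>\<Gamma>\<close> and are small
  modulo \<open>N\<close>, so they lie in \<open>N\<close>, and \<open>u\<close> commutes with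
  \<open>M' \<inter> \<Gamma>\<close> modulo \<open>N\<close>. By cocompactness all conjugates of
  \<open>u\<close> by \<open>M'\<close> are then small, and \<open>Engel\<close> shows that
  \<open>u\<close> commutes with all of \<open>M'\<close>.\<close>

lemma discrete_mod_cent:
  assumes M': "M' \<lhd> G" and N: "N \<lhd> G" and D: "discrete_mod N" and E: "no_small_mod N"
    and C: "compactin M C" and cov: "\<And>m. m \<in> M' \<Longrightarrow> \<exists>\<delta>\<in>M' \<inter> \<Gamma>. m \<otimes> inv \<delta> \<in> C"
  shows "discrete_mod (cent M' N)"
proof -
  interpret M': normal M' G by (rule M')
  interpret N: normal N G by (rule N)
  have Cc: "C \<subseteq> carrier G" using compactin_subset_topspace[OF C] by simp
  have "fin_gen (M' \<inter> \<Gamma>)"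
    using M'.subgroup_axioms \<Gamma>_subgroup by (intro \<Gamma>_subgroup_fin_gen subgroups_Inter_pair) auto
  then obtain B where B: "finite B" "B \<subseteq> M' \<inter> \<Gamma>" "M' \<inter> \<Gamma> = generate G B" by (auto simp: fin_gen_def)
  have Bc: "compactin M B" using B(1,2) \<Gamma>.subset by (intro finite_imp_compactin) auto
  obtain U0 where U0: "nhd U0" "\<And>\<gamma> u. \<gamma> \<in> \<Gamma> \<Longrightarrow> u \<in> U0 \<Longrightarrow> ceq N \<gamma> u \<Longrightarrow> \<gamma> \<in> N"
    using D by (auto simp: discrete_mod_def)
  obtain V where V: "nhd V" "\<And>x. x \<in> carrier G \<Longrightarrow> (\<And>n::nat. \<exists>y\<in>V. ceq N (x [^] n) y) \<Longrightarrow> x \<in> N"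
    using E unfolding no_small_mod_def by blast
  define P where "P V x \<longleftrightarrow> x \<in> carrier G \<and> (\<forall>m\<in>M'. \<exists>w\<in>V. ceq N (m \<otimes> x \<otimes> inv m) w)" for V x
  \<comment> \<open>Neighbourhoods are chosen backwards: \<open>V\<close> has no small subgroups
    modulo \<open>N\<close>, \<open>V1\<close> allows for one commutator with
    \<open>m [^] n\<close>, and \<open>W\<close> for up to \<open>d\<close> commutators with
    \<open>m\<close> before it.\<close>
  obtain V1 where V1: "nhd V1" "\<And>x m. m \<in> M' \<Longrightarrow> P V1 x \<Longrightarrow> P V (comm x m)"
    using small_conjugates_iterate[OF N M'.subgroup_axioms P_def V(1), of 1] by fastforce
  obtain W where W: "nhd W" "\<And>x m r. m \<in> M' \<Longrightarrow> P W x \<Longrightarrow> r \<le> d \<Longrightarrow> P V1 (((\<lambda>y. comm y m) ^^ r) x)"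
    using small_conjugates_iterate[OF N M'.subgroup_axioms P_def V1(1), of d] by fastforce
  obtain W2 where W2: "nhd W2" "\<And>c w. c \<in> C \<Longrightarrow> w \<in> W2 \<Longrightarrow> c \<otimes> w \<otimes> inv c \<in> W"
    using nhd_conj[OF C W(1)] by metis
  obtain W3 where W3: "nhd W3" "\<And>c w. c \<in> B \<Longrightarrow> w \<in> W3 \<Longrightarrow> comm c w \<in> U0 \<and> comm w c \<in> U0"
    using nhd_comm[OF Bc U0(1)] by metis
  have "\<gamma> \<in> cent M' N" if \<gamma>: "\<gamma> \<in> \<Gamma>" and u: "u \<in> W2 \<inter> W3" and eq: "ceq (cent M' N) \<gamma> u" for \<gamma> u
  proof -
    have \<gamma>c: "\<gamma> \<in> carrier G" using \<gamma> by simp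
    have uc: "u \<in> carrier G" using u nhd_carrier[OF W2(1)] by blast
    have cm: "ceq N (comm \<gamma> m) (comm u m)" if "m \<in> M'" for m by (rule ceq_comm_cent[OF M' N eq that])
    have "comm \<delta> \<gamma> \<in> N" if \<delta>: "\<delta> \<in> B" for \<delta>
    proof -
      have dG: "\<delta> \<in> \<Gamma>" "\<delta> \<in> M'" "\<delta> \<in> carrier G" using \<delta> B(2) by auto
      have "comm \<gamma> \<delta> \<in> \<Gamma>" unfolding comm_def using \<gamma> dG by simp
      then have "comm \<gamma> \<delta> \<in> N" using U0(2)[of "comm \<gamma> \<delta>" "comm u \<delta>"] cm W3(2) \<delta> dG u by blast
      then show ?thesis using N.m_inv_closed inv_comm \<gamma>c dG by metis
    qed
    then have "B \<subseteq> cent {\<gamma>} N" using B(2) by (auto simp: cent_def)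
    then have "M' \<inter> \<Gamma> \<subseteq> cent {\<gamma>} N" unfolding B(3)
      using \<gamma>c by (intro generate_subgroup_incl cent_subgroup N) auto
    then have "comm \<delta> \<gamma> \<in> N" if "\<delta> \<in> M' \<inter> \<Gamma>" for \<delta> using that by (auto simp: cent_def)
    then have "comm \<gamma> \<delta> \<in> N" if "\<delta> \<in> M' \<inter> \<Gamma>" for \<delta>
      using that N.m_inv_closed inv_comm[of \<delta> \<gamma>] \<gamma>c by (metis IntD2 \<Gamma>.mem_carrier)
    then have ud: "comm u \<delta> \<in> N" if "\<delta> \<in> M' \<inter> \<Gamma>" for \<delta>
      using that cm N.ceq_mem by blast
    \<comment> \<open>Writing \<open>m\<close> as
      \<open>(m \<otimes> inv \<delta>) \<otimes> \<delta>\<close>, conjugation by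
      \<open>\<delta>\<close> fixes \<open>u\<close> modulo \<open>N\<close>, so only conjugation by
      the compact set \<open>C\<close> remains.\<close>
    have Pu: "P W u" unfolding P_def
    proof (intro conjI uc ballI)
      fix m assume m: "m \<in> M'"
      obtain \<delta> where \<delta>: "\<delta> \<in> M' \<inter> \<Gamma>" "m \<otimes> inv \<delta> \<in> C" using cov[OF m] by blast
      have c: "m \<in> carrier G" "\<delta> \<in> carrier G" using m \<delta> by auto
      let ?\<kappa> = "m \<otimes> inv \<delta>"
      have "comm \<delta> u \<in> N" using ud[OF \<delta>(1)] N.m_inv_closed inv_comm[OF uc c(2)] by metis
      then have "ceq N (\<delta> \<otimes> u \<otimes> inv \<delta>) u" using c uc by (intro N.ceq_conj_imp)
      then have "ceq N (?\<kappa> \<otimes> (\<delta> \<otimes> u \<otimes> inv \<delta>) \<otimes> inv ?\<kappa>) (?\<kappa> \<otimes> u \<otimes> inv ?\<kappa>)"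
        using c by (intro N.ceq_mult N.ceq_refl) auto
      moreover have "?\<kappa> \<otimes> (\<delta> \<otimes> u \<otimes> inv \<delta>) \<otimes> inv ?\<kappa> = m \<otimes> u \<otimes> inv m"
        using c uc by (simp add: m_assoc inv_mult_group)
      ultimately show "\<exists>w\<in>W. ceq N (m \<otimes> u \<otimes> inv m) w" using W2(2)[OF \<delta>(2)] u by auto
    qed
    have "comm u m \<in> N" if m: "m \<in> M'" for m
    proof (rule Engel[OF N uc_top uc _ refl V(2)])
      show mc: "m \<in> carrier G" using m by simp
      fix r n :: nat assume "r < d"
      then have "P V1 (((\<lambda>y. comm y m) ^^ r) u)" using W(2)[OF m Pu] by simp
      moreover have "m [^] n \<in> M'" using m by (induction n) (auto intro: M'.mem_mult)
      ultimately have "P V (comm (((\<lambda>y. comm y m) ^^ r) u) (m [^] n))" using V1(2) by blast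
      then have "comm (((\<lambda>y. comm y m) ^^ r) u) (m [^] n) \<in> carrier G"
        "\<exists>y\<in>V. ceq N (\<one> \<otimes> comm (((\<lambda>y. comm y m) ^^ r) u) (m [^] n) \<otimes> inv \<one>) y"
        using M'.one_closed unfolding P_def by blast+
      then show "\<exists>y\<in>V. ceq N (comm (((\<lambda>y. comm y m) ^^ r) u) (m [^] n)) y" by simp
    qed
    then have "u \<in> cent M' N" using uc by (simp add: cent_def)
    then show ?thesis
      by (rule normal.ceq_mem[OF cent_normal[OF M' N] normal.ceq_sym[OF cent_normal[OF M' N] eq]])
  qed
  then show ?thesis unfolding discrete_mod_def using nhd_Int[OF W2(1) W3(1)] by blast
qed

text \<open>Cover \<open>K\<close> by finitely many small translates with centres \<open>c\<close>,
  and fix for each \<open>c\<close> one element \<open>g c\<close> of \<open>\<Gamma>\<close> that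
  completes a point of \<open>K\<close> near \<open>c\<close> to an element of \<open>N\<close>. For
  any \<open>x = \<kappa> \<otimes> \<gamma>\<close> in \<open>N\<close> with
  \<open>\<kappa>\<close> near \<open>c\<close>, the quotient of \<open>\<gamma>\<close> by
  \<open>g c\<close> is small modulo \<open>N\<close>, hence lies in \<open>N\<close>; so
  \<open>x\<close> equals \<open>\<kappa> \<otimes> g c\<close> up to an element of
  \<open>N \<inter> \<Gamma>\<close>.\<close>

lemma discrete_mod_cocompact:
  assumes N: "N \<lhd> G" and D: "discrete_mod N"
  shows "\<exists>C. compactin M C \<and> (\<forall>x\<in>N. \<exists>\<delta>\<in>N \<inter> \<Gamma>. x \<otimes> inv \<delta> \<in> C)"
proof -
  interpret N: normal N G by (rule N)
  obtain U where U: "nhd U" "\<And>\<gamma> u. \<gamma> \<in> \<Gamma> \<Longrightarrow> u \<in> U \<Longrightarrow> ceq N \<gamma> u \<Longrightarrow> \<gamma> \<in> N"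
    using D by (auto simp: discrete_mod_def)
  obtain W where W: "nhd W" "\<And>x y. x \<in> W \<Longrightarrow> y \<in> W \<Longrightarrow> inv x \<otimes> y \<in> U" using nhd_mult[OF U(1)] by metis
  obtain T where T: "finite T" "T \<subseteq> K" "\<And>x. x \<in> K \<Longrightarrow> \<exists>c\<in>T. inv c \<otimes> x \<in> W"
    using compact_translates[OF K_compact W(1)] by metis
  define R where "R c \<gamma> \<longleftrightarrow> \<gamma> \<in> \<Gamma> \<and> (\<exists>\<kappa>\<in>K. inv c \<otimes> \<kappa> \<in> W \<and> \<kappa> \<otimes> \<gamma> \<in> N)" for c \<gamma>
  \<comment> \<open>The value \<open>\<one>\<close> is a default for centres without such an
    element; it keeps \<open>g c\<close> in \<open>\<Gamma>\<close> throughout.\<close>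
  define g where "g c = (if \<exists>\<gamma>. R c \<gamma> then SOME \<gamma>. R c \<gamma> else \<one>)" for c
  have g: "R c (g c)" if "R c \<gamma>" for c \<gamma> using that unfolding g_def by (auto intro: someI)
  have gG: "g c \<in> \<Gamma>" for c using g[of c] by (cases "\<exists>\<gamma>. R c \<gamma>") (auto simp: R_def g_def)
  have "compactin M (K <#> g ` T)"
    using gG T(1) by (intro compactin_set_mult K_compact finite_imp_compactin) auto
  moreover have "\<exists>\<delta>\<in>N \<inter> \<Gamma>. x \<otimes> inv \<delta> \<in> K <#> g ` T" if x: "x \<in> N" for x
  proof -
    obtain \<kappa> \<gamma> where k: "\<kappa> \<in> K" "\<gamma> \<in> \<Gamma>" "x = \<kappa> \<otimes> \<gamma>" using cover[OF N.mem_carrier[OF x]] by blast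
    obtain c where c: "c \<in> T" "inv c \<otimes> \<kappa> \<in> W" using T(3) k(1) by blast
    have "R c \<gamma>" using k c x by (auto simp: R_def)
    then have "R c (g c)" by (rule g)
    then obtain \<kappa>' where k': "\<kappa>' \<in> K" "inv c \<otimes> \<kappa>' \<in> W" "\<kappa>' \<otimes> g c \<in> N" by (auto simp: R_def)
    have cc: "c \<in> carrier G" "\<kappa> \<in> carrier G" "\<kappa>' \<in> carrier G" "\<gamma> \<in> carrier G" "g c \<in> carrier G"
      using c T(2) k k' K_carrier gG by auto
    define t where "t = \<gamma> \<otimes> inv (g c)"
    have tG: "t \<in> \<Gamma>" using k gG by (simp add: t_def)
    have tc: "t \<in> carrier G" using tG by simp
    have "x \<otimes> inv (\<kappa>' \<otimes> g c) \<in> N" by (rule N.mem_mult[OF x N.m_inv_closed[OF k'(3)]])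
    then have "inv \<kappa> \<otimes> (x \<otimes> inv (\<kappa>' \<otimes> g c)) \<otimes> inv (inv \<kappa>) \<in> N" using cc by (intro N.conj_mem) auto
    moreover have "inv \<kappa> \<otimes> (x \<otimes> inv (\<kappa>' \<otimes> g c)) \<otimes> inv (inv \<kappa>) = t \<otimes> inv (inv \<kappa> \<otimes> \<kappa>')"
      unfolding k(3) t_def using cc by (simp add: m_assoc inv_mult_group)
    ultimately have "ceq N t (inv \<kappa> \<otimes> \<kappa>')" using tc cc by (simp add: ceq_def)
    moreover have "inv (inv c \<otimes> \<kappa>) \<otimes> (inv c \<otimes> \<kappa>') = inv \<kappa> \<otimes> \<kappa>'" using cc by (simp add: m_assoc inv_mult_group)
    then have "inv \<kappa> \<otimes> \<kappa>' \<in> U" using W(2)[OF c(2) k'(2)] by simp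
    ultimately have tN: "t \<in> N" using U(2) tG by blast
    \<comment> \<open>This is \<open>inv (g c) \<otimes> \<gamma>\<close>, written as a conjugate of
      \<open>t\<close> so that normality of \<open>N\<close> applies.\<close>
    define \<delta> where "\<delta> = inv (g c) \<otimes> t \<otimes> inv (inv (g c))"
    have "\<delta> \<in> N" unfolding \<delta>_def using tN cc by (intro N.conj_mem) auto
    moreover have "\<delta> \<in> \<Gamma>" unfolding \<delta>_def using tG gG by simp
    moreover have "x \<otimes> inv \<delta> = \<kappa> \<otimes> g c" unfolding \<delta>_def t_def k(3) using cc by (simp add: m_assoc inv_mult_group)
    ultimately show ?thesis using k(1) c(1) by (intro bexI[of _ \<delta>]) (auto simp: set_mult_def)
  qed
  ultimately show ?thesis by blast
qed

lemma discrete_mod_uc: "discrete_mod (uc i)"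
proof (induction i)
  case 0
  obtain U where U: "nhd U" "\<Gamma> \<inter> U \<subseteq> {\<one>}" using discrete by blast
  have "ceq {\<one>} x y \<Longrightarrow> x = y" for x y
    unfolding ceq_def by (metis inv_closed inv_equality inv_inv singletonD)
  then show ?case unfolding discrete_mod_def using U by auto
next
  case (Suc i)
  have "discrete_mod (cent (carrier G) (uc i))"
  proof (rule discrete_mod_cent[OF normal_self uc_normal Suc no_small_mod_uc K_compact])
    fix m assume m: "m \<in> carrier G"
    then obtain k \<gamma> where k: "k \<in> K" "\<gamma> \<in> \<Gamma>" "m = k \<otimes> \<gamma>" using cover by blast
    then show "\<exists>\<delta>\<in>carrier G \<inter> \<Gamma>. m \<otimes> inv \<delta> \<in> K" using K_carrier
      by (intro bexI[of _ \<gamma>]) (auto simp: m_assoc subset_iff)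
  qed
  then show ?case by simp
qed

lemma discrete_mod_Int:
  assumes "M' \<lhd> G" "N \<lhd> G" "discrete_mod M'" "discrete_mod N" shows "discrete_mod (M' \<inter> N)"
proof -
  obtain U where U: "nhd U" "\<And>\<gamma> u. \<gamma> \<in> \<Gamma> \<Longrightarrow> u \<in> U \<Longrightarrow> ceq M' \<gamma> u \<Longrightarrow> \<gamma> \<in> M'"
    using assms unfolding discrete_mod_def by blast
  obtain V where V: "nhd V" "\<And>\<gamma> u. \<gamma> \<in> \<Gamma> \<Longrightarrow> u \<in> V \<Longrightarrow> ceq N \<gamma> u \<Longrightarrow> \<gamma> \<in> N"
    using assms unfolding discrete_mod_def by blast
  have "\<gamma> \<in> M' \<inter> N" if "\<gamma> \<in> \<Gamma>" "u \<in> U \<inter> V" "ceq (M' \<inter> N) \<gamma> u" for \<gamma> u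
    using U(2)[of \<gamma> u] V(2)[of \<gamma> u] that by (auto simp: ceq_def)
  then show ?thesis unfolding discrete_mod_def using nhd_Int[OF U(1) V(1)] by blast
qed

text \<open>Discreteness modulo \<open>uc i\<close> makes \<open>uc i \<inter> \<Gamma>\<close>
  cocompact in \<open>uc i\<close>, and that is the covering hypothesis of
  \<open>discrete_mod_cent\<close> for each centralizer entering the filtration.\<close>

lemma discrete_mod_stab_filtration: "discrete_mod (stab_filtration d j)"
proof -
  have 1: "discrete_mod (cent (uc i) (uc k))" for i k
    using discrete_mod_cocompact[OF uc_normal discrete_mod_uc, of i]
      discrete_mod_cent[OF uc_normal uc_normal discrete_mod_uc no_small_mod_uc] by blast
  have 2: "(\<Inter>i\<le>n. cent (uc i) (uc (i - j))) \<lhd> G" for n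
    by (induction n) (simp_all add: atMost_Suc cent_normal uc_normal normal_Int del: uc.simps)
  have 3: "discrete_mod (\<Inter>i\<le>n. cent (uc i) (uc (i - j)))" for n
  proof (induction n)
    case 0 then show ?case using 1 by (simp del: uc.simps)
  next
    case (Suc n)
    have eq: "(\<Inter>i\<le>Suc n. cent (uc i) (uc (i - j))) = cent (uc (Suc n)) (uc (Suc n - j)) \<inter> (\<Inter>i\<le>n. cent (uc i) (uc (i - j)))"
      by (simp add: atMost_Suc del: uc.simps)
    show ?case unfolding eq by (rule discrete_mod_Int[OF cent_normal[OF uc_normal uc_normal] 2 1 Suc])
  qed
  show ?thesis unfolding stab_filtration_def
    by (rule discrete_mod_Int[OF uc_normal 2 discrete_mod_uc 3])
qed

section \<open>Limits of pairs of parallel cubes modulo \<open>\<Gamma>\<close>\<close>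

sublocale filtration G "stab_filtration d"
  by (rule stab_filtration_filtration[OF uc_top])

lemma hk_closed:
  assumes F: "F \<noteq> bot"
  shows "(\<And>k. hk n i (p k)) \<Longrightarrow> (\<And>\<omega>. limitin M (\<lambda>k. p k \<omega>) (l \<omega>) F) \<Longrightarrow> hk n i l"
proof (induction n arbitrary: i p l)
  case 0
  have "l {} \<in> stab_filtration d i"
    by (rule limitin_closedin[OF 0(2) closedin_stab_filtration[OF hausdorff]]) (use 0(1) F in auto)
  then show ?case using limitin_carrier[OF 0(2)] by simp
next
  case (Suc n)
  have "hk n i l" by (rule Suc.IH[of i p]) (use Suc.prems in auto)
  moreover have "hk n (Suc i) (diff n l)"
    by (rule Suc.IH[of "Suc i" "\<lambda>k. diff n (p k)"])
      (use Suc.prems in \<open>auto simp: diff_def[abs_def] intro!: limitin_mult limitin_inv\<close>)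
  ultimately show ?case by simp
qed

text \<open>Convergence in \<open>G/\<Gamma>\<close> of the cosets of \<open>c k\<close> to the
  coset of \<open>e\<close>, expressed in \<open>G\<close>: right translates of \<open>c k\<close>
  by elements of \<open>\<Gamma>\<close> come close to \<open>e\<close>.\<close>

definition tends_mod :: "('k \<Rightarrow> 'a) \<Rightarrow> 'a \<Rightarrow> 'k filter \<Rightarrow> bool" where
  "tends_mod c e F \<longleftrightarrow> (\<forall>U. nhd U \<longrightarrow> (\<forall>\<^sub>F k in F. \<exists>\<gamma>\<in>\<Gamma>. inv e \<otimes> c k \<otimes> \<gamma> \<in> U))"

text \<open>Uniqueness of limits in \<open>G/\<Gamma>\<close>, which rests on
  \<open>\<Gamma>\<close> being closed: otherwise a product of elements of \<open>\<Gamma>\<close>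
  would land outside \<open>\<Gamma>\<close>.\<close>

lemma tends_mod_unique:
  assumes t: "tends_mod p e F" and l: "limitin M c l F" and F: "F \<noteq> bot" and e: "e \<in> carrier G"
    and p: "\<And>k. p k = c k \<otimes> \<delta> k" and \<delta>: "\<And>k. \<delta> k \<in> \<Gamma>" and c: "\<And>k. c k \<in> carrier G"
  shows "inv e \<otimes> l \<in> \<Gamma>"
proof (rule ccontr)
  assume "inv e \<otimes> l \<notin> \<Gamma>"
  moreover have lc: "l \<in> carrier G" by (rule limitin_carrier[OF l])
  ultimately have mem: "inv e \<otimes> l \<in> carrier G - \<Gamma>" using e by simp
  have "openin M (carrier G - \<Gamma>)" using closedin_\<Gamma> by (simp add: closedin_def)
  from open_near[OF this mem] obtain W O' where W: "nhd W" "openin M O'" "inv e \<otimes> l \<in> O'"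
    "\<And>u y. u \<in> W \<Longrightarrow> y \<in> O' \<Longrightarrow> inv u \<otimes> y \<in> carrier G - \<Gamma>" by metis
  have "limitin M (\<lambda>k. inv e \<otimes> c k) (inv e \<otimes> l) F"
    using l e by (intro limitin_mult) auto
  then have 1: "\<forall>\<^sub>F k in F. inv e \<otimes> c k \<in> O'" using W by (auto simp: limitin_def)
  have "\<forall>\<^sub>F k in F. \<exists>\<gamma>\<in>\<Gamma>. inv e \<otimes> p k \<otimes> \<gamma> \<in> W" using t W(1) by (simp add: tends_mod_def)
  with 1 have "\<forall>\<^sub>F k in F. False"
  proof eventually_elim
    case (elim k)
    then obtain \<gamma> where g: "\<gamma> \<in> \<Gamma>" "inv e \<otimes> p k \<otimes> \<gamma> \<in> W" by blast
    have cc: "\<delta> k \<in> carrier G" "\<gamma> \<in> carrier G" using g \<delta> by auto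
    have "inv (inv e \<otimes> p k \<otimes> \<gamma>) \<otimes> (inv e \<otimes> c k) \<in> carrier G - \<Gamma>" using W(4)[OF g(2)] elim by blast
    moreover have "inv (inv e \<otimes> p k \<otimes> \<gamma>) \<otimes> (inv e \<otimes> c k) = inv \<gamma> \<otimes> inv (\<delta> k)"
      unfolding p using cc c e by (simp add: m_assoc inv_mult_group)
    ultimately show ?case using g \<delta> by simp
  qed
  then show False using F by (simp add: trivial_limit_def)
qed

text \<open>The second cube is the first times a constant \<open>r k\<close>. Factoring
  \<open>p\<close> as \<open>c \<otimes> \<delta>\<close>, and the conjugate of \<open>r k\<close>
  by \<open>\<delta>\<close> as \<open>c' \<otimes> \<delta>'\<close>, makes the second cube
  \<open>c \<otimes> c'\<close> modulo \<open>\<Gamma>\<close>, with \<open>c\<close> and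
  \<open>c'\<close> in compact sets. In the limit the discrepancy between the two cubes is
  \<open>l'\<close>, a cube of degree \<open>1\<close>; it lies in \<open>\<Gamma>\<close> at every
  vertex but the last and therefore, by \<open>hk_full_vertex\<close>, at the last one too.\<close>

theorem cube_limit:
  fixes p :: "'k \<Rightarrow> nat set \<Rightarrow> 'a"
  assumes F: "F \<noteq> bot" and p: "\<And>k. hk d 0 (p k)" and r: "\<And>k. r k \<in> carrier G"
    and e: "\<And>\<omega>. e \<omega> \<in> carrier G" "\<And>\<omega>. e' \<omega> \<in> carrier G"
    and lim: "\<And>\<omega>. \<omega> \<subseteq> {..<d} \<Longrightarrow> tends_mod (\<lambda>k. p k \<omega>) (e \<omega>) F"
    and lim': "\<And>\<omega>. \<omega> \<subseteq> {..<d} \<Longrightarrow> tends_mod (\<lambda>k. p k \<omega> \<otimes> r k) (e' \<omega>) F"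
    and eq: "\<And>\<omega>. \<omega> \<subset> {..<d} \<Longrightarrow> inv (e \<omega>) \<otimes> e' \<omega> \<in> \<Gamma>"
  shows "inv (e {..<d}) \<otimes> e' {..<d} \<in> \<Gamma>"
proof -
  have coc: "\<exists>C. compactin M C \<and> (\<forall>x\<in>stab_filtration d i. \<exists>\<delta>\<in>stab_filtration d i \<inter> \<Gamma>. x \<otimes> inv \<delta> \<in> C)" for i
    by (rule discrete_mod_cocompact[OF stab_filtration_normal discrete_mod_stab_filtration])
  note hc = hk_cocompact[OF \<Gamma>_subgroup compactin_set_mult compactin_Un coc]
  obtain C where C: "compactin M C" "\<And>p. hk d 0 p \<Longrightarrow> \<exists>c \<delta>. hk d 0 c \<and> hk d 0 \<delta> \<and>
     (\<forall>\<omega>. c \<omega> \<in> C \<and> \<delta> \<omega> \<in> \<Gamma>) \<and> (\<forall>\<omega>\<subseteq>{..<d}. p \<omega> = c \<omega> \<otimes> \<delta> \<omega>)" using hc[of d 0] by blast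
  obtain C' where C': "compactin M C'" "\<And>p. hk d 1 p \<Longrightarrow> \<exists>c \<delta>. hk d 1 c \<and> hk d 1 \<delta> \<and>
     (\<forall>\<omega>. c \<omega> \<in> C' \<and> \<delta> \<omega> \<in> \<Gamma>) \<and> (\<forall>\<omega>\<subseteq>{..<d}. p \<omega> = c \<omega> \<otimes> \<delta> \<omega>)" using hc[of d 1] by blast
  obtain c \<delta> where c: "\<And>k. hk d 0 (c k)" "\<And>k. hk d 0 (\<delta> k)" "\<And>k \<omega>. c k \<omega> \<in> C" "\<And>k \<omega>. \<delta> k \<omega> \<in> \<Gamma>"
    "\<And>k \<omega>. \<omega> \<subseteq> {..<d} \<Longrightarrow> p k \<omega> = c k \<omega> \<otimes> \<delta> k \<omega>"
    using C(2)[OF p] by metis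
  \<comment> \<open>Degree \<open>1\<close> instead of \<open>0\<close> is what counts: a
    \<open>d\<close>-dimensional cube of degree \<open>1\<close> is determined by all vertices but
    one, because the filtration is trivial at \<open>1 + d\<close>.\<close>
  have "hk d 1 (\<lambda>\<omega>. \<delta> k \<omega> \<otimes> r k \<otimes> inv (\<delta> k \<omega>))" for k
    using hk_conj[OF c(2) hk_const[of "r k" 1]] r stab_filtration_one[OF uc_top] by simp
  then have "\<forall>k. \<exists>c' \<delta>'. hk d 1 c' \<and> hk d 1 \<delta>' \<and> (\<forall>\<omega>. c' \<omega> \<in> C' \<and> \<delta>' \<omega> \<in> \<Gamma>) \<and>
     (\<forall>\<omega>\<subseteq>{..<d}. \<delta> k \<omega> \<otimes> r k \<otimes> inv (\<delta> k \<omega>) = c' \<omega> \<otimes> \<delta>' \<omega>)" by (intro allI C'(2))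
  then obtain c' \<delta>' where c': "\<And>k. hk d 1 (c' k)" "\<And>k. hk d 1 (\<delta>' k)" "\<And>k \<omega>. c' k \<omega> \<in> C'" "\<And>k \<omega>. \<delta>' k \<omega> \<in> \<Gamma>"
    "\<And>k \<omega>. \<omega> \<subseteq> {..<d} \<Longrightarrow> \<delta> k \<omega> \<otimes> r k \<otimes> inv (\<delta> k \<omega>) = c' k \<omega> \<otimes> \<delta>' k \<omega>"
    by metis
  have cc: "c k \<omega> \<in> carrier G" "\<delta> k \<omega> \<in> carrier G" "c' k \<omega> \<in> carrier G" "\<delta>' k \<omega> \<in> carrier G" for k \<omega>
    using hk_carrier[OF c(1)] hk_carrier[OF c(2)] hk_carrier[OF c'(1)] hk_carrier[OF c'(2)] by simp_all
  have fin: "finite (Pow {..<d})" by simp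
  have "\<exists>F' l. F' \<le> F \<and> F' \<noteq> bot \<and> (\<forall>\<omega>\<in>Pow {..<d}. limitin M (\<lambda>k. c k \<omega>) (l \<omega>) F')"
    by (rule compactin_cluster_finite[OF C(1) fin F]) (simp add: c(3))
  then obtain F1 l where F1: "F1 \<le> F" "F1 \<noteq> bot" and l: "\<forall>\<omega>\<in>Pow {..<d}. limitin M (\<lambda>k. c k \<omega>) (l \<omega>) F1"
    by blast
  have "\<exists>F' l. F' \<le> F1 \<and> F' \<noteq> bot \<and> (\<forall>\<omega>\<in>Pow {..<d}. limitin M (\<lambda>k. c' k \<omega>) (l \<omega>) F')"
    by (rule compactin_cluster_finite[OF C'(1) fin F1(2)]) (simp add: c'(3))
  then obtain F2 l' where F2: "F2 \<le> F1" "F2 \<noteq> bot" and l': "\<forall>\<omega>\<in>Pow {..<d}. limitin M (\<lambda>k. c' k \<omega>) (l' \<omega>) F2"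
    by blast
  have lim2': "limitin M (\<lambda>k. c' k \<omega>) (l' \<omega>) F2" if "\<omega> \<subseteq> {..<d}" for \<omega>
    using l' that by simp
  have F2F: "F2 \<le> F" using F1 F2 by simp
  have lim2: "limitin M (\<lambda>k. c k \<omega>) (l \<omega>) F2" if "\<omega> \<subseteq> {..<d}" for \<omega>
    by (rule limitin_mono[OF bspec[OF l] F2(1)]) (simp add: that)
  have lc: "l \<omega> \<in> carrier G" "l' \<omega> \<in> carrier G" if "\<omega> \<subseteq> {..<d}" for \<omega>
    using lim2[OF that] lim2'[OF that] limitin_carrier by blast+
  have tm: "tends_mod f x F2" if "tends_mod f x F" for f x
    using that F2F filter_leD unfolding tends_mod_def by blast
  have A: "inv (e \<omega>) \<otimes> l \<omega> \<in> \<Gamma>" if w: "\<omega> \<subseteq> {..<d}" for \<omega>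
    by (rule tends_mod_unique[OF tm[OF lim[OF w]] lim2[OF w] F2(2) e(1) c(5)[OF w] c(4) cc(1)])
  have B: "inv (e' \<omega>) \<otimes> (l \<omega> \<otimes> l' \<omega>) \<in> \<Gamma>" if w: "\<omega> \<subseteq> {..<d}" for \<omega>
  proof (rule tends_mod_unique[OF tm[OF lim'[OF w]] limitin_mult[OF lim2[OF w] lim2'[OF w]] F2(2) e(2)])
    fix k
    have "p k \<omega> \<otimes> r k = c k \<omega> \<otimes> (\<delta> k \<omega> \<otimes> r k \<otimes> inv (\<delta> k \<omega>)) \<otimes> \<delta> k \<omega>"
      unfolding c(5)[OF w] using cc r by (simp add: m_assoc)
    also have "\<dots> = c k \<omega> \<otimes> c' k \<omega> \<otimes> (\<delta>' k \<omega> \<otimes> \<delta> k \<omega>)" unfolding c'(5)[OF w] using cc by (simp add: m_assoc)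
    finally show "p k \<omega> \<otimes> r k = c k \<omega> \<otimes> c' k \<omega> \<otimes> (\<delta>' k \<omega> \<otimes> \<delta> k \<omega>)" .
    show "\<delta>' k \<omega> \<otimes> \<delta> k \<omega> \<in> \<Gamma>" using c(4) c'(4) by simp
  qed (use cc in simp)
  \<comment> \<open>\<open>hk_closed\<close> asks for limits at all sets, whereas they are known
    only at subsets of \<open>{..<d}\<close>; intersecting extends the family without changing it at
    the vertices.\<close>
  define L where "L \<omega> = l' (\<omega> \<inter> {..<d})" for \<omega>
  have "hk d 1 L"
  proof (rule hk_closed[OF F2(2)])
    show "hk d 1 (\<lambda>\<omega>. c' k (\<omega> \<inter> {..<d}))" for k
      by (rule hk_cong[OF c'(1)]) (use cc in \<open>auto simp: Int_absorb2\<close>)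
    show "limitin M (\<lambda>k. c' k (\<omega> \<inter> {..<d})) (L \<omega>) F2" for \<omega> unfolding L_def by (rule lim2') simp
  qed
  then have "L {..<d} \<in> \<Gamma>"
  proof (rule hk_full_vertex[OF \<Gamma>_subgroup])
    show "stab_filtration d (1 + d) = {\<one>}" by (simp add: stab_filtration_end)
    fix \<omega> assume w: "\<omega> \<subset> {..<d}"
    then have w': "\<omega> \<subseteq> {..<d}" by blast
    have "inv (inv (e \<omega>) \<otimes> l \<omega>) \<otimes> (inv (e \<omega>) \<otimes> e' \<omega>) \<otimes> (inv (e' \<omega>) \<otimes> (l \<omega> \<otimes> l' \<omega>)) \<in> \<Gamma>"
      by (rule \<Gamma>.m_closed[OF \<Gamma>.m_closed[OF \<Gamma>.m_inv_closed[OF A[OF w']] eq[OF w]] B[OF w']])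
    moreover have "inv (inv (e \<omega>) \<otimes> l \<omega>) \<otimes> (inv (e \<omega>) \<otimes> e' \<omega>) \<otimes> (inv (e' \<omega>) \<otimes> (l \<omega> \<otimes> l' \<omega>)) = l' \<omega>"
      using e lc[OF w'] by (simp add: m_assoc inv_mult_group)
    ultimately show "L \<omega> \<in> \<Gamma>" using w' by (simp add: L_def Int_absorb2)
  qed
  then have l': "l' {..<d} \<in> \<Gamma>" by (simp add: L_def)
  let ?w = "{..<d}"
  have "(inv (e ?w) \<otimes> l ?w) \<otimes> l' ?w \<otimes> inv (inv (e' ?w) \<otimes> (l ?w \<otimes> l' ?w)) \<in> \<Gamma>"
    by (rule \<Gamma>.m_closed[OF \<Gamma>.m_closed[OF A[OF subset_refl] l'] \<Gamma>.m_inv_closed[OF B[OF subset_refl]]])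
  moreover have "(inv (e ?w) \<otimes> l ?w) \<otimes> l' ?w \<otimes> inv (inv (e' ?w) \<otimes> (l ?w \<otimes> l' ?w)) = inv (e ?w) \<otimes> e' ?w"
    using e lc[of ?w] by (simp add: m_assoc inv_mult_group)
  ultimately show ?thesis by simp
qed

end

section \<open>Lie groups as topological groups\<close>

lemma topspace_Euclidean_iff: "x \<in> topspace (Euclidean_space n) \<longleftrightarrow> (\<forall>i\<ge>n. x i = 0)"
  by (simp add: topspace_Euclidean_space)

lemma continuous_map_Euclidean_coord: "continuous_map (Euclidean_space n) euclideanreal (\<lambda>x. x i)"
  unfolding Euclidean_space_def
  using continuous_map_from_subtopology[OF continuous_map_product_projection[of i UNIV "\<lambda>_. euclideanreal"]] by simp

lemma continuous_map_into_Euclidean: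
  assumes "\<And>i. i < n \<Longrightarrow> continuous_map X euclideanreal (\<lambda>x. f x i)"
    and "\<And>x i. x \<in> topspace X \<Longrightarrow> i \<ge> n \<Longrightarrow> f x i = 0"
  shows "continuous_map X (Euclidean_space n) f"
proof (rule continuous_map_eq)
  show "continuous_map X (Euclidean_space n) (\<lambda>x i. if i < n then f x i else 0)"
    using assms(1) by (simp add: continuous_map_componentwise_Euclidean_space)
  fix x assume "x \<in> topspace X"
  then show "(\<lambda>i. if i < n then f x i else 0) = f x" using assms(2)[of x] by (auto simp: fun_eq_iff)
qed

lemma openin_Euclidean_box:
  "openin (Euclidean_space n) {x \<in> topspace (Euclidean_space n). \<forall>i<k. \<bar>x i - e i\<bar> < (r::real)}"
proof (induction k)
  case 0 show ?case using openin_topspace[of "Euclidean_space n"] by simp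
next
  case (Suc k)
  have "openin (Euclidean_space n) {x \<in> topspace (Euclidean_space n). x k \<in> {y. \<bar>y - e k\<bar> < r}}"
  proof (rule openin_continuous_map_preimage[OF continuous_map_Euclidean_coord])
    have "{y. \<bar>y - e k\<bar> < r} = ball (e k) r" by (auto simp: dist_real_def abs_minus_commute)
    then show "openin euclideanreal {y. \<bar>y - e k\<bar> < r}" by simp
  qed
  from openin_Int[OF Suc this] show ?case by (rule back_subst[of "openin _"]) (auto simp: less_Suc_eq)
qed

lemma Euclidean_box_nhd:
  assumes S: "openin (Euclidean_space n) S" and e: "e \<in> S"
  obtains r where "r > 0" "\<And>x. x \<in> topspace (Euclidean_space n) \<Longrightarrow> (\<And>i. i < n \<Longrightarrow> \<bar>x i - e i\<bar> < r) \<Longrightarrow> x \<in> S"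
proof -
  have et: "\<forall>i\<ge>n. e i = 0" using openin_subset[OF S] e topspace_Euclidean_iff by blast
  obtain T where T: "openin (powertop_real UNIV) T" "S = T \<inter> {x. \<forall>i\<ge>n. x i = 0}"
    using S unfolding Euclidean_space_def openin_subtopology by blast
  have "e \<in> T" using T e by simp
  then obtain U where "\<forall>i\<in>UNIV. openin euclideanreal (U i)" "e \<in> PiE UNIV U" and UT: "PiE UNIV U \<subseteq> T"
    using T(1) unfolding openin_product_topology_alt by blast
  then have U: "\<And>i. open (U i)" "\<And>i. e i \<in> U i" by auto
  have "\<exists>r>0. \<forall>i<k. ball (e i) r \<subseteq> U i" for k
  proof (induction k)
    case 0 show ?case by (intro exI[of _ 1]) simp
  next
    case (Suc k)
    then obtain r where r: "r > 0" "\<forall>i<k. ball (e i) r \<subseteq> U i" by blast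
    obtain r' where r': "r' > 0" "ball (e k) r' \<subseteq> U k" using U(1,2) open_contains_ball by meson
    have "ball (e i) (min r r') \<subseteq> U i" if "i < Suc k" for i
      using that r(2) r'(2) subset_ball[of "min r r'" r "e i"] subset_ball[of "min r r'" r' "e i"]
      by (cases "i = k") (auto simp: less_Suc_eq)
    then have "\<forall>i<Suc k. ball (e i) (min r r') \<subseteq> U i" by blast
    then show ?case using r(1) r'(1) by (intro exI[of _ "min r r'"]) simp
  qed
  from this[of n] obtain r where r: "r > 0" "\<And>i. i < n \<Longrightarrow> ball (e i) r \<subseteq> U i" by blast
  show thesis
  proof (rule that[OF r(1)])
    fix x assume x: "x \<in> topspace (Euclidean_space n)" "\<And>i. i < n \<Longrightarrow> \<bar>x i - e i\<bar> < r"
    have "x i \<in> U i" for i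
    proof (cases "i < n")
      case True
      then have "x i \<in> ball (e i) r" using x(2) by (simp add: dist_real_def abs_minus_commute)
      then show ?thesis using r(2) True by blast
    next
      case False
      then have "x i = e i" using x(1) et topspace_Euclidean_iff[of x n] by simp
      then show ?thesis using U(2)[of i] by simp
    qed
    then have "x \<in> T" using UT by (auto simp: PiE_def Pi_def)
    then show "x \<in> S" using T(2) x(1) topspace_Euclidean_iff by blast
  qed
qed

text \<open>The part of an atlas that the source of a smooth map needs for continuity. Only this is
  proved for product charts, which avoids identifying a product of Euclidean spaces with a larger
  one.\<close>

definition charts :: "'p topology \<Rightarrow> nat \<Rightarrow> 'p chart set \<Rightarrow> bool" where
  "charts M n A \<longleftrightarrow> topspace M \<subseteq> (\<Union>(U, \<phi>)\<in>A. U) \<and>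
     (\<forall>(U, \<phi>)\<in>A. openin M U \<and> continuous_map (subtopology M U) (Euclidean_space n) \<phi> \<and> inj_on \<phi> U)"

lemma smooth_atlas_chart:
  assumes "smooth_atlas M n A" "(U, \<phi>) \<in> A"
  shows "openin M U" "openin (Euclidean_space n) (\<phi> ` U)"
    "homeomorphic_map (subtopology M U) (subtopology (Euclidean_space n) (\<phi> ` U)) \<phi>"
    "continuous_map (subtopology M U) (Euclidean_space n) \<phi>" "inj_on \<phi> U"
    "\<And>p. p \<in> U \<Longrightarrow> \<phi> p \<in> topspace (Euclidean_space n)"
proof -
  show 1: "openin M U" "openin (Euclidean_space n) (\<phi> ` U)"
    "homeomorphic_map (subtopology M U) (subtopology (Euclidean_space n) (\<phi> ` U)) \<phi>"
    using assms unfolding smooth_atlas_def by blast+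
  have "topspace (subtopology M U) = U" using openin_subset[OF 1(1)] by auto
  then show "inj_on \<phi> U" using homeomorphic_imp_injective_map[OF 1(3)] by simp
  show "continuous_map (subtopology M U) (Euclidean_space n) \<phi>"
    using homeomorphic_imp_continuous_map[OF 1(3)] continuous_map_into_fulltopology by blast
  show "\<phi> p \<in> topspace (Euclidean_space n)" if "p \<in> U" for p
    using openin_subset[OF 1(2)] that by blast
qed

lemma smooth_atlas_charts:
  assumes A: "smooth_atlas M n A" shows "charts M n A"
proof -
  have "(\<Union>(U, \<phi>)\<in>A. U) = topspace M" using A by (simp add: smooth_atlas_def)
  moreover have "openin M U \<and> continuous_map (subtopology M U) (Euclidean_space n) \<phi> \<and> inj_on \<phi> U"
    if "(U, \<phi>) \<in> A" for U \<phi>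
    using smooth_atlas_chart[OF A that] by simp
  ultimately show ?thesis unfolding charts_def by blast
qed

lemma openin_chart_preimage:
  assumes "openin M U" "continuous_map (subtopology M U) Y \<phi>" "openin Y W"
  shows "openin M {p \<in> U. \<phi> p \<in> W}"
proof -
  have "topspace (subtopology M U) = U" using openin_subset[OF assms(1)] by auto
  then have "openin (subtopology M U) {p \<in> U. \<phi> p \<in> W}"
    using openin_continuous_map_preimage[OF assms(2,3)] by simp
  then show ?thesis using assms(1) by (rule openin_trans_full)
qed

text \<open>Smoothness includes that the chart image of \<open>P\<close>, the set of points sent
  into a given chart domain of the target, is open. As the chart is continuous and injective,
  \<open>P\<close> is itself open, and on \<open>P\<close> the map read in charts is continuous by
  \<open>Ck_on\<close> of order \<open>0\<close>.\<close>

lemma smooth_map_continuous: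
  assumes A: "charts M n A" and B: "smooth_atlas N m B" and sm: "smooth_map n A m B f"
    and f: "\<And>x. x \<in> topspace M \<Longrightarrow> f x \<in> topspace N"
  shows "continuous_map M N f"
proof -
  have "\<exists>O'. openin M O' \<and> x \<in> O' \<and> (\<forall>y\<in>O'. f y \<in> V)"
    if x: "x \<in> topspace M" and V: "openin N V" "f x \<in> V" for x V
  proof -
    obtain U \<phi> where U: "(U, \<phi>) \<in> A" "x \<in> U" using A x by (auto simp: charts_def)
    then have U': "openin M U" "continuous_map (subtopology M U) (Euclidean_space n) \<phi>" "inj_on \<phi> U"
      using A by (auto simp: charts_def)
    have "f x \<in> (\<Union>(U, \<phi>)\<in>B. U)" using B f[OF x] by (simp add: smooth_atlas_def)
    then obtain V' \<psi> where V': "(V', \<psi>) \<in> B" "f x \<in> V'" by auto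
    note ch = smooth_atlas_chart[OF B V'(1)]
    define P where "P = {p \<in> U. f p \<in> V'}"
    define g where "g = (\<lambda>y. \<psi> (f (inv_into U \<phi> y)))"
    have sm': "smooth_on n m (\<phi> ` P) g" using sm U(1) V'(1) unfolding smooth_map_def P_def g_def by blast
    then have S: "openin (Euclidean_space n) (\<phi> ` P)" by (simp add: smooth_on_def)
    have "\<forall>j<m. Ck_on n 0 (\<phi> ` P) (\<lambda>x. g x j)" using sm' unfolding smooth_on_def by blast
    then have gc: "continuous_map (subtopology (Euclidean_space n) (\<phi> ` P)) euclideanreal (\<lambda>y. g y j)" if "j < m" for j
      using that by simp
    have PU: "P \<subseteq> U" by (auto simp: P_def)
    have tU: "topspace (subtopology M U) = U" using openin_subset[OF U'(1)] by auto
    have "P = {p \<in> topspace (subtopology M U). \<phi> p \<in> \<phi> ` P}"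
      unfolding tU using PU U'(3) by (auto dest: inj_onD)
    then have "openin (subtopology M U) P" using openin_continuous_map_preimage[OF U'(2) S] by simp
    then have P: "openin M P" using U'(1) openin_trans_full by blast
    have tP: "topspace (subtopology M P) = P" using openin_subset[OF P] by auto
    have "continuous_map (subtopology M P) (Euclidean_space n) \<phi>"
      using continuous_map_from_subtopology_mono[OF U'(2) PU] .
    then have \<phi>P: "continuous_map (subtopology M P) (subtopology (Euclidean_space n) (\<phi> ` P)) \<phi>"
      using tP by (auto simp: continuous_map_in_subtopology)
    have gf: "g (\<phi> p) = \<psi> (f p)" if "p \<in> P" for p
      using that PU U'(3) by (simp add: g_def subset_iff)
    have fc: "continuous_map (subtopology M P) (Euclidean_space m) (\<lambda>p. \<psi> (f p))"
    proof (rule continuous_map_into_Euclidean)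
      fix j assume "j < m"
      have "continuous_map (subtopology M P) euclideanreal ((\<lambda>y. g y j) \<circ> \<phi>)"
        by (rule continuous_map_compose[OF \<phi>P gc[OF \<open>j < m\<close>]])
      then show "continuous_map (subtopology M P) euclideanreal (\<lambda>p. \<psi> (f p) j)"
        by (rule continuous_map_eq) (use tP gf in auto)
    next
      fix p j assume "p \<in> topspace (subtopology M P)" "m \<le> j"
      then have "f p \<in> V'" using tP by (auto simp: P_def)
      then show "\<psi> (f p) j = 0" using ch(6) topspace_Euclidean_iff \<open>m \<le> j\<close> by blast
    qed
    have tV: "topspace (subtopology N V') = V'" using openin_subset[OF ch(1)] by auto
    have "openin (subtopology N V') (V \<inter> V')" using V(1) openin_subtopology by blast
    moreover have sub: "V \<inter> V' \<subseteq> topspace (subtopology N V')" unfolding tV by simp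
    ultimately have "openin (subtopology (Euclidean_space m) (\<psi> ` V')) (\<psi> ` (V \<inter> V'))"
      using homeomorphic_map_openness[OF ch(3) sub] by blast
    then have o: "openin (Euclidean_space m) (\<psi> ` (V \<inter> V'))" using ch(2) openin_trans_full by blast
    let ?O = "{p \<in> topspace (subtopology M P). \<psi> (f p) \<in> \<psi> ` (V \<inter> V')}"
    have "openin (subtopology M P) ?O" by (rule openin_continuous_map_preimage[OF fc o])
    then have "openin M ?O" using P openin_trans_full by blast
    moreover have "x \<in> ?O" unfolding tP using U V' V by (simp add: P_def)
    moreover have "f p \<in> V" if p: "p \<in> ?O" for p
    proof -
      have "f p \<in> V'" using p tP by (auto simp: P_def)
      obtain v where v: "v \<in> V \<inter> V'" "\<psi> (f p) = \<psi> v" using p by blast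
      then have "f p = v" using inj_onD[OF ch(5)] \<open>f p \<in> V'\<close> by blast
      then show ?thesis using v by simp
    qed
    ultimately show ?thesis by blast
  qed
  then show ?thesis using f by (simp add: continuous_map_eq_topcontinuous_at topcontinuous_at_def)
qed

definition prod_chart :: "nat \<Rightarrow> ('p \<Rightarrow> nat \<Rightarrow> real) \<Rightarrow> ('q \<Rightarrow> nat \<Rightarrow> real) \<Rightarrow> 'p \<times> 'q \<Rightarrow> nat \<Rightarrow> real" where
  "prod_chart n \<phi> \<psi> = (\<lambda>(p, q) i. if i < n then \<phi> p i else \<psi> q (i - n))"

lemma prod_atlas_eq:
  "prod_atlas n A B = {(U \<times> V, prod_chart n \<phi> \<psi>) | U \<phi> V \<psi>. (U, \<phi>) \<in> A \<and> (V, \<psi>) \<in> B}"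
  by (simp add: prod_atlas_def prod_chart_def)

lemma prod_chart_props:
  assumes A: "smooth_atlas M n A" and U: "(U, \<phi>) \<in> A" and V: "(V, \<psi>) \<in> A"
  shows "continuous_map (subtopology (prod_topology M M) (U \<times> V)) (Euclidean_space (n + n)) (prod_chart n \<phi> \<psi>)"
    and "inj_on (prod_chart n \<phi> \<psi>) (U \<times> V)"
    and "\<And>p q. p \<in> U \<Longrightarrow> q \<in> V \<Longrightarrow> prod_chart n \<phi> \<psi> (p, q) \<in> topspace (Euclidean_space (n + n))"
proof -
  note cU = smooth_atlas_chart[OF A U] and cV = smooth_atlas_chart[OF A V]
  show t: "prod_chart n \<phi> \<psi> (p, q) \<in> topspace (Euclidean_space (n + n))" if "p \<in> U" "q \<in> V" for p q
    using cV(6)[OF that(2)] by (auto simp: topspace_Euclidean_iff prod_chart_def)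
  have ts: "topspace (subtopology (prod_topology M M) (U \<times> V)) = U \<times> V"
    using openin_subset[OF cU(1)] openin_subset[OF cV(1)] by auto
  show "continuous_map (subtopology (prod_topology M M) (U \<times> V)) (Euclidean_space (n + n)) (prod_chart n \<phi> \<psi>)"
  proof (rule continuous_map_into_Euclidean)
    fix i assume "i < n + n"
    have 1: "continuous_map (subtopology (prod_topology M M) (U \<times> V)) euclideanreal (\<lambda>z. \<phi> (fst z) i)"
      unfolding subtopology_Times
      using continuous_map_compose[OF continuous_map_compose[OF continuous_map_fst cU(4)] continuous_map_Euclidean_coord]
      by (simp add: o_def)
    have 2: "continuous_map (subtopology (prod_topology M M) (U \<times> V)) euclideanreal (\<lambda>z. \<psi> (snd z) (i - n))"
      unfolding subtopology_Times
      using continuous_map_compose[OF continuous_map_compose[OF continuous_map_snd cV(4)] continuous_map_Euclidean_coord]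
      by (simp add: o_def)
    show "continuous_map (subtopology (prod_topology M M) (U \<times> V)) euclideanreal (\<lambda>z. prod_chart n \<phi> \<psi> z i)"
      using 1 2 by (cases "i < n") (simp_all add: prod_chart_def split_beta)
  next
    fix z i assume "z \<in> topspace (subtopology (prod_topology M M) (U \<times> V))" "n + n \<le> i"
    then show "prod_chart n \<phi> \<psi> z i = 0" unfolding ts using t[of "fst z" "snd z"] topspace_Euclidean_iff by fastforce
  qed
  show "inj_on (prod_chart n \<phi> \<psi>) (U \<times> V)"
  proof (rule inj_onI, clarify)
    fix p q p' q' assume pq: "p \<in> U" "q \<in> V" "p' \<in> U" "q' \<in> V"
      and eq: "prod_chart n \<phi> \<psi> (p, q) = prod_chart n \<phi> \<psi> (p', q')"
    have "\<phi> p i = \<phi> p' i" for i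
    proof (cases "i < n")
      case True then show ?thesis using fun_cong[OF eq, of i] by (simp add: prod_chart_def)
    next
      case False then show ?thesis using cU(6) pq topspace_Euclidean_iff[of _ n] by simp
    qed
    moreover have "\<psi> q i = \<psi> q' i" for i using fun_cong[OF eq, of "n + i"] by (simp add: prod_chart_def)
    ultimately show "p = p' \<and> q = q'"
      using inj_onD[OF cU(5)] inj_onD[OF cV(5)] pq by (metis ext)
  qed
qed

lemma prod_atlas_charts:
  assumes A: "smooth_atlas M n A" shows "charts (prod_topology M M) (n + n) (prod_atlas n A A)"
  unfolding charts_def
proof
  have cov: "\<exists>U \<phi>. (U, \<phi>) \<in> A \<and> p \<in> U" if "p \<in> topspace M" for p
    using A that unfolding smooth_atlas_def by blast
  show "topspace (prod_topology M M) \<subseteq> (\<Union>(U, \<phi>)\<in>prod_atlas n A A. U)"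
  proof
    fix z assume "z \<in> topspace (prod_topology M M)"
    then have "fst z \<in> topspace M" "snd z \<in> topspace M" by auto
    then obtain U \<phi> V \<psi> where "(U, \<phi>) \<in> A" "fst z \<in> U" "(V, \<psi>) \<in> A" "snd z \<in> V" using cov by metis
    then have "(U \<times> V, prod_chart n \<phi> \<psi>) \<in> prod_atlas n A A" "z \<in> U \<times> V"
      by (auto simp: prod_atlas_eq mem_Times_iff)
    then show "z \<in> (\<Union>(U, \<phi>)\<in>prod_atlas n A A. U)" by blast
  qed
  show "\<forall>(U, \<phi>)\<in>prod_atlas n A A. openin (prod_topology M M) U \<and>
       continuous_map (subtopology (prod_topology M M) U) (Euclidean_space (n + n)) \<phi> \<and> inj_on \<phi> U"
    using prod_chart_props[OF A] smooth_atlas_chart(1)[OF A]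
    by (auto simp: prod_atlas_eq openin_prod_Times_iff)
qed

lemma lie_group_top_group:
  assumes "lie_group G M" shows "top_group G M"
proof -
  interpret group G using assms by (simp add: lie_group_def)
  obtain n A where A: "smooth_atlas M n A" and m: "smooth_map (n + n) (prod_atlas n A A) n A (\<lambda>(g, h). g \<otimes>\<^bsub>G\<^esub> h)"
    and i: "smooth_map n A n A (\<lambda>g. inv\<^bsub>G\<^esub> g)" and t: "topspace M = carrier G"
    using assms by (auto simp: lie_group_def)
  show ?thesis
  proof unfold_locales
    show "continuous_map (prod_topology M M) M (\<lambda>(x, y). x \<otimes>\<^bsub>G\<^esub> y)"
      by (rule smooth_map_continuous[OF prod_atlas_charts[OF A] A m]) (auto simp: t)
    show "continuous_map M M (\<lambda>x. inv\<^bsub>G\<^esub> x)"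
      by (rule smooth_map_continuous[OF smooth_atlas_charts[OF A] A i]) (auto simp: t)
  qed (rule t)
qed

lemma compactin_Euclidean_box:
  "compactin (Euclidean_space n) {x \<in> topspace (Euclidean_space n). \<forall>i<n. \<bar>x i - e i\<bar> \<le> (r::real)}" (is "compactin _ ?B")
proof -
  have "?B = PiE UNIV (\<lambda>i. if i < n then {e i - r..e i + r} else {0})"
    by (auto simp: topspace_Euclidean_iff PiE_def Pi_def abs_le_iff not_less split: if_splits)
  then have "compactin (powertop_real UNIV) ?B" by (auto simp: compactin_PiE)
  then show ?thesis by (auto simp: Euclidean_space_def compactin_subtopology topspace_Euclidean_iff)
qed

lemma lie_group_compact_nhd:
  assumes L: "lie_group G M" shows "\<exists>U L. openin M U \<and> \<one>\<^bsub>G\<^esub> \<in> U \<and> U \<subseteq> L \<and> compactin M L"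
proof -
  interpret group G using assms by (simp add: lie_group_def)
  obtain n A where A: "smooth_atlas M n A" and t: "topspace M = carrier G"
    using assms by (auto simp: lie_group_def)
  have "\<one>\<^bsub>G\<^esub> \<in> (\<Union>(U, \<phi>)\<in>A. U)" using A t by (auto simp: smooth_atlas_def)
  then obtain U \<phi> where U: "(U, \<phi>) \<in> A" "\<one>\<^bsub>G\<^esub> \<in> U" by auto
  note ch = smooth_atlas_chart[OF A U(1)]
  define e where "e = \<phi> \<one>\<^bsub>G\<^esub>"
  obtain r where r: "r > 0" "\<And>x. x \<in> topspace (Euclidean_space n) \<Longrightarrow> (\<And>i. i < n \<Longrightarrow> \<bar>x i - e i\<bar> < r) \<Longrightarrow> x \<in> \<phi> ` U"
    using Euclidean_box_nhd[OF ch(2), of e] U(2) unfolding e_def by blast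
  obtain s where s: "0 < s" "s < r" using dense[OF r(1)] by blast
  define B where "B = {x \<in> topspace (Euclidean_space n). \<forall>i<n. \<bar>x i - e i\<bar> \<le> s}"
  define B' where "B' = {x \<in> topspace (Euclidean_space n). \<forall>i<n. \<bar>x i - e i\<bar> < s}"
  define L where "L = {p \<in> U. \<phi> p \<in> B}"
  have tU: "topspace (subtopology M U) = U" using openin_subset[OF ch(1)] by auto
  have BU: "B \<subseteq> \<phi> ` U" using r(2) s(2) unfolding B_def by force
  have "\<phi> ` L = B" using BU unfolding L_def by blast
  moreover have "compactin (subtopology (Euclidean_space n) (\<phi> ` U)) B"
    using compactin_Euclidean_box[of n e s] BU by (simp add: compactin_subtopology B_def)
  moreover have "L \<subseteq> topspace (subtopology M U)" unfolding tU L_def by blast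
  ultimately have "compactin (subtopology M U) L"
    using homeomorphic_map_compactness[OF ch(3)] by metis
  then have "compactin M L" by (simp add: compactin_subtopology)
  moreover have "openin M {p \<in> U. \<phi> p \<in> B'}"
    unfolding B'_def by (rule openin_chart_preimage[OF ch(1,4) openin_Euclidean_box])
  moreover have "\<one>\<^bsub>G\<^esub> \<in> {p \<in> U. \<phi> p \<in> B'}" using U(2) s(1) ch(6)[OF U(2)] by (simp add: e_def B'_def)
  moreover have "{p \<in> U. \<phi> p \<in> B'} \<subseteq> L" by (auto simp: less_imp_le L_def B_def B'_def)
  ultimately show ?thesis by blast
qed

section \<open>Linearizing the multiplication at the unit\<close>

lemma sum_lessThan_add:
  fixes n k :: nat
  shows "(\<Sum>m<n + k. F m) = (\<Sum>m<n. F m) + (\<Sum>m<k. F (n + m) :: real)"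
  by (induction k) (simp_all add: add.assoc)

text \<open>Coordinates are switched from \<open>a\<close> to \<open>x\<close> one at a time; along
  each switch the mean value inequality is applied to \<open>f\<close> minus the linear function of
  slope \<open>c k\<close>, whose derivative is at most \<open>\<eta>\<close> in absolute
  value.\<close>

lemma partial_derivative_bound:
  fixes f :: "(nat \<Rightarrow> real) \<Rightarrow> real"
  assumes box: "\<And>x. (\<And>i. i < N \<Longrightarrow> \<bar>x i - a i\<bar> < r) \<Longrightarrow> (\<And>i. i \<ge> N \<Longrightarrow> x i = 0) \<Longrightarrow> x \<in> S"
    and der: "\<And>i x. i < N \<Longrightarrow> x \<in> S \<Longrightarrow> ((\<lambda>t. f (x(i := t))) has_real_derivative g i x) (at (x i))"
    and bnd: "\<And>i x. i < N \<Longrightarrow> (\<And>i. i < N \<Longrightarrow> \<bar>x i - a i\<bar> < r) \<Longrightarrow> (\<And>i. i \<ge> N \<Longrightarrow> x i = 0) \<Longrightarrow> \<bar>g i x - c i\<bar> \<le> \<eta>"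
    and x: "\<And>i. i < N \<Longrightarrow> \<bar>x i - a i\<bar> < r" "\<And>i. i \<ge> N \<Longrightarrow> x i = 0" and a: "\<And>i. i \<ge> N \<Longrightarrow> a i = 0"
    and r: "r > 0"
  shows "\<bar>f x - f a - (\<Sum>i<N. c i * (x i - a i))\<bar> \<le> \<eta> * (\<Sum>i<N. \<bar>x i - a i\<bar>)"
proof -
  define y where "y k = (\<lambda>i. if i < k then x i else a i)" for k
  have step: "\<bar>f (y (Suc k)) - f (y k) - c k * (x k - a k)\<bar> \<le> \<eta> * \<bar>x k - a k\<bar>" if k: "k < N" for k
  proof -
    define h where "h t = f ((y k)(k := t)) - c k * t" for t
    have in_box: "\<bar>((y k)(k := t)) i - a i\<bar> < r" if "\<bar>t - a k\<bar> < r" "i < N" for t i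
      using that x r by (auto simp: y_def)
    have zero: "((y k)(k := t)) i = 0" if "i \<ge> N" for t i using that k x a by (auto simp: y_def)
    have d: "(h has_field_derivative (g k ((y k)(k := t)) - c k)) (at t within ball (a k) r)" if "t \<in> ball (a k) r" for t
    proof -
      have t: "\<bar>t - a k\<bar> < r" using that by (simp add: dist_real_def abs_minus_commute)
      have "((\<lambda>s. f (((y k)(k := t))(k := s))) has_real_derivative g k ((y k)(k := t))) (at (((y k)(k := t)) k))"
        by (rule der[OF k box[OF in_box[OF t] zero]])
      then have "((\<lambda>s. f ((y k)(k := s))) has_real_derivative g k ((y k)(k := t))) (at t)" by simp
      then have "((\<lambda>s. f ((y k)(k := s)) - c k * s) has_real_derivative (g k ((y k)(k := t)) - c k)) (at t)"
        by (auto intro!: derivative_eq_intros)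
      then show ?thesis unfolding h_def by (rule has_field_derivative_at_within)
    qed
    have "norm (h (x k) - h (a k)) \<le> \<eta> * norm (x k - a k)"
    proof (rule field_differentiable_bound[OF convex_ball d])
      fix t assume "t \<in> ball (a k) r"
      then have t: "\<bar>t - a k\<bar> < r" by (simp add: dist_real_def abs_minus_commute)
      have "\<bar>g k ((y k)(k := t)) - c k\<bar> \<le> \<eta>" by (rule bnd[OF k in_box[OF t] zero])
      then show "norm (g k ((y k)(k := t)) - c k) \<le> \<eta>" unfolding real_norm_def .
    qed (use x(1)[OF k] r in \<open>auto simp: dist_real_def abs_minus_commute\<close>)
    moreover have "(y k)(k := x k) = y (Suc k)" by (auto simp: y_def fun_eq_iff less_Suc_eq)
    moreover have "(y k)(k := a k) = y k" by (auto simp: y_def fun_eq_iff)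
    ultimately show ?thesis by (simp add: h_def algebra_simps)
  qed
  have "\<bar>f (y k) - f (y 0) - (\<Sum>i<k. c i * (x i - a i))\<bar> \<le> \<eta> * (\<Sum>i<k. \<bar>x i - a i\<bar>)" if "k \<le> N" for k
    using that
  proof (induction k)
    case (Suc k)
    have "\<bar>f (y k) - f (y 0) - (\<Sum>i<k. c i * (x i - a i))\<bar> \<le> \<eta> * (\<Sum>i<k. \<bar>x i - a i\<bar>)" using Suc by simp
    with step[of k] Suc.prems show ?case by (simp add: distrib_left)
  qed simp
  from this[of N] have "\<bar>f (y N) - f (y 0) - (\<Sum>i<N. c i * (x i - a i))\<bar> \<le> \<eta> * (\<Sum>i<N. \<bar>x i - a i\<bar>)" by simp
  moreover have "y N = x" "y 0 = a" using x(2) a by (auto simp: y_def fun_eq_iff not_less)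
  ultimately show ?thesis by simp
qed

text \<open>In a chart at the identity the squaring map is \<open>2v + o(v)\<close>, so it expands small displacements;
  hence the powers \<open>x\<^sup>2, x\<^sup>4, x\<^sup>8, \<dots>\<close> of a nontrivial element leave a fixed neighbourhood.\<close>

lemma lie_group_no_small_subgroups:
  assumes L: "lie_group G M"
  shows "\<exists>V. openin M V \<and> \<one>\<^bsub>G\<^esub> \<in> V \<and> (\<forall>x\<in>carrier G. (\<forall>n::nat. x [^]\<^bsub>G\<^esub> n \<in> V) \<longrightarrow> x = \<one>\<^bsub>G\<^esub>)"
proof -
  interpret group G using assms by (simp add: lie_group_def)
  obtain n A where A: "smooth_atlas M n A" and sm: "smooth_map (n + n) (prod_atlas n A A) n A (\<lambda>(g, h). g \<otimes>\<^bsub>G\<^esub> h)"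
    and t: "topspace M = carrier G"
    using assms by (auto simp: lie_group_def)
  have "\<one>\<^bsub>G\<^esub> \<in> (\<Union>(U, \<phi>)\<in>A. U)" using A t by (auto simp: smooth_atlas_def)
  then obtain U \<phi> where U: "(U, \<phi>) \<in> A" "\<one>\<^bsub>G\<^esub> \<in> U" by auto
  note ch = smooth_atlas_chart[OF A U(1)]
  have Uc: "U \<subseteq> carrier G" using openin_subset[OF ch(1)] t by simp
  let ?\<Phi> = "prod_chart n \<phi> \<phi>"
  note pc = prod_chart_props[OF A U(1) U(1)]
  define P where "P = {z \<in> U \<times> U. (case z of (g, h) \<Rightarrow> g \<otimes>\<^bsub>G\<^esub> h) \<in> U}"
  define S where "S = ?\<Phi> ` P"
  define f where "f j x = \<phi> (case inv_into (U \<times> U) ?\<Phi> x of (g, h) \<Rightarrow> g \<otimes>\<^bsub>G\<^esub> h) j" for j :: nat and x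
  have "(U \<times> U, ?\<Phi>) \<in> prod_atlas n A A" using U(1) by (auto simp: prod_atlas_eq)
  then have so: "smooth_on (n + n) n S (\<lambda>x j. f j x)"
    using sm U(1) unfolding smooth_map_def S_def P_def f_def by blast
  then have S: "openin (Euclidean_space (n + n)) S" by (simp add: smooth_on_def)
  have "\<forall>j<n. Ck_on (n + n) (Suc 0) S (\<lambda>x. f j x)" using so unfolding smooth_on_def by blast
  then have "\<forall>j<n. \<forall>i<n + n. \<exists>g. (\<forall>x\<in>S. ((\<lambda>t. f j (x(i := t))) has_real_derivative g x) (at (x i))) \<and>
      continuous_map (subtopology (Euclidean_space (n + n)) S) euclideanreal g"
    by simp
  then obtain g where g: "\<And>j i x. j < n \<Longrightarrow> i < n + n \<Longrightarrow> x \<in> S \<Longrightarrow> ((\<lambda>t. f j (x(i := t))) has_real_derivative g j i x) (at (x i))"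
    "\<And>j i. j < n \<Longrightarrow> i < n + n \<Longrightarrow> continuous_map (subtopology (Euclidean_space (n + n)) S) euclideanreal (g j i)"
    by metis
  have f\<Phi>: "f j (?\<Phi> (p, q)) = \<phi> (p \<otimes>\<^bsub>G\<^esub> q) j" if "p \<in> U" "q \<in> U" for j p q
    using pc(2) that by (simp add: f_def)
  define e where "e = \<phi> \<one>\<^bsub>G\<^esub>"
  define x0 where "x0 = ?\<Phi> (\<one>\<^bsub>G\<^esub>, \<one>\<^bsub>G\<^esub>)"
  have x0S: "x0 \<in> S" using U(2) by (auto simp: S_def x0_def P_def)
  have x0i: "x0 i = e (if i < n then i else i - n)" for i by (simp add: x0_def prod_chart_def e_def)
  have eU: "e \<in> \<phi> ` U" using U(2) by (simp add: e_def)
  have e0: "e i = 0" if "i \<ge> n" for i using ch(6)[OF U(2)] that topspace_Euclidean_iff[of e n] by (simp add: e_def)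
  obtain r1 where r1: "r1 > 0" "\<And>x. x \<in> topspace (Euclidean_space n) \<Longrightarrow> (\<And>i. i < n \<Longrightarrow> \<bar>x i - e i\<bar> < r1) \<Longrightarrow> x \<in> \<phi> ` U"
    using Euclidean_box_nhd[OF ch(2) eU] by blast
  \<comment> \<open>The expected Jacobian of the multiplication at the unit, where
    \<open>(v, w)\<close> is sent to \<open>v + w\<close>.\<close>
  define c where "c j i = (if i = j \<or> i = n + j then 1 else 0 :: real)" for i j :: nat
  have gx0: "g j i x0 = c j i" if j: "j < n" and i: "i < n + n" for i j
  proof -
    define i' where "i' = (if i < n then i else i - n)"
    have i': "i' < n" using i by (auto simp: i'_def)
    have x0i': "x0 i = e i'" by (simp add: x0i i'_def)
    \<comment> \<open>On the coordinate axes through \<open>x0\<close> one factor is the unit, so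
      the product is known exactly and its partial derivatives can be read off.\<close>
    have val: "f j (x0(i := t)) = (e(i' := t)) j" if "\<bar>t - e i'\<bar> < r1" for t
    proof -
      have "e(i' := t) \<in> \<phi> ` U" using that i' e0 r1 by (intro r1(2)) (auto simp: topspace_Euclidean_iff)
      then obtain p where p: "p \<in> U" "\<phi> p = e(i' := t)" by force
      have pcar: "p \<in> carrier G" using p(1) Uc by blast
      have "x0(i := t) = (if i < n then ?\<Phi> (p, \<one>\<^bsub>G\<^esub>) else ?\<Phi> (\<one>\<^bsub>G\<^esub>, p))"
        using p(2) i by (auto simp: fun_eq_iff x0_def prod_chart_def e_def i'_def)
      then show ?thesis using f\<Phi>[OF p(1) U(2)] f\<Phi>[OF U(2) p(1)] p(2) pcar by (simp split: if_splits)
    qed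
    have "((\<lambda>t. (e(i' := t)) j) has_real_derivative c j i) (at (x0 i))"
    proof (cases "j = i'")
      case True
      then have "c j i = 1" using i by (auto simp: c_def i'_def)
      then show ?thesis using True by simp
    next
      case False
      then have "c j i = 0" using j by (auto simp: c_def i'_def)
      then show ?thesis using False by simp
    qed
    then have "((\<lambda>t. f j (x0(i := t))) has_real_derivative c j i) (at (x0 i))"
    proof (rule has_field_derivative_transform_within_open)
      show "open (ball (e i') r1)" "x0 i \<in> ball (e i') r1" using r1(1) x0i' by auto
      fix t assume "t \<in> ball (e i') r1"
      then show "(e(i' := t)) j = f j (x0(i := t))" using val by (simp add: dist_real_def abs_minus_commute)
    qed
    then show ?thesis using g(1)[OF j i x0S] DERIV_unique by blast
  qed
  \<comment> \<open>An error of \<open>2 * \<eta> * nm p\<close> in each of \<open>n\<close>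
    coordinates adds up to at most half of \<open>nm p\<close>, which leaves the factor
    \<open>2 - 1/2 = 3/2\<close> of \<open>sq\<close>. The summand \<open>1\<close> keeps the
    denominator nonzero when \<open>n = 0\<close>.\<close>
  define \<eta> where "\<eta> = 1 / (4 * (real n + 1))"
  have \<eta>: "\<eta> > 0" "2 * \<eta> * real n \<le> 1/2" by (auto simp: \<eta>_def field_simps)
  define W where "W = S \<inter> (\<Inter>j<n. \<Inter>i<n+n. {x \<in> S. g j i x \<in> ball (c j i) \<eta>})"
  have tS: "topspace (subtopology (Euclidean_space (n + n)) S) = S" using openin_subset[OF S] by auto
  have Wji: "openin (Euclidean_space (n + n)) {x \<in> S. g j i x \<in> ball (c j i) \<eta>}" if "j < n" "i < n + n" for i j
    using openin_continuous_map_preimage[OF g(2)[OF that], of "ball (c j i) \<eta>"] S openin_trans_full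
    unfolding tS by auto
  have Wj: "openin (Euclidean_space (n + n)) (S \<inter> (\<Inter>i<m. {x \<in> S. g j i x \<in> ball (c j i) \<eta>}))" if "j < n" "m \<le> n + n" for m j
    using that(2)
  proof (induction m)
    case (Suc m)
    have "openin (Euclidean_space (n + n)) ((S \<inter> (\<Inter>i<m. {x \<in> S. g j i x \<in> ball (c j i) \<eta>})) \<inter> {x \<in> S. g j m x \<in> ball (c j m) \<eta>})"
      by (rule openin_Int) (use Suc Wji[OF that(1), of m] in simp_all)
    then show ?case by (rule back_subst[of "openin _"]) (auto simp: lessThan_Suc)
  qed (use S in simp)
  have "openin (Euclidean_space (n + n)) (S \<inter> (\<Inter>j<m. \<Inter>i<n+n. {x \<in> S. g j i x \<in> ball (c j i) \<eta>}))" if "m \<le> n" for m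
    using that
  proof (induction m)
    case (Suc m)
    have "openin (Euclidean_space (n + n)) ((S \<inter> (\<Inter>j<m. \<Inter>i<n+n. {x \<in> S. g j i x \<in> ball (c j i) \<eta>})) \<inter>
       (S \<inter> (\<Inter>i<n+n. {x \<in> S. g m i x \<in> ball (c m i) \<eta>})))"
      by (rule openin_Int) (use Suc Wj[of m "n + n"] in simp_all)
    then show ?case by (rule back_subst[of "openin _"]) (auto simp: lessThan_Suc)
  qed (use S in simp)
  then have W: "openin (Euclidean_space (n + n)) W" by (simp add: W_def)
  have x0W: "x0 \<in> W" using x0S gx0 \<eta> by (auto simp: W_def)
  obtain r where r: "r > 0" "\<And>x. x \<in> topspace (Euclidean_space (n + n)) \<Longrightarrow> (\<And>i. i < n + n \<Longrightarrow> \<bar>x i - x0 i\<bar> < r) \<Longrightarrow> x \<in> W"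
    using Euclidean_box_nhd[OF W x0W] by blast
  define V where "V = {p \<in> U. \<phi> p \<in> {x \<in> topspace (Euclidean_space n). \<forall>i<n. \<bar>x i - e i\<bar> < r}}"
  have tU: "topspace (subtopology M U) = U" using openin_subset[OF ch(1)] by auto
  have V: "openin M V" unfolding V_def
    by (rule openin_chart_preimage[OF ch(1,4) openin_Euclidean_box])
  have oneV: "\<one>\<^bsub>G\<^esub> \<in> V" using U(2) r(1) ch(6)[OF U(2)] by (simp add: V_def e_def)
  define nm where "nm p = (\<Sum>i<n. \<bar>\<phi> p i - e i\<bar>)" for p
  have sq: "nm (p \<otimes>\<^bsub>G\<^esub> p) \<ge> 3/2 * nm p" if p: "p \<in> V" for p
  proof -
    have pU: "p \<in> U" using p by (simp add: V_def)
    define x where "x = ?\<Phi> (p, p)"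
    have xi: "x i = \<phi> p (if i < n then i else i - n)" for i by (simp add: x_def prod_chart_def)
    have xt: "x \<in> topspace (Euclidean_space (n + n))" unfolding x_def by (rule pc(3)[OF pU pU])
    have xb: "\<bar>x i - x0 i\<bar> < r" if "i < n + n" for i
      using that p by (auto simp: xi x0i V_def)
    have main: "\<bar>(\<phi> (p \<otimes>\<^bsub>G\<^esub> p) j - e j) - 2 * (\<phi> p j - e j)\<bar> \<le> 2 * \<eta> * nm p" if j: "j < n" for j
    proof -
      have "\<bar>f j x - f j x0 - (\<Sum>i<n+n. c j i * (x i - x0 i))\<bar> \<le> \<eta> * (\<Sum>i<n+n. \<bar>x i - x0 i\<bar>)"
      proof (rule partial_derivative_bound[where S = W and r = r and g = "g j"])
        show yW: "y \<in> W" if "\<And>i. i < n + n \<Longrightarrow> \<bar>y i - x0 i\<bar> < r" "\<And>i. n + n \<le> i \<Longrightarrow> y i = 0" for y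
          using that by (intro r(2)) (auto simp: topspace_Euclidean_iff)
        show "\<bar>g j i y - c j i\<bar> \<le> \<eta>" if i: "i < n + n" and y: "\<And>i. i < n + n \<Longrightarrow> \<bar>y i - x0 i\<bar> < r" "\<And>i. n + n \<le> i \<Longrightarrow> y i = 0" for i y
        proof -
          have "g j i y \<in> ball (c j i) \<eta>" using yW[OF y] i j unfolding W_def by blast
          then show ?thesis by (simp add: dist_real_def abs_minus_commute)
        qed
        show "((\<lambda>t. f j (y(i := t))) has_real_derivative g j i y) (at (y i))" if "i < n + n" "y \<in> W" for i y
          using g(1)[OF j that(1)] that(2) by (simp add: W_def)
        show "x i = 0" if "n + n \<le> i" for i using xt that topspace_Euclidean_iff by blast
        show "x0 i = 0" if "n + n \<le> i" for i using that e0 by (simp add: x0i)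
      qed (use xb r(1) in auto)
      moreover have "(\<Sum>i<n+n. \<bar>x i - x0 i\<bar>) = 2 * nm p"
        unfolding sum_lessThan_add by (simp add: xi x0i nm_def)
      moreover have "(\<Sum>i<n+n. c j i * (x i - x0 i)) = 2 * (\<phi> p j - e j)"
      proof -
        have 1: "(\<Sum>i<n. c j i * (x i - x0 i)) = (\<Sum>i<n. if i = j then \<phi> p j - e j else 0)"
          by (rule sum.cong) (auto simp: c_def xi x0i)
        have 2: "(\<Sum>i<n. c j (n + i) * (x (n + i) - x0 (n + i))) = (\<Sum>i<n. if i = j then \<phi> p j - e j else 0)"
          by (rule sum.cong) (use j in \<open>auto simp: c_def xi x0i\<close>)
        show ?thesis unfolding sum_lessThan_add 1 2 using j by simp
      qed
      moreover have "f j x = \<phi> (p \<otimes>\<^bsub>G\<^esub> p) j" unfolding x_def by (rule f\<Phi>[OF pU pU])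
      moreover have "f j x0 = e j" unfolding x0_def using f\<Phi>[OF U(2) U(2)] by (simp add: e_def)
      ultimately show ?thesis by simp
    qed
    have "2 * \<bar>\<phi> p j - e j\<bar> - 2 * \<eta> * nm p \<le> \<bar>\<phi> (p \<otimes>\<^bsub>G\<^esub> p) j - e j\<bar>" if "j < n" for j
      using main[OF that] by linarith
    then have "(\<Sum>j<n. 2 * \<bar>\<phi> p j - e j\<bar> - 2 * \<eta> * nm p) \<le> nm (p \<otimes>\<^bsub>G\<^esub> p)"
      unfolding nm_def[of "p \<otimes>\<^bsub>G\<^esub> p"] by (intro sum_mono) auto
    moreover have "(\<Sum>j<n. 2 * \<bar>\<phi> p j - e j\<bar> - 2 * \<eta> * nm p) = 2 * nm p - (2 * \<eta> * real n) * nm p"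
      by (simp add: sum_subtractf nm_def flip: sum_distrib_left)
    moreover have "(2 * \<eta> * real n) * nm p \<le> 1/2 * nm p"
      using \<eta>(2) by (intro mult_right_mono) (auto simp: nm_def intro: sum_nonneg)
    ultimately show ?thesis by simp
  qed
  have "x = \<one>\<^bsub>G\<^esub>" if x: "x \<in> carrier G" and pw: "\<And>k::nat. x [^]\<^bsub>G\<^esub> k \<in> V" for x
  proof -
    have grow: "nm (x [^]\<^bsub>G\<^esub> ((2::nat) ^ k)) \<ge> (3/2) ^ k * nm x" for k
    proof (induction k)
      case (Suc k)
      have "x [^]\<^bsub>G\<^esub> ((2::nat) ^ Suc k) = x [^]\<^bsub>G\<^esub> ((2::nat) ^ k) \<otimes>\<^bsub>G\<^esub> x [^]\<^bsub>G\<^esub> ((2::nat) ^ k)"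
        using x by (simp add: nat_pow_mult mult_2)
      then have "nm (x [^]\<^bsub>G\<^esub> ((2::nat) ^ Suc k)) \<ge> 3/2 * nm (x [^]\<^bsub>G\<^esub> ((2::nat) ^ k))" using sq[OF pw] by simp
      then show ?case using Suc by simp
    qed (use x in simp)
    have bd: "nm p \<le> real n * r" if "p \<in> V" for p
    proof -
      have "nm p \<le> (\<Sum>i<n. r)" unfolding nm_def by (rule sum_mono) (use that in \<open>auto simp: V_def less_imp_le\<close>)
      then show ?thesis by simp
    qed
    have "nm x \<le> 0"
    proof (rule ccontr)
      assume "\<not> nm x \<le> 0"
      then have pos: "nm x > 0" by simp
      obtain k where "real n * r / nm x < (3/2) ^ k" using real_arch_pow[of "3/2" "real n * r / nm x"] by auto
      then have "real n * r < (3/2) ^ k * nm x" using pos by (simp add: pos_divide_less_eq)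
      then show False using grow[of k] bd[OF pw, of "2 ^ k"] by simp
    qed
    moreover have "\<bar>\<phi> x i - e i\<bar> \<le> nm x" if "i < n" for i
      unfolding nm_def by (rule member_le_sum[of i "{..<n}" "\<lambda>i. \<bar>\<phi> x i - e i\<bar>"]) (use that in auto)
    ultimately have lt: "\<phi> x i = e i" if "i < n" for i using that by fastforce
    have xU: "x \<in> U" using pw[of 1] x by (simp add: V_def)
    have "\<phi> x i = e i" for i
    proof (cases "i < n")
      case True then show ?thesis by (rule lt)
    next
      case False then show ?thesis using e0 ch(6)[OF xU] topspace_Euclidean_iff[of _ n] by simp
    qed
    then have "\<phi> x = \<phi> \<one>\<^bsub>G\<^esub>" by (auto simp: e_def)
    then show ?thesis using inj_onD[OF ch(5)] xU U(2) by blast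
  qed
  then show ?thesis using V oneV by blast
qed

section \<open>Nilsystems\<close>

lemma (in subgroup) l_coset_eq_iff:
  assumes "group G" "x \<in> carrier G" "y \<in> carrier G"
  shows "x <# H = y <# H \<longleftrightarrow> inv x \<otimes> y \<in> H"
proof -
  interpret group G by fact
  show ?thesis
  proof
    assume eq: "x <# H = y <# H"
    have "y \<in> y <# H" using assms one_closed by (auto simp: l_coset_def intro!: bexI[of _ \<one>])
    then obtain h where "h \<in> H" "y = x \<otimes> h" unfolding eq[symmetric] by (auto simp: l_coset_def)
    then show "inv x \<otimes> y \<in> H" using assms by simp
  next
    assume h: "inv x \<otimes> y \<in> H"
    have "y \<otimes> k \<in> x <# H" if "k \<in> H" for k
    proof -
      have "y \<otimes> k = x \<otimes> ((inv x \<otimes> y) \<otimes> k)" using assms that by (simp add: m_assoc)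
      moreover have "(inv x \<otimes> y) \<otimes> k \<in> H" by (rule subgroup.m_closed[OF subgroup_axioms h that])
      ultimately show ?thesis unfolding l_coset_def by blast
    qed
    moreover have "x \<otimes> k \<in> y <# H" if "k \<in> H" for k
    proof -
      have "x \<otimes> k = y \<otimes> (inv (inv x \<otimes> y) \<otimes> k)" using assms that by (simp add: m_assoc inv_mult_group)
      moreover have "inv (inv x \<otimes> y) \<otimes> k \<in> H" by (rule subgroup.m_closed[OF subgroup_axioms m_inv_closed[OF h] that])
      ultimately show ?thesis unfolding l_coset_def by blast
    qed
    ultimately show "x <# H = y <# H" by (auto simp: l_coset_def)
  qed
qed

locale top_group_quotient = top_group G M for G (structure) and M +
  fixes \<Gamma> :: "'a set"
  assumes \<Gamma>_subgroup: "subgroup \<Gamma> G"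
begin

sublocale \<Gamma>: subgroup \<Gamma> G by (rule \<Gamma>_subgroup)

lemma coset_eq_iff: "x \<in> carrier G \<Longrightarrow> y \<in> carrier G \<Longrightarrow> x <# \<Gamma> = y <# \<Gamma> \<longleftrightarrow> inv x \<otimes> y \<in> \<Gamma>"
  by (rule \<Gamma>.l_coset_eq_iff[OF is_group])

lemma coset_mult_right: "x \<in> carrier G \<Longrightarrow> \<gamma> \<in> \<Gamma> \<Longrightarrow> (x \<otimes> \<gamma>) <# \<Gamma> = x <# \<Gamma>"
  by (subst coset_eq_iff) (auto simp: inv_mult_group m_assoc)

text \<open>The saturation of \<open>U\<close> is the union of its right translates by elements of
  \<open>\<Gamma>\<close>.\<close>

lemma openin_coset_image:
  assumes U: "openin M U" shows "openin (nil_space G M \<Gamma>) ((\<lambda>g. g <# \<Gamma>) ` U)"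
proof -
  have Uc: "U \<subseteq> carrier G" using openin_subset[OF U] by simp
  have "{x \<in> carrier G. x <# \<Gamma> \<in> (\<lambda>g. g <# \<Gamma>) ` U} = (\<Union>\<gamma>\<in>\<Gamma>. {x \<in> carrier G. x \<otimes> \<gamma> \<in> U})" (is "?L = ?R")
  proof
    show "?L \<subseteq> ?R"
    proof
      fix x assume "x \<in> ?L"
      then obtain u where x: "x \<in> carrier G" and u: "u \<in> U" "x <# \<Gamma> = u <# \<Gamma>" by auto
      have "inv x \<otimes> u \<in> \<Gamma>" using u x Uc coset_eq_iff by blast
      moreover have "x \<otimes> (inv x \<otimes> u) = u" using x u Uc by auto
      ultimately show "x \<in> ?R" using x u by (intro UN_I[of "inv x \<otimes> u"]) simp_all
    qed
    show "?R \<subseteq> ?L"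
    proof
      fix x assume "x \<in> ?R"
      then obtain \<gamma> where x: "x \<in> carrier G" "\<gamma> \<in> \<Gamma>" "x \<otimes> \<gamma> \<in> U" by blast
      then have "x <# \<Gamma> = (x \<otimes> \<gamma>) <# \<Gamma>" by (simp add: coset_mult_right)
      then show "x \<in> ?L" using x by blast
    qed
  qed
  moreover have "openin M {x \<in> carrier G. x \<otimes> \<gamma> \<in> U}" if "\<gamma> \<in> \<Gamma>" for \<gamma>
  proof -
    have "continuous_map M M (\<lambda>x. x \<otimes> \<gamma>)" using that by (intro continuous_map_mult) auto
    from openin_continuous_map_preimage[OF this U] show ?thesis by simp
  qed
  then have "openin M ?R" by (intro openin_Union) blast
  ultimately have "openin M ?L" by simp
  then show ?thesis using Uc by (auto simp: nil_space_def openin_quotient_top)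
qed

lemma topspace_nil_space: "topspace (nil_space G M \<Gamma>) = (\<lambda>g. g <# \<Gamma>) ` carrier G"
  by (simp add: nil_space_def topspace_quotient_top)

lemma limitin_nil_space:
  assumes lim: "limitin (nil_space G M \<Gamma>) (\<lambda>k. p k <# \<Gamma>) (e <# \<Gamma>) F"
    and e: "e \<in> carrier G" and p: "\<And>k. p k \<in> carrier G" and U: "nhd U"
  shows "\<forall>\<^sub>F k in F. \<exists>\<gamma>\<in>\<Gamma>. inv e \<otimes> p k \<otimes> \<gamma> \<in> U"
proof -
  let ?V = "{x \<in> carrier G. inv e \<otimes> x \<in> U}"
  have "openin M ?V" using U e by (intro openin_translate) (auto simp: nhd_def)
  then have "openin (nil_space G M \<Gamma>) ((\<lambda>g. g <# \<Gamma>) ` ?V)" by (rule openin_coset_image)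
  moreover have "e <# \<Gamma> \<in> (\<lambda>g. g <# \<Gamma>) ` ?V" using e U by (auto simp: nhd_def)
  ultimately have "\<forall>\<^sub>F k in F. p k <# \<Gamma> \<in> (\<lambda>g. g <# \<Gamma>) ` ?V" using lim by (auto simp: limitin_def)
  then show ?thesis
  proof eventually_elim
    case (elim k)
    then obtain x where x: "x \<in> carrier G" "inv e \<otimes> x \<in> U" "p k <# \<Gamma> = x <# \<Gamma>" by auto
    have "inv (p k) \<otimes> x \<in> \<Gamma>" using x p coset_eq_iff by blast
    moreover have "inv e \<otimes> p k \<otimes> (inv (p k) \<otimes> x) = inv e \<otimes> x" using x p e by (simp add: m_assoc)
    ultimately show ?case using x(2) by metis
  qed
qed

text \<open>The projection being open, finitely many images of translates of \<open>U\<close> cover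
  the quotient; the same translates of the compact set \<open>L\<close> make up
  \<open>K\<close>.\<close>

lemma nil_space_compact_cover:
  assumes C: "compact_space (nil_space G M \<Gamma>)" and U: "nhd U" and L: "compactin M L" "U \<subseteq> L"
  obtains K where "compactin M K" "\<And>g. g \<in> carrier G \<Longrightarrow> \<exists>k\<in>K. \<exists>\<gamma>\<in>\<Gamma>. g = k \<otimes> \<gamma>"
proof -
  let ?V = "\<lambda>c. {x \<in> carrier G. inv c \<otimes> x \<in> U}"
  let ?q = "\<lambda>g. g <# \<Gamma>"
  have V: "openin M (?V c)" if "c \<in> carrier G" for c using U that by (intro openin_translate) (auto simp: nhd_def)
  have "compactin (nil_space G M \<Gamma>) (topspace (nil_space G M \<Gamma>))" using C by (simp add: compact_space_def)
  then have "\<exists>\<F>. finite \<F> \<and> \<F> \<subseteq> (\<lambda>c. ?q ` ?V c) ` carrier G \<and> topspace (nil_space G M \<Gamma>) \<subseteq> \<Union>\<F>"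
  proof (rule compactinD)
    show "openin (nil_space G M \<Gamma>) W" if "W \<in> (\<lambda>c. ?q ` ?V c) ` carrier G" for W
      using that V openin_coset_image by blast
    have "c \<in> ?V c" if "c \<in> carrier G" for c using that U by (simp add: nhd_def)
    then show "topspace (nil_space G M \<Gamma>) \<subseteq> \<Union>((\<lambda>c. ?q ` ?V c) ` carrier G)"
      unfolding topspace_nil_space by blast
  qed
  then obtain \<F> where \<F>: "finite \<F>" "\<F> \<subseteq> (\<lambda>c. ?q ` ?V c) ` carrier G" "topspace (nil_space G M \<Gamma>) \<subseteq> \<Union>\<F>" by blast
  obtain T where T: "T \<subseteq> carrier G" "finite T" "\<F> = (\<lambda>c. ?q ` ?V c) ` T"
    using finite_subset_image[OF \<F>(1,2)] by blast
  show thesis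
  proof (rule that[of "T <#> L"])
    show "compactin M (T <#> L)" using T by (intro compactin_set_mult L finite_imp_compactin) auto
    fix g assume g: "g \<in> carrier G"
    then have "?q g \<in> \<Union>\<F>" using \<F>(3) unfolding topspace_nil_space by blast
    then obtain c x where c: "c \<in> T" "x \<in> carrier G" "inv c \<otimes> x \<in> U" "?q g = ?q x" unfolding T(3) by auto
    have cc: "c \<in> carrier G" using c T by blast
    have "x = c \<otimes> (inv c \<otimes> x)" using c cc by simp
    then have "x \<in> T <#> L" using c L(2) unfolding set_mult_def by blast
    moreover have "inv x \<otimes> g \<in> \<Gamma>" using c(2,4) g coset_eq_iff by metis
    moreover have "g = x \<otimes> (inv x \<otimes> g)" using c(2) g by simp
    ultimately show "\<exists>k\<in>T <#> L. \<exists>\<gamma>\<in>\<Gamma>. g = k \<otimes> \<gamma>" by blast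
  qed
qed

end

text \<open>Everything is moved into the subgroup \<open>H\<close> generated by a compact set. It is
  open and meets every coset of \<open>\<Gamma>\<close>, so convergence and equality in the quotient
  can be tested with representatives in \<open>H\<close>, where \<open>cube_limit\<close>
  applies.\<close>

theorem nilsystem_cube_limit:
  fixes G :: "'g monoid" and n :: "'k \<Rightarrow> nat \<Rightarrow> int"
  assumes nilsys: "nilsystem d G M \<Gamma> \<tau>" and F: "F \<noteq> bot"
    and a: "\<And>k. a k \<in> carrier G" and b: "\<And>k. b k \<in> carrier G"
    and lim: "\<And>\<omega>. \<omega> \<subseteq> {..<d} \<Longrightarrow>
      limitin (nil_space G M \<Gamma>) (\<lambda>k. (\<tau> [^]\<^bsub>G\<^esub> (\<Sum>j\<in>\<omega>. n k j) \<otimes>\<^bsub>G\<^esub> a k) <#\<^bsub>G\<^esub> \<Gamma>) (Y \<omega>) F"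
    and lim': "\<And>\<omega>. \<omega> \<subseteq> {..<d} \<Longrightarrow>
      limitin (nil_space G M \<Gamma>) (\<lambda>k. (\<tau> [^]\<^bsub>G\<^esub> (\<Sum>j\<in>\<omega>. n k j) \<otimes>\<^bsub>G\<^esub> b k) <#\<^bsub>G\<^esub> \<Gamma>) (Y' \<omega>) F"
    and eq: "\<And>\<omega>. \<omega> \<subseteq> {..<d} \<Longrightarrow> \<omega> \<noteq> {} \<Longrightarrow> Y \<omega> = Y' \<omega>"
  shows "Y {} = Y' {}"
proof -
  have lie: "lie_group G M" and nil: "nilpotent d G" and \<Gamma>: "subgroup \<Gamma> G"
    and disc: "subtopology M \<Gamma> = discrete_topology \<Gamma>" and comp: "compact_space (nil_space G M \<Gamma>)"
    and \<tau>: "\<tau> \<in> carrier G"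
    using nilsys by (auto simp: nilsystem_def)
  interpret T: top_group G M by (rule lie_group_top_group[OF lie])
  interpret Q: top_group_quotient G M \<Gamma>
    by (intro top_group_quotient.intro top_group_quotient_axioms.intro T.top_group_axioms \<Gamma>)
  have haus: "Hausdorff_space M" using lie by (simp add: lie_group_def)
  obtain U L where U: "openin M U" "\<one>\<^bsub>G\<^esub> \<in> U" "U \<subseteq> L" "compactin M L" using lie_group_compact_nhd[OF lie] by blast
  obtain K0 where K0: "compactin M K0" "\<And>g. g \<in> carrier G \<Longrightarrow> \<exists>k\<in>K0. \<exists>\<gamma>\<in>\<Gamma>. g = k \<otimes>\<^bsub>G\<^esub> \<gamma>"
    using Q.nil_space_compact_cover[OF comp, of U L] U by (auto simp: T.nhd_def)
  \<comment> \<open>\<open>K0\<close> makes \<open>H\<close> meet every coset, \<open>L\<close>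
    makes \<open>H\<close> open since it contains a neighbourhood of the unit, and
    \<open>\<tau>\<close> keeps the translation inside \<open>H\<close>.\<close>
  define K where "K = insert \<tau> (K0 \<union> L)"
  have "compactin M ({\<tau>} \<union> (K0 \<union> L))" using \<tau> K0 U by (intro compactin_Un) auto
  then have K: "compactin M K" by (simp add: K_def)
  have Kc: "K \<subseteq> carrier G" using compactin_subset_topspace[OF K] by simp
  define H where "H = generate G K"
  have H: "subgroup H G" unfolding H_def by (rule T.generate_is_subgroup[OF Kc])
  have Hc: "H \<subseteq> carrier G" by (rule subgroup.subset[OF H])
  have KH: "K \<subseteq> H" unfolding H_def by (auto intro: generate.incl)
  have openH: "openin M H"
  proof (subst openin_subopen, intro ballI)
    fix h assume h: "h \<in> H"
    then have hc: "h \<in> carrier G" using Hc by blast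
    have "openin M {x \<in> carrier G. inv\<^bsub>G\<^esub> h \<otimes>\<^bsub>G\<^esub> x \<in> U}" by (rule T.openin_translate[OF U(1) hc])
    moreover have "h \<in> {x \<in> carrier G. inv\<^bsub>G\<^esub> h \<otimes>\<^bsub>G\<^esub> x \<in> U}" using hc U by simp
    moreover have "x \<in> H" if x: "x \<in> carrier G" "inv\<^bsub>G\<^esub> h \<otimes>\<^bsub>G\<^esub> x \<in> U" for x
    proof -
      have "inv\<^bsub>G\<^esub> h \<otimes>\<^bsub>G\<^esub> x \<in> H" using x(2) U(3) KH by (auto simp: K_def)
      then have "h \<otimes>\<^bsub>G\<^esub> (inv\<^bsub>G\<^esub> h \<otimes>\<^bsub>G\<^esub> x) \<in> H" using h subgroup.m_closed[OF H] by blast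
      then show ?thesis using hc x by simp
    qed
    ultimately show "\<exists>T. openin M T \<and> h \<in> T \<and> T \<subseteq> H" by blast
  qed
  let ?G = "G\<lparr>carrier := H\<rparr>"
  let ?M = "subtopology M H"
  interpret GH: group ?G by (rule T.subgroup_imp_group[OF H])
  have inv_eq: "inv\<^bsub>?G\<^esub> x = inv\<^bsub>G\<^esub> x" if "x \<in> H" for x using T.m_inv_consistent[OF H that] .
  have topH: "topspace ?M = H" using Hc by auto
  have om: "openin ?M W \<longleftrightarrow> openin M W \<and> W \<subseteq> H" for W by (rule openin_open_subtopology[OF openH])
  interpret TH: top_group ?G ?M
  proof unfold_locales
    show "topspace ?M = carrier ?G" using topH by simp
    have "continuous_map (subtopology (prod_topology M M) (H \<times> H)) M (\<lambda>(x, y). x \<otimes>\<^bsub>G\<^esub> y)"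
      by (rule continuous_map_from_subtopology[OF T.mult_cont])
    then show "continuous_map (prod_topology ?M ?M) ?M (\<lambda>(x, y). x \<otimes>\<^bsub>?G\<^esub> y)"
      using subgroup.m_closed[OF H] Hc by (auto simp: continuous_map_in_subtopology simp flip: subtopology_Times)
    have "continuous_map ?M M (\<lambda>x. inv\<^bsub>G\<^esub> x)"
      by (rule continuous_map_from_subtopology[OF T.inv_cont])
    then have "continuous_map ?M ?M (\<lambda>x. inv\<^bsub>G\<^esub> x)"
      using subgroup.m_inv_closed[OF H] by (auto simp: continuous_map_in_subtopology)
    then show "continuous_map ?M ?M (\<lambda>x. inv\<^bsub>?G\<^esub> x)"
      by (rule continuous_map_eq) (use inv_eq topH in auto)
  qed
  have nhdH: "TH.nhd W \<longleftrightarrow> T.nhd W \<and> W \<subseteq> H" for W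
    by (auto simp: TH.nhd_def T.nhd_def om)
  have compH: "compactin ?M C \<longleftrightarrow> compactin M C \<and> C \<subseteq> H" for C by (rule compactin_subtopology)
  have \<Gamma>H: "subgroup (\<Gamma> \<inter> H) ?G"
    by (rule T.subgroup_incl[OF T.subgroups_Inter_pair[OF \<Gamma> H] H]) simp
  interpret LH: lattice ?G ?M "\<Gamma> \<inter> H" K d
  proof (intro lattice.intro lattice_axioms.intro TH.top_group_axioms)
    show "Hausdorff_space ?M" by (rule Hausdorff_space_subtopology[OF haus])
    show "\<exists>U L. TH.nhd U \<and> U \<subseteq> L \<and> compactin ?M L"
      using U KH by (intro exI[of _ U] exI[of _ L]) (auto simp: nhdH compH T.nhd_def K_def)
    obtain V where V: "openin M V" "\<one>\<^bsub>G\<^esub> \<in> V" "\<And>x. x \<in> carrier G \<Longrightarrow> (\<And>n::nat. x [^]\<^bsub>G\<^esub> n \<in> V) \<Longrightarrow> x = \<one>\<^bsub>G\<^esub>"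
      using lie_group_no_small_subgroups[OF lie] by blast
    have "TH.nhd (V \<inter> H)" using V openH subgroup.one_closed[OF H] by (auto simp: nhdH T.nhd_def)
    moreover have "x = \<one>\<^bsub>G\<^esub>" if "x \<in> H" "\<forall>n::nat. x [^]\<^bsub>?G\<^esub> n \<in> V \<inter> H" for x
      using that V(3)[of x] Hc T.nat_pow_consistent[of x _ H] by auto
    ultimately show "\<exists>V. TH.nhd V \<and> (\<forall>x\<in>carrier ?G. (\<forall>n::nat. x [^]\<^bsub>?G\<^esub> n \<in> V) \<longrightarrow> x = \<one>\<^bsub>?G\<^esub>)"
      by (intro exI[of _ "V \<inter> H"]) simp
    have "openin (subtopology M \<Gamma>) {\<one>\<^bsub>G\<^esub>}" unfolding disc using subgroup.one_closed[OF \<Gamma>] by simp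
    then obtain D where D: "openin M D" "{\<one>\<^bsub>G\<^esub>} = D \<inter> \<Gamma>" unfolding openin_subtopology by blast
    show "\<exists>U. TH.nhd U \<and> \<Gamma> \<inter> H \<inter> U \<subseteq> {\<one>\<^bsub>?G\<^esub>}"
      using D openH subgroup.one_closed[OF H] by (intro exI[of _ "D \<inter> H"]) (auto simp: nhdH T.nhd_def)
    show "subgroup (\<Gamma> \<inter> H) ?G" by (rule \<Gamma>H)
    show "compactin ?M K" using K KH by (simp add: compH)
    show "\<exists>k\<in>K. \<exists>\<gamma>\<in>\<Gamma> \<inter> H. g = k \<otimes>\<^bsub>?G\<^esub> \<gamma>" if "g \<in> carrier ?G" for g
    proof -
      have g: "g \<in> H" "g \<in> carrier G" using that Hc by auto
      obtain k \<gamma> where k: "k \<in> K0" "\<gamma> \<in> \<Gamma>" "g = k \<otimes>\<^bsub>G\<^esub> \<gamma>" using K0(2)[OF g(2)] by blast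
      have kH: "k \<in> H" using k(1) KH by (auto simp: K_def)
      have c: "k \<in> carrier G" "\<gamma> \<in> carrier G" using kH Hc k(2) by auto
      have "inv\<^bsub>G\<^esub> k \<otimes>\<^bsub>G\<^esub> g \<in> H" using kH g subgroup.m_closed[OF H] subgroup.m_inv_closed[OF H] by blast
      then have "\<gamma> \<in> H" unfolding k(3) using c by simp
      then show ?thesis using k by (auto simp: K_def)
    qed
    show "generate ?G K = carrier ?G" using T.generate_consistent[OF KH H] by (simp add: H_def)
    show "nilpotent d ?G" by (rule T.nilpotent_subgroup[OF H nil])
  qed
  \<comment> \<open>Representatives are exchanged for ones in \<open>H\<close>. The second conjunct
    says that the cosets still agree after any left translation, hence along the orbit.\<close>
  have rep: "\<exists>h\<in>H. h <#\<^bsub>G\<^esub> \<Gamma> = g <#\<^bsub>G\<^esub> \<Gamma> \<and> (\<forall>t\<in>carrier G. (t \<otimes>\<^bsub>G\<^esub> h) <#\<^bsub>G\<^esub> \<Gamma> = (t \<otimes>\<^bsub>G\<^esub> g) <#\<^bsub>G\<^esub> \<Gamma>)"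
    if g: "g \<in> carrier G" for g
  proof -
    obtain k \<gamma> where k: "k \<in> K0" "\<gamma> \<in> \<Gamma>" "g = k \<otimes>\<^bsub>G\<^esub> \<gamma>" using K0(2)[OF g] by blast
    have kH: "k \<in> H" using k(1) KH by (auto simp: K_def)
    have c: "k \<in> carrier G" "\<gamma> \<in> carrier G" using kH Hc k(2) by auto
    have "(t \<otimes>\<^bsub>G\<^esub> k) <#\<^bsub>G\<^esub> \<Gamma> = (t \<otimes>\<^bsub>G\<^esub> g) <#\<^bsub>G\<^esub> \<Gamma>" if "t \<in> carrier G" for t
      using Q.coset_mult_right[of "t \<otimes>\<^bsub>G\<^esub> k" \<gamma>] that c k(2) by (simp add: k(3) T.m_assoc)
    moreover have "k <#\<^bsub>G\<^esub> \<Gamma> = g <#\<^bsub>G\<^esub> \<Gamma>" using Q.coset_mult_right[OF c(1) k(2)] by (simp add: k(3))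
    ultimately show ?thesis using kH by blast
  qed
  have "\<forall>k. \<exists>h\<in>H. \<forall>t\<in>carrier G. (t \<otimes>\<^bsub>G\<^esub> h) <#\<^bsub>G\<^esub> \<Gamma> = (t \<otimes>\<^bsub>G\<^esub> a k) <#\<^bsub>G\<^esub> \<Gamma>" using rep[OF a] by blast
  then obtain a' where a': "\<And>k. a' k \<in> H" "\<And>k t. t \<in> carrier G \<Longrightarrow> (t \<otimes>\<^bsub>G\<^esub> a' k) <#\<^bsub>G\<^esub> \<Gamma> = (t \<otimes>\<^bsub>G\<^esub> a k) <#\<^bsub>G\<^esub> \<Gamma>" by metis
  have "\<forall>k. \<exists>h\<in>H. \<forall>t\<in>carrier G. (t \<otimes>\<^bsub>G\<^esub> h) <#\<^bsub>G\<^esub> \<Gamma> = (t \<otimes>\<^bsub>G\<^esub> b k) <#\<^bsub>G\<^esub> \<Gamma>" using rep[OF b] by blast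
  then obtain b' where b': "\<And>k. b' k \<in> H" "\<And>k t. t \<in> carrier G \<Longrightarrow> (t \<otimes>\<^bsub>G\<^esub> b' k) <#\<^bsub>G\<^esub> \<Gamma> = (t \<otimes>\<^bsub>G\<^esub> b k) <#\<^bsub>G\<^esub> \<Gamma>" by metis
  have Yrep: "\<exists>h\<in>H. Z = h <#\<^bsub>G\<^esub> \<Gamma>" if Z: "Z \<in> topspace (nil_space G M \<Gamma>)" for Z
  proof -
    obtain g where "g \<in> carrier G" "Z = g <#\<^bsub>G\<^esub> \<Gamma>" using Z unfolding Q.topspace_nil_space by blast
    then show ?thesis using rep by metis
  qed
  have "\<forall>\<omega>. \<exists>h\<in>H. \<omega> \<subseteq> {..<d} \<longrightarrow> Y \<omega> = h <#\<^bsub>G\<^esub> \<Gamma>"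
    using Yrep[OF limitin_topspace[OF lim]] subgroup.one_closed[OF H] by blast
  then obtain y where y: "\<And>\<omega>. y \<omega> \<in> H" "\<And>\<omega>. \<omega> \<subseteq> {..<d} \<Longrightarrow> Y \<omega> = y \<omega> <#\<^bsub>G\<^esub> \<Gamma>" by metis
  have "\<forall>\<omega>. \<exists>h\<in>H. \<omega> \<subseteq> {..<d} \<longrightarrow> Y' \<omega> = h <#\<^bsub>G\<^esub> \<Gamma>"
    using Yrep[OF limitin_topspace[OF lim']] subgroup.one_closed[OF H] by blast
  then obtain y' where y': "\<And>\<omega>. y' \<omega> \<in> H" "\<And>\<omega>. \<omega> \<subseteq> {..<d} \<Longrightarrow> Y' \<omega> = y' \<omega> <#\<^bsub>G\<^esub> \<Gamma>" by metis
  have \<tau>H: "\<tau> \<in> H" using KH by (simp add: K_def)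
  have pow_eq: "\<tau> [^]\<^bsub>?G\<^esub> (z::int) = \<tau> [^]\<^bsub>G\<^esub> z" for z using T.int_pow_consistent[OF H \<tau>H] by simp
  have powH: "\<tau> [^]\<^bsub>G\<^esub> (z::int) \<in> H" for z using T.subgroup_int_pow_closed[OF H \<tau>H] .
  \<comment> \<open>Regional proximality singles out the vertex \<open>{}\<close>, the cube group the vertex \<open>{..<d}\<close>; hence the complements.\<close>
  define p where "p k \<omega> = \<tau> [^]\<^bsub>?G\<^esub> ((\<Sum>j<d. n k j) + (\<Sum>j\<in>\<omega> \<inter> {..<d}. - n k j)) \<otimes>\<^bsub>?G\<^esub> a' k" for k \<omega>
  have exp: "(\<Sum>j<d. n k j) + (\<Sum>j\<in>\<omega> \<inter> {..<d}. - n k j) = (\<Sum>j\<in>{..<d} - \<omega>. n k j)" for k \<omega>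
  proof -
    have "(\<Sum>j<d. n k j) = (\<Sum>j\<in>{..<d} - \<omega>. n k j) + (\<Sum>j\<in>\<omega> \<inter> {..<d}. n k j)"
      by (subst sum.union_disjoint[symmetric]) (auto intro: sum.cong)
    then show ?thesis by (simp add: sum_negf)
  qed
  have pe: "p k \<omega> = \<tau> [^]\<^bsub>G\<^esub> (\<Sum>j\<in>{..<d} - \<omega>. n k j) \<otimes>\<^bsub>G\<^esub> a' k" for k \<omega>
    unfolding p_def exp pow_eq by simp
  have pH: "p k \<omega> \<in> H" for k \<omega> unfolding pe using powH a' subgroup.m_closed[OF H] by blast
  \<comment> \<open>The quotient is formed on the right so that one constant carries the whole cube
    through \<open>a' k\<close> to the parallel one through \<open>b' k\<close>.\<close>
  define r where "r k = inv\<^bsub>?G\<^esub> (a' k) \<otimes>\<^bsub>?G\<^esub> b' k" for k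
  have rH: "r k \<in> carrier ?G" for k
    unfolding r_def by (rule GH.m_closed[OF GH.inv_closed]) (simp_all add: a'(1) b'(1))
  have pr: "p k \<omega> \<otimes>\<^bsub>G\<^esub> r k = \<tau> [^]\<^bsub>G\<^esub> (\<Sum>j\<in>{..<d} - \<omega>. n k j) \<otimes>\<^bsub>G\<^esub> b' k" for k \<omega>
    unfolding pe r_def using powH a' b' Hc inv_eq[OF a'(1)] by (simp add: T.m_assoc subset_iff)
  have tends: "LH.tends_mod q e F"
    if "limitin (nil_space G M \<Gamma>) (\<lambda>k. q k <#\<^bsub>G\<^esub> \<Gamma>) (e <#\<^bsub>G\<^esub> \<Gamma>) F" "e \<in> H" "\<And>k. q k \<in> H" for q :: "'k \<Rightarrow> 'g" and e
    unfolding LH.tends_mod_def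
  proof (intro allI impI)
    fix W assume W: "TH.nhd W"
    have "\<forall>\<^sub>F k in F. \<exists>\<gamma>\<in>\<Gamma>. inv\<^bsub>G\<^esub> e \<otimes>\<^bsub>G\<^esub> q k \<otimes>\<^bsub>G\<^esub> \<gamma> \<in> W"
      by (rule Q.limitin_nil_space[OF that(1)]) (use that W nhdH Hc in auto)
    then show "\<forall>\<^sub>F k in F. \<exists>\<gamma>\<in>\<Gamma> \<inter> H. inv\<^bsub>?G\<^esub> e \<otimes>\<^bsub>?G\<^esub> q k \<otimes>\<^bsub>?G\<^esub> \<gamma> \<in> W"
    proof eventually_elim
      case (elim k)
      then obtain \<gamma> where g: "\<gamma> \<in> \<Gamma>" "inv\<^bsub>G\<^esub> e \<otimes>\<^bsub>G\<^esub> q k \<otimes>\<^bsub>G\<^esub> \<gamma> \<in> W" by blast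
      let ?x = "inv\<^bsub>G\<^esub> e \<otimes>\<^bsub>G\<^esub> q k"
      have x: "?x \<in> H" using that subgroup.m_closed[OF H] subgroup.m_inv_closed[OF H] by blast
      have "?x \<otimes>\<^bsub>G\<^esub> \<gamma> \<in> H" using g(2) W nhdH by blast
      then have "inv\<^bsub>G\<^esub> ?x \<otimes>\<^bsub>G\<^esub> (?x \<otimes>\<^bsub>G\<^esub> \<gamma>) \<in> H"
        using x subgroup.m_closed[OF H] subgroup.m_inv_closed[OF H] by blast
      moreover have "inv\<^bsub>G\<^esub> ?x \<otimes>\<^bsub>G\<^esub> (?x \<otimes>\<^bsub>G\<^esub> \<gamma>) = \<gamma>"
        by (rule T.mult_inv_cancel(1)) (use x Hc g(1) in auto)
      ultimately show ?case using g inv_eq[OF that(2)] by auto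
    qed
  qed
  have "inv\<^bsub>?G\<^esub> (y ({..<d} - {..<d})) \<otimes>\<^bsub>?G\<^esub> y' ({..<d} - {..<d}) \<in> \<Gamma> \<inter> H"
  proof (rule LH.cube_limit[OF F, where p = p and r = r and e = "\<lambda>\<omega>. y ({..<d} - \<omega>)" and e' = "\<lambda>\<omega>. y' ({..<d} - \<omega>)"])
    show "LH.hk d 0 (p k)" for k
      unfolding p_def
      by (rule LH.hk_translate) (use \<tau>H a' GH.stab_filtration_one[OF LH.uc_top] in auto)
    show "r k \<in> carrier ?G" for k by (rule rH)
    show "y ({..<d} - \<omega>) \<in> carrier ?G" "y' ({..<d} - \<omega>) \<in> carrier ?G" for \<omega> using y y' by auto
    fix \<omega> assume "\<omega> \<subseteq> {..<d}"
    show "LH.tends_mod (\<lambda>k. p k \<omega>) (y ({..<d} - \<omega>)) F"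
    proof (rule tends)
      show "limitin (nil_space G M \<Gamma>) (\<lambda>k. p k \<omega> <#\<^bsub>G\<^esub> \<Gamma>) (y ({..<d} - \<omega>) <#\<^bsub>G\<^esub> \<Gamma>) F"
        using lim[of "{..<d} - \<omega>"] y(2)[of "{..<d} - \<omega>"] a'(2) powH Hc by (simp add: pe subset_iff)
    qed (use y pH in auto)
    show "LH.tends_mod (\<lambda>k. p k \<omega> \<otimes>\<^bsub>?G\<^esub> r k) (y' ({..<d} - \<omega>)) F"
    proof (rule tends)
      show "limitin (nil_space G M \<Gamma>) (\<lambda>k. (p k \<omega> \<otimes>\<^bsub>?G\<^esub> r k) <#\<^bsub>G\<^esub> \<Gamma>) (y' ({..<d} - \<omega>) <#\<^bsub>G\<^esub> \<Gamma>) F"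
        using lim'[of "{..<d} - \<omega>"] y'(2)[of "{..<d} - \<omega>"] b'(2) powH Hc by (simp add: pr subset_iff)
    qed (use y' pH rH subgroup.m_closed[OF H] in auto)
  next
    fix \<omega> assume w: "\<omega> \<subset> {..<d}"
    let ?w = "{..<d} - \<omega>"
    have "?w \<noteq> {}" "?w \<subseteq> {..<d}" using w by auto
    then have "y ?w <#\<^bsub>G\<^esub> \<Gamma> = y' ?w <#\<^bsub>G\<^esub> \<Gamma>" using eq y(2) y'(2) by metis
    then have "inv\<^bsub>G\<^esub> (y ?w) \<otimes>\<^bsub>G\<^esub> y' ?w \<in> \<Gamma>" using Q.coset_eq_iff y(1) y'(1) Hc by blast
    then show "inv\<^bsub>?G\<^esub> (y ?w) \<otimes>\<^bsub>?G\<^esub> y' ?w \<in> \<Gamma> \<inter> H"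
      using inv_eq[OF y(1)] y(1) y'(1) subgroup.m_closed[OF H] subgroup.m_inv_closed[OF H] by simp
  qed
  then have "inv\<^bsub>G\<^esub> (y {}) \<otimes>\<^bsub>G\<^esub> y' {} \<in> \<Gamma>" using inv_eq[OF y(1)] by simp
  then have "y {} <#\<^bsub>G\<^esub> \<Gamma> = y' {} <#\<^bsub>G\<^esub> \<Gamma>" using Q.coset_eq_iff y(1) y'(1) Hc by blast
  then show ?thesis using y(2)[of "{}"] y'(2)[of "{}"] by simp
qed

section \<open>Integer powers of a homeomorphism\<close>

locale dynamical_system =
  fixes X :: "'a::metric_space set" and T :: "'a \<Rightarrow> 'a"
  assumes tds: "tds (top_of_set X) T"
begin

lemma compact_X: "compact X"
  using tds by (simp add: tds_def compact_space_def)

lemma T_bij: "bij_betw T X X"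
  using tds homeomorphic_imp_injective_map[of "top_of_set X" "top_of_set X" T]
    homeomorphic_imp_surjective_map[of "top_of_set X" "top_of_set X" T]
  by (simp add: tds_def bij_betw_def)

lemma T_closed: "x \<in> X \<Longrightarrow> T x \<in> X"
  using T_bij bij_betwE by blast

lemma inv_T:
  assumes "x \<in> X" shows "inv_into X T x \<in> X" "T (inv_into X T x) = x" "inv_into X T (T x) = x"
proof -
  show "inv_into X T x \<in> X" using assms T_bij bij_betw_inv_into bij_betwE by metis
  show "T (inv_into X T x) = x" by (rule bij_betw_inv_into_right[OF T_bij assms])
  show "inv_into X T (T x) = x" by (rule bij_betw_inv_into_left[OF T_bij assms])
qed

abbreviation pw :: "int \<Rightarrow> 'a \<Rightarrow> 'a" where "pw \<equiv> ipow X T"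

lemma funpow_closed: "(\<And>x. x \<in> X \<Longrightarrow> f x \<in> X) \<Longrightarrow> x \<in> X \<Longrightarrow> (f ^^ n) x \<in> X"
  by (induction n) auto

lemma pw_closed: "x \<in> X \<Longrightarrow> pw n x \<in> X"
  using funpow_closed[of T] funpow_closed[of "inv_into X T"] T_closed inv_T(1) by (simp add: ipow_def)

lemma pw_0 [simp]: "pw 0 x = x"
  by (simp add: ipow_def)

lemma pw_Suc: assumes x: "x \<in> X" shows "pw (n + 1) x = T (pw n x)"
proof (cases "0 \<le> n")
  case True
  then have "nat (n + 1) = Suc (nat n)" by simp
  then show ?thesis using True by (simp add: ipow_def)
next
  case False
  define m where "m = nat (- (n + 1))"
  have m: "nat (- n) = Suc m" using False by (simp add: m_def)
  have "(inv_into X T ^^ m) x \<in> X" using funpow_closed[of "inv_into X T"] inv_T(1) x by blast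
  then have "T (pw n x) = (inv_into X T ^^ m) x" using False m inv_T(2) by (simp add: ipow_def)
  also have "\<dots> = pw (n + 1) x"
  proof (cases "n + 1 = 0")
    case True then show ?thesis by (simp add: m_def)
  next
    case False
    then have "\<not> 0 \<le> n + 1" using \<open>\<not> 0 \<le> n\<close> by simp
    then show ?thesis by (simp add: ipow_def m_def)
  qed
  finally show ?thesis ..
qed

lemma T_inj: "x \<in> X \<Longrightarrow> y \<in> X \<Longrightarrow> T x = T y \<Longrightarrow> x = y"
  using T_bij by (auto simp: bij_betw_def inj_on_def)

lemma pw_add: assumes x: "x \<in> X" shows "pw (m + n) x = pw m (pw n x)"
proof (induction m rule: int_induct[where k = 0])
  case (step1 i)
  have "pw (i + 1 + n) x = T (pw (i + n) x)" using pw_Suc[OF x, of "i + n"] by (simp add: algebra_simps)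
  then show ?case using step1 pw_Suc[OF pw_closed[OF x], of i n] by simp
next
  case (step2 i)
  have "T (pw (i - 1 + n) x) = pw (i + n) x" using pw_Suc[OF x, of "i - 1 + n"] by (simp add: algebra_simps)
  also have "\<dots> = T (pw (i - 1) (pw n x))" using step2 pw_Suc[OF pw_closed[OF x], of "i - 1" n] by simp
  finally show ?case using T_inj pw_closed x by blast
qed simp

lemma pw_commute:
  assumes f: "\<And>x. x \<in> X \<Longrightarrow> f x \<in> X" "\<And>x. x \<in> X \<Longrightarrow> f (T x) = T (f x)" and x: "x \<in> X"
  shows "f (pw n x) = pw n (f x)"
proof (induction n rule: int_induct[where k = 0])
  case (step1 i)
  then show ?case using pw_Suc f x pw_closed by simp
next
  case (step2 i)
  have "T (f (pw (i - 1) x)) = f (pw i x)" using pw_Suc[OF x, of "i - 1"] f(2)[OF pw_closed[OF x], of "i - 1"] by simp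
  also have "\<dots> = T (pw (i - 1) (f x))" using step2 pw_Suc[OF f(1)[OF x], of "i - 1"] by simp
  finally show ?case using T_inj f(1) pw_closed x by blast
qed simp

lemma continuous_on_funpow:
  "continuous_on X f \<Longrightarrow> (\<And>x. x \<in> X \<Longrightarrow> f x \<in> X) \<Longrightarrow> continuous_on X (f ^^ n)"
proof (induction n)
  case 0 then show ?case by (simp add: id_def)
next
  case (Suc n)
  have "(f ^^ n) ` X \<subseteq> X" using funpow_closed Suc.prems(2) by blast
  then show ?case using continuous_on_compose2[OF Suc.prems(1) Suc.IH[OF Suc.prems]] by simp
qed

lemma continuous_on_pw: "continuous_on X (pw n)"
proof -
  obtain g where g: "homeomorphic_maps (top_of_set X) (top_of_set X) T g"
    using tds by (auto simp: tds_def homeomorphic_map_maps)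
  then have c: "continuous_on X T" "continuous_on X g" and gX: "\<And>x. x \<in> X \<Longrightarrow> g x \<in> X"
    and Tg: "\<And>x. x \<in> X \<Longrightarrow> T (g x) = x"
    by (auto simp: homeomorphic_maps_def continuous_map_iff_continuous2)
  have "inv_into X T x = g x" if "x \<in> X" for x
    using T_inj[OF inv_T(1)[OF that] gX[OF that]] inv_T(2)[OF that] Tg[OF that] by simp
  then have "continuous_on X (inv_into X T)" using c(2) continuous_on_cong by metis
  then show ?thesis using continuous_on_funpow[OF c(1) T_closed] continuous_on_funpow[OF _ inv_T(1)]
    by (simp add: ipow_def)
qed

end

section \<open>Regional proximality and nilsystem factors\<close>

context dynamical_system
begin

lemma equivariant_pw:
  assumes G: "group G" "\<tau> \<in> carrier G" and \<Gamma>: "\<Gamma> \<subseteq> carrier G"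
    and f: "\<And>x. x \<in> X \<Longrightarrow> f x \<in> (\<lambda>g. g <#\<^bsub>G\<^esub> \<Gamma>) ` carrier G"
    and fT: "\<And>x. x \<in> X \<Longrightarrow> f (T x) = \<tau> <#\<^bsub>G\<^esub> f x" and x: "x \<in> X"
  shows "f (pw n x) = \<tau> [^]\<^bsub>G\<^esub> n <#\<^bsub>G\<^esub> f x"
proof -
  interpret group G by fact
  have fc: "f x \<subseteq> carrier G" if "x \<in> X" for x
  proof -
    obtain g where "g \<in> carrier G" "f x = g <#\<^bsub>G\<^esub> \<Gamma>" using f[OF \<open>x \<in> X\<close>] by blast
    then show ?thesis using l_coset_subset_G[OF \<Gamma>] by simp
  qed
  show ?thesis
  proof (induction n rule: int_induct[where k = 0])
    case base
    then show ?case using fc[OF x] by (simp add: lcos_mult_one)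
  next
    case (step1 i)
    have "\<tau> [^]\<^bsub>G\<^esub> (i + 1) = \<tau> \<otimes>\<^bsub>G\<^esub> \<tau> [^]\<^bsub>G\<^esub> i" using int_pow_mult[OF G(2), of 1 i] G by (simp add: add.commute)
    then show ?case using step1 pw_Suc[OF x] fT[OF pw_closed[OF x]] G fc[OF x] by (simp add: lcos_m_assoc)
  next
    case (step2 i)
    let ?z = "pw (i - 1) x"
    have z: "?z \<in> X" by (rule pw_closed[OF x])
    have "\<tau> <#\<^bsub>G\<^esub> f ?z = \<tau> [^]\<^bsub>G\<^esub> i <#\<^bsub>G\<^esub> f x" using step2 fT[OF z] pw_Suc[OF x, of "i - 1"] by simp
    then have "inv\<^bsub>G\<^esub> \<tau> <#\<^bsub>G\<^esub> (\<tau> <#\<^bsub>G\<^esub> f ?z) = inv\<^bsub>G\<^esub> \<tau> <#\<^bsub>G\<^esub> (\<tau> [^]\<^bsub>G\<^esub> i <#\<^bsub>G\<^esub> f x)" by simp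
    then have "f ?z = (inv\<^bsub>G\<^esub> \<tau> \<otimes>\<^bsub>G\<^esub> \<tau> [^]\<^bsub>G\<^esub> i) <#\<^bsub>G\<^esub> f x"
      using G fc[OF z] fc[OF x] by (simp add: lcos_m_assoc lcos_mult_one)
    moreover have "\<tau> [^]\<^bsub>G\<^esub> (i - 1) = inv\<^bsub>G\<^esub> \<tau> \<otimes>\<^bsub>G\<^esub> \<tau> [^]\<^bsub>G\<^esub> i"
      using int_pow_mult[OF G(2), of "-1" i] G by (simp add: int_pow_neg add.commute)
    ultimately show ?case by simp
  qed
qed

text \<open>Approximating configurations for \<open>1 / real (Suc k)\<close> are made to converge,
  along one filter, at all vertices of both cubes simultaneously. The limits agree except possibly
  at the empty vertex, where they are \<open>x\<close> and \<open>y\<close>; after applying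
  \<open>f\<close>, a difference there is excluded by \<open>nilsystem_cube_limit\<close>.\<close>

lemma RP_nilsystem_factor:
  fixes G :: "'g monoid"
  assumes xy: "(x, y) \<in> RP d X T" and nilsys: "nilsystem d G M \<Gamma> \<tau>"
    and f: "continuous_map (top_of_set X) (nil_space G M \<Gamma>) f"
    and fT: "\<And>x. x \<in> X \<Longrightarrow> f (T x) = nil_map G \<tau> (f x)"
  shows "f x = f y"
proof -
  have G: "group G" "\<tau> \<in> carrier G" "subgroup \<Gamma> G" and M: "topspace M = carrier G"
    using nilsys by (auto simp: nilsystem_def lie_group_def)
  interpret group G by fact
  have \<Gamma>c: "\<Gamma> \<subseteq> carrier G" by (rule subgroup.subset[OF G(3)])
  have ft: "f z \<in> (\<lambda>g. g <#\<^bsub>G\<^esub> \<Gamma>) ` carrier G" if "z \<in> X" for z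
    using continuous_map_image_subset_topspace[OF f] that M by (auto simp: nil_space_def topspace_quotient_top)
  have fT': "f (T z) = \<tau> <#\<^bsub>G\<^esub> f z" if "z \<in> X" for z using fT[OF that] unfolding nil_map_def .
  have fpw: "f (pw n z) = \<tau> [^]\<^bsub>G\<^esub> n <#\<^bsub>G\<^esub> f z" if "z \<in> X" for n z
    by (rule equivariant_pw[where f = f, OF G(1,2) \<Gamma>c ft fT' that])
  have xX: "x \<in> X" and yX: "y \<in> X" using xy by (auto simp: RP_def)
  have RP: "\<forall>\<delta>>0. \<exists>x'\<in>X. \<exists>y'\<in>X. \<exists>n :: nat \<Rightarrow> int. dist x x' < \<delta> \<and> dist y y' < \<delta> \<and>
      (\<forall>\<epsilon> :: nat \<Rightarrow> int. (\<forall>i<d. \<epsilon> i \<in> {0, 1}) \<and> (\<exists>i<d. \<epsilon> i \<noteq> 0) \<longrightarrow>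
         dist (pw (\<Sum>i<d. n i * \<epsilon> i) x') (pw (\<Sum>i<d. n i * \<epsilon> i) y') < \<delta>)"
    using xy unfolding RP_def mem_Collect_eq prod.case by (elim conjE)
  define R where "R \<delta> x' y' n \<longleftrightarrow> x' \<in> X \<and> y' \<in> X \<and> dist x x' < \<delta> \<and> dist y y' < \<delta> \<and>
      (\<forall>\<omega>. \<omega> \<subseteq> {..<d} \<and> \<omega> \<noteq> {} \<longrightarrow> dist (pw (\<Sum>i\<in>\<omega>. n i) x') (pw (\<Sum>i\<in>\<omega>. n i) y') < \<delta>)"
    for \<delta> x' y' and n :: "nat \<Rightarrow> int"
  have "\<exists>x' y' n. R \<delta> x' y' n" if \<delta>: "\<delta> > 0" for \<delta>
  proof -
    obtain x' y' n where *: "x' \<in> X" "y' \<in> X" "dist x x' < \<delta>" "dist y y' < \<delta>"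
      "\<forall>\<epsilon> :: nat \<Rightarrow> int. (\<forall>i<d. \<epsilon> i \<in> {0, 1}) \<and> (\<exists>i<d. \<epsilon> i \<noteq> 0) \<longrightarrow>
           dist (pw (\<Sum>i<d. n i * \<epsilon> i) x') (pw (\<Sum>i<d. n i * \<epsilon> i) y') < \<delta>"
      using RP[rule_format, OF \<delta>] by blast
    have "dist (pw (\<Sum>i\<in>\<omega>. n i) x') (pw (\<Sum>i\<in>\<omega>. n i) y') < \<delta>" if w: "\<omega> \<subseteq> {..<d}" "\<omega> \<noteq> {}" for \<omega>
    proof -
      define \<epsilon> where "\<epsilon> i = (if i \<in> \<omega> then 1 else 0 :: int)" for i
      have "(\<Sum>i<d. n i * \<epsilon> i) = (\<Sum>i<d. if i \<in> \<omega> then n i else 0)"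
        by (rule sum.cong) (auto simp: \<epsilon>_def)
      also have "\<dots> = (\<Sum>i\<in>\<omega>. n i)" using w(1) by (simp add: sum.If_cases Int_absorb1)
      finally have s: "(\<Sum>i<d. n i * \<epsilon> i) = (\<Sum>i\<in>\<omega>. n i)" .
      obtain i where "i \<in> \<omega>" using w(2) by blast
      then have "(\<forall>i<d. \<epsilon> i \<in> {0, 1}) \<and> (\<exists>i<d. \<epsilon> i \<noteq> 0)" using w(1) by (auto simp: \<epsilon>_def)
      then have "dist (pw (\<Sum>i<d. n i * \<epsilon> i) x') (pw (\<Sum>i<d. n i * \<epsilon> i) y') < \<delta>" using *(5) by blast
      then show ?thesis unfolding s .
    qed
    then have "R \<delta> x' y' n" using *(1-4) by (simp add: R_def)
    then show ?thesis by blast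
  qed
  then have "\<forall>k. \<exists>x' y' n. R (1 / real (Suc k)) x' y' n" by simp
  then obtain x' y' n where R: "\<And>k. R (1 / real (Suc k)) (x' k) (y' k) (n k)" by metis
  have x': "\<And>k. x' k \<in> X" "\<And>k. y' k \<in> X" "\<And>k. dist x (x' k) < 1 / real (Suc k)"
    "\<And>k. dist y (y' k) < 1 / real (Suc k)"
    "\<And>k \<omega>. \<omega> \<subseteq> {..<d} \<Longrightarrow> \<omega> \<noteq> {} \<Longrightarrow>
       dist (pw (\<Sum>i\<in>\<omega>. n k i) (x' k)) (pw (\<Sum>i\<in>\<omega>. n k i) (y' k)) < 1 / real (Suc k)"
    using R unfolding R_def by blast+
  have inv0: "(\<lambda>k. 1 / real (Suc k)) \<longlonglongrightarrow> 0" using LIMSEQ_inverse_real_of_nat by (simp add: inverse_eq_divide)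
  have small: "(h \<longlongrightarrow> 0) sequentially" if "\<And>k. 0 \<le> h k" "\<And>k. h k < 1 / real (Suc k)" for h :: "nat \<Rightarrow> real"
    by (rule real_tendsto_sandwich[OF _ _ tendsto_const inv0]) (use that in \<open>auto simp: less_imp_le\<close>)
  have cX: "compactin (top_of_set X) X" using compact_X by (simp add: compactin_subtopology)
  have "\<exists>F' l. F' \<le> sequentially \<and> F' \<noteq> bot \<and>
      (\<forall>\<omega>\<in>Pow {..<d}. limitin (top_of_set X) (\<lambda>k. pw (\<Sum>i\<in>\<omega>. n k i) (x' k)) (l \<omega>) F')"
    by (rule compactin_cluster_finite[OF cX]) (simp_all add: x'(1) pw_closed)
  then obtain F w where F: "F \<le> sequentially" "F \<noteq> bot"
    and w0: "\<forall>\<omega>\<in>Pow {..<d}. limitin (top_of_set X) (\<lambda>k. pw (\<Sum>i\<in>\<omega>. n k i) (x' k)) (w \<omega>) F" by blast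
  have w: "limitin (top_of_set X) (\<lambda>k. pw (\<Sum>i\<in>\<omega>. n k i) (x' k)) (w \<omega>) F" if "\<omega> \<subseteq> {..<d}" for \<omega>
    using w0 that by blast
  have lX: "limitin (top_of_set X) g l F \<longleftrightarrow> l \<in> X \<and> (g \<longlongrightarrow> l) F" if "\<And>k. g k \<in> X" for g l
    using that by (auto simp: limitin_subtopology)
  have wt: "w \<omega> \<in> X" "((\<lambda>k. pw (\<Sum>i\<in>\<omega>. n k i) (x' k)) \<longlongrightarrow> w \<omega>) F" if "\<omega> \<subseteq> {..<d}" for \<omega>
    using w[OF that] by (auto simp: limitin_subtopology)
  have x't: "(x' \<longlongrightarrow> x) F"
    by (rule tendsto_mono[OF F(1)], rule iffD2[OF tendsto_dist_iff], rule small)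
      (use x'(3) in \<open>auto simp: dist_commute\<close>)
  have y't: "(y' \<longlongrightarrow> y) F"
    by (rule tendsto_mono[OF F(1)], rule iffD2[OF tendsto_dist_iff], rule small)
      (use x'(4) in \<open>auto simp: dist_commute\<close>)
  \<comment> \<open>Away from the empty vertex the orbits of \<open>x' k\<close> and
    \<open>y' k\<close> merge, so the limits already chosen for the first cube serve the second one
    too.\<close>
  define Y where "Y \<omega> = (if \<omega> = {} then y else w \<omega>)" for \<omega>
  have yt: "Y \<omega> \<in> X" "((\<lambda>k. pw (\<Sum>i\<in>\<omega>. n k i) (y' k)) \<longlongrightarrow> Y \<omega>) F" if "\<omega> \<subseteq> {..<d}" for \<omega>
  proof -
    show "Y \<omega> \<in> X" using wt(1)[OF that] yX by (simp add: Y_def)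
    show "((\<lambda>k. pw (\<Sum>i\<in>\<omega>. n k i) (y' k)) \<longlongrightarrow> Y \<omega>) F"
    proof (cases "\<omega> = {}")
      case True then show ?thesis using y't by (simp add: Y_def)
    next
      case False
      define u where "u k = pw (\<Sum>i\<in>\<omega>. n k i) (x' k)" for k
      define v where "v k = pw (\<Sum>i\<in>\<omega>. n k i) (y' k)" for k
      have "((\<lambda>k. dist (u k) (v k)) \<longlongrightarrow> 0) sequentially"
        unfolding u_def v_def using x'(5)[OF that False] by (intro small) simp_all
      then have 1: "((\<lambda>k. dist (u k) (v k)) \<longlongrightarrow> 0) F" by (rule tendsto_mono[OF F(1)])
      have "(u \<longlongrightarrow> w \<omega>) F" unfolding u_def by (rule wt(2)[OF that])
      then have 2: "((\<lambda>k. dist (u k) (w \<omega>)) \<longlongrightarrow> 0) F" by (rule iffD1[OF tendsto_dist_iff])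
      have 3: "((\<lambda>k. dist (u k) (v k) + dist (u k) (w \<omega>)) \<longlongrightarrow> 0) F"
        using tendsto_add[OF 1 2] by simp
      have "((\<lambda>k. dist (v k) (w \<omega>)) \<longlongrightarrow> 0) F"
      proof (rule real_tendsto_sandwich[OF _ _ tendsto_const 3])
        show "\<forall>\<^sub>F k in F. 0 \<le> dist (v k) (w \<omega>)" by simp
        show "\<forall>\<^sub>F k in F. dist (v k) (w \<omega>) \<le> dist (u k) (v k) + dist (u k) (w \<omega>)"
          by (intro always_eventually allI dist_triangle3)
      qed
      then have "(v \<longlongrightarrow> w \<omega>) F" by (rule iffD2[OF tendsto_dist_iff])
      then show ?thesis using False by (simp add: Y_def v_def[abs_def])
    qed
  qed
  have "\<forall>k. \<exists>a. a \<in> carrier G \<and> f (x' k) = a <#\<^bsub>G\<^esub> \<Gamma>" using ft[OF x'(1)] by blast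
  then obtain a where a: "\<And>k. a k \<in> carrier G" "\<And>k. f (x' k) = a k <#\<^bsub>G\<^esub> \<Gamma>" by metis
  have "\<forall>k. \<exists>b. b \<in> carrier G \<and> f (y' k) = b <#\<^bsub>G\<^esub> \<Gamma>" using ft[OF x'(2)] by blast
  then obtain b where b: "\<And>k. b k \<in> carrier G" "\<And>k. f (y' k) = b k <#\<^bsub>G\<^esub> \<Gamma>" by metis
  note ab = a b
  have "f (w {}) = f (Y {})"
  proof (rule nilsystem_cube_limit[where a = a and b = b and n = n, OF nilsys F(2) ab(1,3), where Y = "\<lambda>\<omega>. f (w \<omega>)" and Y' = "\<lambda>\<omega>. f (Y \<omega>)"])
    fix \<omega> assume o: "\<omega> \<subseteq> {..<d}"
    have "limitin (nil_space G M \<Gamma>) (f \<circ> (\<lambda>k. pw (\<Sum>i\<in>\<omega>. n k i) (x' k))) (f (w \<omega>)) F"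
      by (rule continuous_map_limit[OF f w[OF o]])
    then show "limitin (nil_space G M \<Gamma>) (\<lambda>k. (\<tau> [^]\<^bsub>G\<^esub> (\<Sum>j\<in>\<omega>. n k j) \<otimes>\<^bsub>G\<^esub> a k) <#\<^bsub>G\<^esub> \<Gamma>) (f (w \<omega>)) F"
      using fpw[OF x'(1)] ab(1,2) G \<Gamma>c by (simp add: o_def lcos_m_assoc)
    have "limitin (top_of_set X) (\<lambda>k. pw (\<Sum>i\<in>\<omega>. n k i) (y' k)) (Y \<omega>) F"
      by (rule iffD2[OF lX[OF pw_closed[OF x'(2)]]]) (intro conjI yt[OF o])
    then have "limitin (nil_space G M \<Gamma>) (f \<circ> (\<lambda>k. pw (\<Sum>i\<in>\<omega>. n k i) (y' k))) (f (Y \<omega>)) F"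
      by (rule continuous_map_limit[OF f])
    then show "limitin (nil_space G M \<Gamma>) (\<lambda>k. (\<tau> [^]\<^bsub>G\<^esub> (\<Sum>j\<in>\<omega>. n k j) \<otimes>\<^bsub>G\<^esub> b k) <#\<^bsub>G\<^esub> \<Gamma>) (f (Y \<omega>)) F"
      using fpw[OF x'(2)] ab(3,4) G \<Gamma>c by (simp add: o_def lcos_m_assoc)
    show "f (w \<omega>) = f (Y \<omega>)" if "\<omega> \<noteq> {}" using that by (simp add: Y_def)
  qed
  moreover have "w {} = x" using tendsto_unique[OF F(2) wt(2)[of "{}"]] x't by simp
  ultimately show ?thesis by (simp add: Y_def)
qed

text \<open>Points of the inverse limit are separated by coordinates, and each coordinate of
  \<open>h \<circ> \<pi>\<close> is a continuous equivariant map to a nilsystem.\<close>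

lemma RP_inverse_limit_factor:
  fixes \<pi> :: "'a \<Rightarrow> 'b"
  assumes xy: "(x, y) \<in> RP d X T"
    and Y: "inverse_limit_of_minimal_nilsystems TYPE('g) d Y S"
    and \<pi>: "factor_map (top_of_set X) T Y S \<pi>"
  shows "\<pi> x = \<pi> y"
proof -
  have xX: "x \<in> X" and yX: "y \<in> X" using xy by (auto simp: RP_def)
  obtain G :: "nat \<Rightarrow> 'g monoid" and M \<Gamma> \<tau> p where
    nils: "\<And>i. nilsystem d (G i) (M i) (\<Gamma> i) (\<tau> i)"
    and conj: "conjugate Y S (inverse_limit_space (\<lambda>i. nil_space (G i) (M i) (\<Gamma> i)) p) (\<lambda>x i. nil_map (G i) (\<tau> i) (x i))"
    using Y unfolding inverse_limit_of_minimal_nilsystems_def by blast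
  let ?Z = "inverse_limit_space (\<lambda>i. nil_space (G i) (M i) (\<Gamma> i)) p"
  obtain h where h: "homeomorphic_map Y ?Z h" "\<And>z. z \<in> topspace Y \<Longrightarrow> h (S z) = (\<lambda>i. nil_map (G i) (\<tau> i) (h z i))"
    using conj by (auto simp: conjugate_def)
  have pc: "continuous_map (top_of_set X) Y \<pi>" and pT: "\<And>z. z \<in> X \<Longrightarrow> \<pi> (T z) = S (\<pi> z)"
    and pX: "\<And>z. z \<in> X \<Longrightarrow> \<pi> z \<in> topspace Y"
    using \<pi> by (auto simp: factor_map_def)
  have "h (\<pi> x) i = h (\<pi> y) i" for i
  proof (rule RP_nilsystem_factor[OF xy nils, where f = "\<lambda>z. h (\<pi> z) i"])
    have "continuous_map ?Z (nil_space (G i) (M i) (\<Gamma> i)) (\<lambda>z. z i)"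
      unfolding inverse_limit_space_def
      by (intro continuous_map_from_subtopology continuous_map_product_projection) simp
    from continuous_map_compose[OF continuous_map_compose[OF pc homeomorphic_imp_continuous_map[OF h(1)]] this]
    show "continuous_map (top_of_set X) (nil_space (G i) (M i) (\<Gamma> i)) (\<lambda>z. h (\<pi> z) i)" by (simp add: o_def)
    show "h (\<pi> (T z)) i = nil_map (G i) (\<tau> i) (h (\<pi> z) i)" if "z \<in> X" for z
      using that pT pX h(2) by simp
  qed
  then have "h (\<pi> x) = h (\<pi> y)" by blast
  then show ?thesis using homeomorphic_imp_injective_map[OF h(1)] pX xX yX by (auto simp: inj_on_def)
qed

end

section \<open>Automorphisms and cubes\<close>

context dynamical_system
begin

abbreviation "AutX \<equiv> Aut (top_of_set X) T"

lemma AutX_group: "group AutX"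
  using group_Aut[of "top_of_set X" T] tds by (simp add: tds_def)

lemma Aut_carrier_iff:
  "\<phi> \<in> carrier AutX \<longleftrightarrow> \<phi> \<in> Bij X \<and> homeomorphic_map (top_of_set X) (top_of_set X) \<phi> \<and> (\<forall>x\<in>X. \<phi> (T x) = T (\<phi> x))"
  by (simp add: Aut_def)

lemma AutD:
  assumes "\<phi> \<in> carrier AutX"
  shows "\<And>x. x \<in> X \<Longrightarrow> \<phi> x \<in> X" "\<And>x. x \<in> X \<Longrightarrow> \<phi> (T x) = T (\<phi> x)" "continuous_on X \<phi>"
    "\<phi> \<in> extensional X" "bij_betw \<phi> X X" "\<And>x n. x \<in> X \<Longrightarrow> \<phi> (pw n x) = pw n (\<phi> x)"
proof -
  show b: "bij_betw \<phi> X X" and "\<phi> \<in> extensional X"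
    using assms by (auto simp: Aut_carrier_iff Bij_def)
  show c: "\<And>x. x \<in> X \<Longrightarrow> \<phi> x \<in> X" using b bij_betwE by blast
  show T: "\<And>x. x \<in> X \<Longrightarrow> \<phi> (T x) = T (\<phi> x)" using assms by (simp add: Aut_carrier_iff)
  show "continuous_on X \<phi>"
    using assms homeomorphic_imp_continuous_map[of "top_of_set X" "top_of_set X" \<phi>]
    by (simp add: Aut_carrier_iff continuous_map_iff_continuous2)
  show "\<And>x n. x \<in> X \<Longrightarrow> \<phi> (pw n x) = pw n (\<phi> x)" using pw_commute[of \<phi>] c T by blast
qed

lemma Aut_one: "x \<in> X \<Longrightarrow> \<one>\<^bsub>AutX\<^esub> x = x"
  by (simp add: Aut_def BijGroup_def)

lemma Aut_mult:
  assumes "\<phi> \<in> carrier AutX" "\<psi> \<in> carrier AutX" "x \<in> X" shows "(\<phi> \<otimes>\<^bsub>AutX\<^esub> \<psi>) x = \<phi> (\<psi> x)"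
  using assms by (simp add: Aut_def BijGroup_def compose_def)

lemma Aut_inv:
  assumes "\<phi> \<in> carrier AutX" "x \<in> X"
  shows "(inv\<^bsub>AutX\<^esub> \<phi>) (\<phi> x) = x" "\<phi> ((inv\<^bsub>AutX\<^esub> \<phi>) x) = x"
proof -
  interpret group AutX by (rule AutX_group)
  show "(inv\<^bsub>AutX\<^esub> \<phi>) (\<phi> x) = x" "\<phi> ((inv\<^bsub>AutX\<^esub> \<phi>) x) = x"
    using Aut_mult[of "inv\<^bsub>AutX\<^esub> \<phi>" \<phi> x] Aut_mult[of \<phi> "inv\<^bsub>AutX\<^esub> \<phi>" x] Aut_one assms by auto
qed

lemma Aut_eqI:
  assumes "\<phi> \<in> carrier AutX" "\<psi> \<in> carrier AutX" "\<And>x. x \<in> X \<Longrightarrow> \<phi> x = \<psi> x"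
  shows "\<phi> = \<psi>"
  using extensionalityI[OF AutD(4)[OF assms(1)] AutD(4)[OF assms(2)]] assms(3) by blast

lemma RP_Aut:
  assumes \<phi>: "\<phi> \<in> carrier AutX" and xy: "(x, y) \<in> RP d X T" shows "(\<phi> x, \<phi> y) \<in> RP d X T"
proof -
  note A = AutD[OF \<phi>]
  have xX: "x \<in> X" "y \<in> X" using xy by (auto simp: RP_def)
  have uc: "uniformly_continuous_on X \<phi>" by (rule compact_uniformly_continuous[OF A(3) compact_X])
  have "\<exists>x'\<in>X. \<exists>y'\<in>X. \<exists>n :: nat \<Rightarrow> int. dist (\<phi> x) x' < \<delta> \<and> dist (\<phi> y) y' < \<delta> \<and>
        (\<forall>\<epsilon> :: nat \<Rightarrow> int. (\<forall>i<d. \<epsilon> i \<in> {0, 1}) \<and> (\<exists>i<d. \<epsilon> i \<noteq> 0) \<longrightarrow>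
           dist (pw (\<Sum>i<d. n i * \<epsilon> i) x') (pw (\<Sum>i<d. n i * \<epsilon> i) y') < \<delta>)" if \<delta>: "\<delta> > 0" for \<delta>
  proof -
    obtain \<eta> where \<eta>: "\<eta> > 0" "\<And>u v. u \<in> X \<Longrightarrow> v \<in> X \<Longrightarrow> dist u v < \<eta> \<Longrightarrow> dist (\<phi> u) (\<phi> v) < \<delta>"
      using uc \<delta> unfolding uniformly_continuous_on_def by metis
    obtain x' y' n where *: "x' \<in> X" "y' \<in> X" "dist x x' < \<eta>" "dist y y' < \<eta>"
      "\<forall>\<epsilon> :: nat \<Rightarrow> int. (\<forall>i<d. \<epsilon> i \<in> {0, 1}) \<and> (\<exists>i<d. \<epsilon> i \<noteq> 0) \<longrightarrow>
           dist (pw (\<Sum>i<d. n i * \<epsilon> i) x') (pw (\<Sum>i<d. n i * \<epsilon> i) y') < \<eta>"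
      using xy \<eta>(1) unfolding RP_def by blast
    have "dist (pw k (\<phi> x')) (pw k (\<phi> y')) < \<delta>" if "dist (pw k x') (pw k y') < \<eta>" for k
      using \<eta>(2)[OF pw_closed[OF *(1)] pw_closed[OF *(2)] that] A(6) *(1,2) by simp
    then show ?thesis
      using *(1-4) *(5)[rule_format] \<eta>(2) xX A(1)
      by (intro bexI[of _ "\<phi> x'"] bexI[of _ "\<phi> y'"] exI[of _ n]) simp_all
  qed
  then show ?thesis using A(1) xX by (simp add: RP_def)
qed

lemma RP_Aut_iff:
  assumes \<phi>: "\<phi> \<in> carrier AutX" and xy: "x \<in> X" "y \<in> X"
  shows "(\<phi> x, \<phi> y) \<in> RP d X T \<longleftrightarrow> (x, y) \<in> RP d X T"
proof
  assume "(\<phi> x, \<phi> y) \<in> RP d X T"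
  moreover have "inv\<^bsub>AutX\<^esub> \<phi> \<in> carrier AutX" using group.inv_closed[OF AutX_group \<phi>] .
  ultimately have "((inv\<^bsub>AutX\<^esub> \<phi>) (\<phi> x), (inv\<^bsub>AutX\<^esub> \<phi>) (\<phi> y)) \<in> RP d X T" using RP_Aut by blast
  then show "(x, y) \<in> RP d X T" using Aut_inv(1)[OF \<phi>] xy by simp
qed (rule RP_Aut[OF \<phi>])

lemma RP_refl: "x \<in> X \<Longrightarrow> (x, x) \<in> RP d X T"
  unfolding RP_def by (auto intro!: bexI[of _ x])

lemma RP_subset: "(x, y) \<in> RP d X T \<Longrightarrow> x \<in> X \<and> y \<in> X"
  by (auto simp: RP_def)

lemma Aut_image_RP:
  assumes \<phi>: "\<phi> \<in> carrier AutX" and C: "C \<subseteq> X"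
  shows "\<phi> ` (RP d X T `` C) = RP d X T `` (\<phi> ` C)"
proof
  show "\<phi> ` (RP d X T `` C) \<subseteq> RP d X T `` (\<phi> ` C)" using RP_Aut[OF \<phi>] by blast
  show "RP d X T `` (\<phi> ` C) \<subseteq> \<phi> ` (RP d X T `` C)"
  proof
    fix z assume "z \<in> RP d X T `` (\<phi> ` C)"
    then obtain c where c: "c \<in> C" "(\<phi> c, z) \<in> RP d X T" by blast
    then have z: "z \<in> X" using RP_subset by blast
    then obtain y where y: "y \<in> X" "z = \<phi> y" using AutD(5)[OF \<phi>] by (auto simp: bij_betw_def)
    then have "(c, y) \<in> RP d X T" using c RP_Aut_iff[OF \<phi>] C by auto
    then show "z \<in> \<phi> ` (RP d X T `` C)" using c y by blast
  qed
qed

subsection \<open>The induced automorphism of the nilfactor\<close>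

abbreviation "AutZ d \<equiv> Aut (nilfactor_space d X T) (nilfactor_map d X T)"

text \<open>Classes are subsets of \<open>X\<close>, so the induced map is direct image; the
  restriction makes it extensional, as \<open>Aut\<close> demands.\<close>

definition induced :: "nat \<Rightarrow> ('a \<Rightarrow> 'a) \<Rightarrow> 'a set \<Rightarrow> 'a set" where
  "induced d \<phi> = restrict (\<lambda>C. \<phi> ` C) (topspace (nilfactor_space d X T))"

lemma topspace_nilfactor: "topspace (nilfactor_space d X T) = (\<lambda>x. RP d X T `` {x}) ` X"
  by (simp add: nilfactor_space_def topspace_quotient_top)

lemma induced_class:
  assumes "\<phi> \<in> carrier AutX" "x \<in> X"
  shows "induced d \<phi> (RP d X T `` {x}) = RP d X T `` {\<phi> x}"
  using assms Aut_image_RP[OF assms(1), of "{x}" d] by (simp add: induced_def topspace_nilfactor)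

lemma induced_continuous:
  assumes \<phi>: "\<phi> \<in> carrier AutX"
  shows "continuous_map (nilfactor_space d X T) (nilfactor_space d X T) (induced d \<phi>)"
proof -
  let ?q = "\<lambda>x. RP d X T `` {x}"
  have q: "quotient_map (top_of_set X) (nilfactor_space d X T) ?q"
    unfolding nilfactor_space_def by (rule quotient_map_quotient_top)
  have "continuous_map (top_of_set X) (top_of_set X) \<phi>"
    using AutD(1,3)[OF \<phi>] by (auto simp: continuous_map_iff_continuous2)
  from continuous_map_compose[OF this quotient_imp_continuous_map[OF q]]
  have "continuous_map (top_of_set X) (nilfactor_space d X T) (induced d \<phi> \<circ> ?q)"
    by (rule continuous_map_eq) (simp add: induced_class[OF \<phi>])
  then show ?thesis using continuous_compose_quotient_map_eq[OF q] by blast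
qed

lemma induced_inverse:
  assumes \<phi>: "\<phi> \<in> carrier AutX" and \<psi>: "\<psi> \<in> carrier AutX" and inv: "\<And>x. x \<in> X \<Longrightarrow> \<phi> (\<psi> x) = x"
    and C: "C \<in> topspace (nilfactor_space d X T)"
  shows "induced d \<phi> (induced d \<psi> C) = C"
proof -
  obtain x where x: "x \<in> X" "C = RP d X T `` {x}" using C by (auto simp: topspace_nilfactor)
  then show ?thesis using induced_class[OF \<psi> x(1)] induced_class[OF \<phi> AutD(1)[OF \<psi> x(1)]] inv by simp
qed

text \<open>The inverse automorphism induces the inverse map. The hypothesis
  \<open>class_map\<close> is discharged in the final theorem, once \<open>RP\<close> is known to be
  the fibre relation of \<open>\<pi>\<close>.\<close>

lemma induced_Aut:
  assumes \<phi>: "\<phi> \<in> carrier AutX"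
    and class_map: "\<And>x. x \<in> X \<Longrightarrow> nilfactor_map d X T (RP d X T `` {x}) = RP d X T `` {T x}"
  shows "induced d \<phi> \<in> carrier (AutZ d)"
proof -
  interpret group AutX by (rule AutX_group)
  let ?Z = "nilfactor_space d X T" and ?\<psi> = "inv\<^bsub>AutX\<^esub> \<phi>"
  have \<psi>: "?\<psi> \<in> carrier AutX" using \<phi> by simp
  have "homeomorphic_maps ?Z ?Z (induced d \<phi>) (induced d ?\<psi>)"
    unfolding homeomorphic_maps_def
    using induced_continuous[OF \<phi>] induced_continuous[OF \<psi>]
      induced_inverse[OF \<phi> \<psi> Aut_inv(2)[OF \<phi>]] induced_inverse[OF \<psi> \<phi> Aut_inv(1)[OF \<phi>]] by blast
  then have h: "homeomorphic_map ?Z ?Z (induced d \<phi>)" using homeomorphic_maps_map by blast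
  then have "bij_betw (induced d \<phi>) (topspace ?Z) (topspace ?Z)"
    by (simp add: bij_betw_def homeomorphic_imp_injective_map homeomorphic_imp_surjective_map)
  then have B: "induced d \<phi> \<in> Bij (topspace ?Z)" by (simp add: Bij_def induced_def)
  have "induced d \<phi> (nilfactor_map d X T C) = nilfactor_map d X T (induced d \<phi> C)" if C: "C \<in> topspace ?Z" for C
  proof -
    obtain x where x: "x \<in> X" "C = RP d X T `` {x}" using C by (auto simp: topspace_nilfactor)
    then show ?thesis
      using class_map[OF x(1)] class_map[OF AutD(1)[OF \<phi> x(1)]] induced_class[OF \<phi> x(1)]
        induced_class[OF \<phi> T_closed[OF x(1)]] AutD(2)[OF \<phi> x(1)] by simp
  qed
  then show ?thesis using h B by (simp add: Aut_def)
qed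

lemma induced_mult:
  assumes \<phi>: "\<phi> \<in> carrier AutX" and \<psi>: "\<psi> \<in> carrier AutX"
    and B: "induced d \<phi> \<in> carrier (AutZ d)" "induced d \<psi> \<in> carrier (AutZ d)"
  shows "induced d (\<phi> \<otimes>\<^bsub>AutX\<^esub> \<psi>) = induced d \<phi> \<otimes>\<^bsub>AutZ d\<^esub> induced d \<psi>"
proof -
  interpret group AutX by (rule AutX_group)
  let ?Z = "nilfactor_space d X T"
  have B: "induced d \<phi> \<in> Bij (topspace ?Z)" "induced d \<psi> \<in> Bij (topspace ?Z)"
    using B by (auto simp: Aut_def)
  then have eq: "induced d \<phi> \<otimes>\<^bsub>AutZ d\<^esub> induced d \<psi> = compose (topspace ?Z) (induced d \<phi>) (induced d \<psi>)"
    by (simp add: Aut_def BijGroup_def)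
  show ?thesis unfolding eq
  proof (rule extensionalityI[of _ "topspace ?Z"])
    show "induced d (\<phi> \<otimes>\<^bsub>AutX\<^esub> \<psi>) \<in> extensional (topspace ?Z)" by (simp add: induced_def)
    fix C assume C: "C \<in> topspace ?Z"
    then obtain x where x: "x \<in> X" "C = RP d X T `` {x}" by (auto simp: topspace_nilfactor)
    show "induced d (\<phi> \<otimes>\<^bsub>AutX\<^esub> \<psi>) C = compose (topspace ?Z) (induced d \<phi>) (induced d \<psi>) C"
      using C x induced_class[OF m_closed[OF \<phi> \<psi>] x(1)] induced_class[OF \<psi> x(1)]
        induced_class[OF \<phi> AutD(1)[OF \<psi> x(1)]] Aut_mult[OF \<phi> \<psi> x(1)]
      by (simp add: compose_def)
  qed simp
qed

subsection \<open>Closures of cubes\<close>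

definition vert :: "(nat \<Rightarrow> int) \<Rightarrow> nat set \<Rightarrow> 'a \<Rightarrow> 'a" where
  "vert n \<omega> z = pw (\<Sum>i\<in>\<omega>. n i) z"

text \<open>Membership in the closure of the cubes
  \<open>\<omega> \<mapsto> T^(n\<cdot>\<omega>) z\<close>, the dynamical cube space of Host, Kra
  and Maass, with subsets of \<open>{..<D}\<close> as vertices.\<close>

definition cube :: "nat \<Rightarrow> (nat set \<Rightarrow> 'a) \<Rightarrow> bool" where
  "cube D x \<longleftrightarrow> (\<forall>\<omega>. \<omega> \<subseteq> {..<D} \<longrightarrow> x \<omega> \<in> X) \<and>
     (\<forall>\<delta>>0. \<exists>z\<in>X. \<exists>n. \<forall>\<omega>. \<omega> \<subseteq> {..<D} \<longrightarrow> dist (x \<omega>) (vert n \<omega> z) < \<delta>)"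

text \<open>Acts on the face of all vertices containing \<open>I\<close>, whose codimension is
  \<open>card I\<close>; for \<open>I = {..<D}\<close> it is a single vertex.\<close>

definition face :: "nat set \<Rightarrow> ('a \<Rightarrow> 'a) \<Rightarrow> (nat set \<Rightarrow> 'a) \<Rightarrow> nat set \<Rightarrow> 'a" where
  "face I \<phi> x \<omega> = (if I \<subseteq> \<omega> then \<phi> (x \<omega>) else x \<omega>)"

lemma cube_const: "x \<in> X \<Longrightarrow> cube D (\<lambda>_. x)"
  unfolding cube_def vert_def
  by (auto intro!: bexI[of _ x] exI[of _ "\<lambda>_. 0"])

lemma cube_cong: "cube D x \<Longrightarrow> (\<And>\<omega>. \<omega> \<subseteq> {..<D} \<Longrightarrow> y \<omega> = x \<omega>) \<Longrightarrow> cube D y"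
  by (simp add: cube_def)

text \<open>The configuration is read off an approximating cube from its far end: \<open>x'\<close>
  and \<open>y'\<close> are the vertices \<open>{..<d}\<close> and \<open>{..<Suc d}\<close>, and
  moving back by \<open>- n\<close> in the directions of \<open>\<epsilon>\<close> leads from them
  to the vertices \<open>\<omega>\<close> and \<open>insert d \<omega>\<close>, with
  \<open>\<omega>\<close> the zero set of \<open>\<epsilon>\<close>. For nonzero
  \<open>\<epsilon>\<close> neither is the exceptional vertex, so both are near
  \<open>x\<close>.\<close>

lemma RP_of_cube:
  assumes c: "cube (Suc d) (\<lambda>\<omega>. if \<omega> = {..<Suc d} then y else x)"
  shows "(x, y) \<in> RP d X T"
proof -
  have "{} \<noteq> {..<Suc d}" by (simp add: lessThan_Suc)
  then have xX: "x \<in> X" using c unfolding cube_def by (metis empty_subsetI)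
  have yX: "y \<in> X" using c by (auto simp: cube_def dest: spec[of _ "{..<Suc d}"])
  have "\<exists>x'\<in>X. \<exists>y'\<in>X. \<exists>n :: nat \<Rightarrow> int. dist x x' < \<delta> \<and> dist y y' < \<delta> \<and>
        (\<forall>\<epsilon> :: nat \<Rightarrow> int. (\<forall>i<d. \<epsilon> i \<in> {0, 1}) \<and> (\<exists>i<d. \<epsilon> i \<noteq> 0) \<longrightarrow>
           dist (pw (\<Sum>i<d. n i * \<epsilon> i) x') (pw (\<Sum>i<d. n i * \<epsilon> i) y') < \<delta>)" if \<delta>: "\<delta> > 0" for \<delta>
  proof -
    have "\<delta> / 2 > 0" using \<delta> by simp
    then obtain z n where z: "z \<in> X" and n: "\<And>\<omega>. \<omega> \<subseteq> {..<Suc d} \<Longrightarrow>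
        dist (if \<omega> = {..<Suc d} then y else x) (vert n \<omega> z) < \<delta> / 2"
      using c unfolding cube_def by blast
    define x' where "x' = vert n {..<d} z"
    define y' where "y' = vert n {..<Suc d} z"
    have X': "x' \<in> X" "y' \<in> X" using z pw_closed by (auto simp: x'_def y'_def vert_def)
    have "{..<d} \<subseteq> {..<Suc d}" "{..<d} \<noteq> {..<Suc d}" by auto
    then have 1: "dist x x' < \<delta>" using n[of "{..<d}"] \<delta> by (simp add: x'_def)
    have 2: "dist y y' < \<delta>" using n[of "{..<Suc d}"] \<delta> by (auto simp: y'_def)
    have 3: "dist (pw (\<Sum>i<d. - n i * \<epsilon> i) x') (pw (\<Sum>i<d. - n i * \<epsilon> i) y') < \<delta>"
      if e: "\<forall>i<d. \<epsilon> i \<in> {0, 1}" "\<exists>i<d. \<epsilon> i \<noteq> 0" for \<epsilon> :: "nat \<Rightarrow> int"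
    proof -
      define \<omega> where "\<omega> = {i. i < d \<and> \<epsilon> i = 0}"
      have w: "\<omega> \<subseteq> {..<d}" "\<omega> \<noteq> {..<d}" using e(2) by (auto simp: \<omega>_def)
      have s: "(\<Sum>i<d. - n i * \<epsilon> i) + (\<Sum>i<d. n i) = (\<Sum>i\<in>\<omega>. n i)"
      proof -
        have "(\<Sum>i<d. - n i * \<epsilon> i) + (\<Sum>i<d. n i) = (\<Sum>i<d. if i \<in> \<omega> then n i else 0)"
          unfolding sum.distrib[symmetric] by (rule sum.cong) (use e(1) in \<open>auto simp: \<omega>_def\<close>)
        also have "\<dots> = (\<Sum>i\<in>\<omega>. n i)" using w(1) by (simp add: sum.If_cases Int_absorb1)
        finally show ?thesis .
      qed
      have p1: "pw (\<Sum>i<d. - n i * \<epsilon> i) x' = vert n \<omega> z"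
        unfolding x'_def vert_def pw_add[OF z, symmetric] s ..
      have fin: "finite \<omega>" "d \<notin> \<omega>" using w finite_subset by auto
      have "(\<Sum>i<d. - n i * \<epsilon> i) + (\<Sum>i<Suc d. n i) = (\<Sum>i\<in>insert d \<omega>. n i)"
        using s fin by simp
      then have p2: "pw (\<Sum>i<d. - n i * \<epsilon> i) y' = vert n (insert d \<omega>) z"
        unfolding y'_def vert_def pw_add[OF z, symmetric] by (rule arg_cong[of _ _ "\<lambda>k. pw k z"])
      have "\<omega> \<subseteq> {..<Suc d}" "\<omega> \<noteq> {..<Suc d}" using w by (auto simp: lessThan_Suc)
      then have a: "dist x (vert n \<omega> z) < \<delta> / 2" using n[of \<omega>] by simp
      have "insert d \<omega> \<subseteq> {..<Suc d}" "insert d \<omega> \<noteq> {..<Suc d}" using w by (auto simp: lessThan_Suc)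
      then have b: "dist x (vert n (insert d \<omega>) z) < \<delta> / 2" using n[of "insert d \<omega>"] by simp
      have "dist (vert n \<omega> z) (vert n (insert d \<omega>) z) \<le> dist x (vert n \<omega> z) + dist x (vert n (insert d \<omega>) z)"
        by (rule dist_triangle3)
      then show ?thesis unfolding p1 p2 using a b by linarith
    qed
    have "\<forall>\<epsilon> :: nat \<Rightarrow> int. (\<forall>i<d. \<epsilon> i \<in> {0, 1}) \<and> (\<exists>i<d. \<epsilon> i \<noteq> 0) \<longrightarrow>
        dist (pw (\<Sum>i<d. - n i * \<epsilon> i) x') (pw (\<Sum>i<d. - n i * \<epsilon> i) y') < \<delta>"
      by (intro allI impI, elim conjE, rule 3)
    then show ?thesis
      using X' 1 2 by (intro bexI[of _ x'] bexI[of _ y'] exI[of _ "\<lambda>i. - n i"] conjI)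
  qed
  then show ?thesis using xX yX by (simp add: RP_def)
qed

end

section \<open>Minimal systems: face maps, proximal pairs, rigidity of automorphisms\<close>

locale minimal_system = dynamical_system +
  assumes min: "minimal (top_of_set X) T"
begin

lemma orbit_dense:
  assumes "x \<in> X" "y \<in> X" "e > 0" obtains n where "dist (pw n x) y < e"
proof -
  have "top_of_set X closure_of (range (\<lambda>n. pw n x)) = X" using min assms(1) by (simp add: minimal_def)
  then have "y \<in> closure (X \<inter> range (\<lambda>n. pw n x))" using assms(2) by (auto simp: closure_of_subtopology)
  then have "y \<in> closure (range (\<lambda>n. pw n x))" using closure_mono[of "X \<inter> range (\<lambda>n. pw n x)"] by blast
  then obtain z where "z \<in> range (\<lambda>n. pw n x)" "dist z y < e" using assms(3) closure_approachable by blast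
  then show thesis using that by blast
qed

text \<open>By minimality \<open>\<phi> z\<close> is close to some \<open>pw m z\<close>. Since
  \<open>\<phi>\<close> commutes with \<open>T\<close>, applying \<open>\<phi>\<close> at the
  vertices containing \<open>i\<close> is nearly the same as increasing \<open>n i\<close> by
  \<open>m\<close>.\<close>

lemma cube_face_one:
  assumes \<phi>: "\<phi> \<in> carrier AutX" and x: "cube D x" and i: "i < D"
  shows "cube D (face {i} \<phi> x)"
proof -
  note A = AutD[OF \<phi>]
  have xX: "x \<omega> \<in> X" if "\<omega> \<subseteq> {..<D}" for \<omega> using x that by (simp add: cube_def)
  have "\<exists>z\<in>X. \<exists>n. \<forall>\<omega>. \<omega> \<subseteq> {..<D} \<longrightarrow> dist (face {i} \<phi> x \<omega>) (vert n \<omega> z) < \<delta>" if \<delta>: "\<delta> > 0" for \<delta>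
  proof -
    have uc: "uniformly_continuous_on X \<phi>" by (rule compact_uniformly_continuous[OF A(3) compact_X])
    then obtain \<eta>0 where \<eta>0: "\<eta>0 > 0" "\<And>u v. u \<in> X \<Longrightarrow> v \<in> X \<Longrightarrow> dist u v < \<eta>0 \<Longrightarrow> dist (\<phi> u) (\<phi> v) < \<delta> / 2"
      using \<delta> unfolding uniformly_continuous_on_def by (metis half_gt_zero)
    define \<eta> where "\<eta> = min \<eta>0 \<delta>"
    have "\<eta> > 0" using \<eta>0(1) \<delta> by (simp add: \<eta>_def)
    then obtain z n where z: "z \<in> X" and n: "\<And>\<omega>. \<omega> \<subseteq> {..<D} \<Longrightarrow> dist (x \<omega>) (vert n \<omega> z) < \<eta>"
      using x unfolding cube_def by blast
    have vX: "vert n \<omega> u \<in> X" if "u \<in> X" for \<omega> u using pw_closed[OF that] by (simp add: vert_def)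
    \<comment> \<open>The increments \<open>n\<close> are already fixed, so finitely many powers of
      \<open>T\<close> are involved and one \<open>e\<close> serves all of them; only then is
      \<open>m\<close> chosen.\<close>
    have "\<exists>e>0. \<forall>\<omega>\<in>S. \<forall>u\<in>X. dist u (\<phi> z) < e \<longrightarrow> dist (vert n \<omega> u) (vert n \<omega> (\<phi> z)) < \<delta> / 2"
      if "finite S" for S
      using that
    proof induction
      case empty show ?case by (intro exI[of _ 1]) simp
    next
      case (insert \<omega> S)
      then obtain e where e: "e > 0" "\<forall>\<omega>\<in>S. \<forall>u\<in>X. dist u (\<phi> z) < e \<longrightarrow> dist (vert n \<omega> u) (vert n \<omega> (\<phi> z)) < \<delta> / 2" by blast
      have "continuous_on X (vert n \<omega>)" using continuous_on_pw[of "\<Sum>i\<in>\<omega>. n i"] by (simp add: vert_def[abs_def])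
      then obtain e' where e': "e' > 0" "\<forall>u\<in>X. dist u (\<phi> z) < e' \<longrightarrow> dist (vert n \<omega> u) (vert n \<omega> (\<phi> z)) < \<delta> / 2"
        using A(1)[OF z] \<delta> unfolding continuous_on_iff by (metis half_gt_zero)
      show ?case using e e' by (intro exI[of _ "min e e'"]) auto
    qed
    from this[of "Pow {..<D}"] obtain e where e: "e > 0"
      "\<And>\<omega> u. \<omega> \<subseteq> {..<D} \<Longrightarrow> u \<in> X \<Longrightarrow> dist u (\<phi> z) < e \<Longrightarrow> dist (vert n \<omega> u) (vert n \<omega> (\<phi> z)) < \<delta> / 2" by auto
    obtain m where m: "dist (pw m z) (\<phi> z) < e" using orbit_dense[OF z A(1)[OF z] e(1)] by blast
    define n' where "n' = n(i := n i + m)"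
    have v1: "vert n' \<omega> z = vert n \<omega> (pw m z)" if "i \<in> \<omega>" "\<omega> \<subseteq> {..<D}" for \<omega>
    proof -
      have fin: "finite \<omega>" using that finite_subset by blast
      have "(\<Sum>j\<in>\<omega>. n' j) = (\<Sum>j\<in>\<omega>. n j + (if j = i then m else 0))"
        by (rule sum.cong) (auto simp: n'_def)
      then have "(\<Sum>j\<in>\<omega>. n' j) = (\<Sum>j\<in>\<omega>. n j) + m" using fin that(1) by (simp add: sum.distrib)
      then show ?thesis using pw_add[OF z] by (simp add: vert_def)
    qed
    have v2: "vert n' \<omega> z = vert n \<omega> z" if "i \<notin> \<omega>" for \<omega>
    proof -
      have "(\<Sum>j\<in>\<omega>. n' j) = (\<Sum>j\<in>\<omega>. n j)" by (rule sum.cong) (use that in \<open>auto simp: n'_def\<close>)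
      then show ?thesis by (simp add: vert_def)
    qed
    have "dist (face {i} \<phi> x \<omega>) (vert n' \<omega> z) < \<delta>" if w: "\<omega> \<subseteq> {..<D}" for \<omega>
    proof (cases "i \<in> \<omega>")
      case False
      then show ?thesis using n[OF w] v2[OF False] by (simp add: face_def \<eta>_def)
    next
      case True
      have a: "dist (\<phi> (x \<omega>)) (\<phi> (vert n \<omega> z)) < \<delta> / 2"
        using n[OF w] by (intro \<eta>0(2) xX[OF w] vX[OF z]) (simp add: \<eta>_def)
      have c: "\<phi> (vert n \<omega> z) = vert n \<omega> (\<phi> z)" using A(6)[OF z] by (simp add: vert_def)
      have b: "dist (vert n \<omega> (pw m z)) (vert n \<omega> (\<phi> z)) < \<delta> / 2" by (rule e(2)[OF w pw_closed[OF z] m])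
      have "dist (\<phi> (x \<omega>)) (vert n \<omega> (pw m z)) \<le> dist (\<phi> (x \<omega>)) (vert n \<omega> (\<phi> z)) + dist (vert n \<omega> (pw m z)) (vert n \<omega> (\<phi> z))"
        by (rule dist_triangle2)
      then show ?thesis using a b v1[OF True w] True by (simp add: face_def c)
    qed
    then show ?thesis using z by blast
  qed
  moreover have "face {i} \<phi> x \<omega> \<in> X" if "\<omega> \<subseteq> {..<D}" for \<omega> using xX[OF that] A(1) by (simp add: face_def)
  ultimately show ?thesis by (simp add: cube_def)
qed

text \<open>The commutator of the maps that apply \<open>a\<close> on one face and \<open>b\<close>
  on another applies \<open>comm a b\<close> on the intersection of the faces and nothing elsewhere.
  Each step down the lower central series thus gains one codimension.\<close>

lemma cube_face_lower_central:
  "\<psi> \<in> lower_central AutX j \<Longrightarrow> I \<subseteq> {..<D} \<Longrightarrow> card I = Suc j \<Longrightarrow> cube D x \<Longrightarrow> cube D (face I \<psi> x)"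
proof (induction j arbitrary: \<psi> I x)
  case 0
  then obtain i where "I = {i}" by (metis One_nat_def card_1_singletonE)
  then show ?case using cube_face_one 0 by auto
next
  case (Suc j)
  interpret group AutX by (rule AutX_group)
  have "I \<noteq> {}" using Suc.prems(3) by auto
  then obtain i where i: "i \<in> I" by blast
  define I' where "I' = I - {i}"
  have I': "I = insert i I'" "i \<notin> I'" using i by (auto simp: I'_def)
  have finI: "finite I" using Suc.prems(2) finite_subset by blast
  have cI': "card I' = Suc j" "I' \<subseteq> {..<D}" using Suc.prems finI i by (auto simp: I'_def)
  have iD: "i < D" using i Suc.prems(2) by auto
  have Lc: "lower_central AutX j \<subseteq> carrier AutX" by (rule lower_central_carrier)
  have Li: "inv\<^bsub>AutX\<^esub> k \<in> lower_central AutX j" if "k \<in> lower_central AutX j" for k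
  proof -
    interpret L: normal "lower_central AutX j" AutX by (rule lower_central_normal)
    show ?thesis by (rule L.m_inv_closed[OF that])
  qed
  have xX: "x \<omega> \<in> X" if "cube D x" "\<omega> \<subseteq> {..<D}" for x \<omega> using that by (simp add: cube_def)
  have face_comm: "cube D (face (A \<union> B) (comm a b) x)"
    if a: "a \<in> carrier AutX" and b: "b \<in> carrier AutX" and x: "cube D x"
      and pa: "\<And>x. cube D x \<Longrightarrow> cube D (face A a x)" "\<And>x. cube D x \<Longrightarrow> cube D (face A (inv\<^bsub>AutX\<^esub> a) x)"
      and pb: "\<And>x. cube D x \<Longrightarrow> cube D (face B b x)" "\<And>x. cube D x \<Longrightarrow> cube D (face B (inv\<^bsub>AutX\<^esub> b) x)"
    for a b A B x
  proof -
    have ai: "inv\<^bsub>AutX\<^esub> a \<in> carrier AutX" and bi: "inv\<^bsub>AutX\<^esub> b \<in> carrier AutX" using a b by auto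
    have "cube D (face A a (face B b (face A (inv\<^bsub>AutX\<^esub> a) (face B (inv\<^bsub>AutX\<^esub> b) x))))"
      by (intro pa pb x)
    then show ?thesis
    proof (rule cube_cong)
      fix \<omega> assume w: "\<omega> \<subseteq> {..<D}"
      note xw = xX[OF x w]
      have 1: "comm a b (x \<omega>) = a (b ((inv\<^bsub>AutX\<^esub> a) ((inv\<^bsub>AutX\<^esub> b) (x \<omega>))))"
        using Aut_mult AutD(1)[OF ai] AutD(1)[OF bi] AutD(1)[OF b] a b ai bi xw by (simp add: comm_def)
      have 2: "a ((inv\<^bsub>AutX\<^esub> a) (x \<omega>)) = x \<omega>" "b ((inv\<^bsub>AutX\<^esub> b) (x \<omega>)) = x \<omega>"
        using Aut_inv(2)[OF a xw] Aut_inv(2)[OF b xw] by auto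
      show "face (A \<union> B) (comm a b) x \<omega> = face A a (face B b (face A (inv\<^bsub>AutX\<^esub> a) (face B (inv\<^bsub>AutX\<^esub> b) x))) \<omega>"
        unfolding face_def using 1 2 by simp
    qed
  qed
  \<comment> \<open>The inverse of a generator \<open>comm h k\<close> is \<open>comm k h\<close>,
    so both orders are needed to reach the whole generated subgroup.\<close>
  have face_comms: "cube D (face I (comm h k) x) \<and> cube D (face I (comm k h) x)"
    if h: "h \<in> carrier AutX" and k: "k \<in> lower_central AutX j" and x: "cube D x" for h k x
  proof -
    have kc: "k \<in> carrier AutX" using k Lc by blast
    note ph = cube_face_one[OF h _ iD] cube_face_one[OF inv_closed[OF h] _ iD]
    note pk = Suc.IH[OF k cI'(2,1)] Suc.IH[OF Li[OF k] cI'(2,1)]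
    show ?thesis using face_comm[OF h kc x ph pk] face_comm[OF kc h x pk ph] I'(1) by simp
  qed
  have "cube D (face I \<psi> x) " if "\<psi> \<in> generate AutX {comm h k |h k. h \<in> carrier AutX \<and> k \<in> lower_central AutX j}" "cube D x" for x \<psi>
    using that
  proof (induction arbitrary: x rule: generate.induct)
    case one
    show ?case by (rule cube_cong[OF one.prems]) (use one.prems xX Aut_one in \<open>auto simp: face_def\<close>)
  next
    case (incl c)
    then show ?case using face_comms by blast
  next
    case (inv c)
    then obtain h k where c: "c = comm h k" "h \<in> carrier AutX" "k \<in> lower_central AutX j" by blast
    have "k \<in> carrier AutX" using c(3) Lc by blast
    then have "inv\<^bsub>AutX\<^esub> c = comm k h" using c inv_comm by simp
    then show ?case using face_comms[OF c(2,3) inv.prems] by simp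
  next
    case (eng a b)
    have sub: "{comm h k |h k. h \<in> carrier AutX \<and> k \<in> lower_central AutX j} \<subseteq> carrier AutX" using Lc by auto
    have c: "a \<in> carrier AutX" "b \<in> carrier AutX" using eng.hyps generate_in_carrier[OF sub] by auto
    have "cube D (face I a (face I b x))" using eng by blast
    then show ?case
      by (rule cube_cong) (use eng.prems xX Aut_mult[OF c] in \<open>auto simp: face_def\<close>)
  qed
  then show ?case using Suc.prems unfolding lower_central.simps commutator_subgroup_eq by blast
qed

text \<open>The points themselves serve as \<open>x'\<close> and \<open>y'\<close>. The increments
  are chosen one after another: the next one, \<open>m\<close>, brings \<open>x\<close> and
  \<open>y\<close> so close that the finitely many powers coming from the earlier increments keep
  them within \<open>\<delta>\<close>.\<close>

lemma proximal_imp_RP: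
  assumes x: "x \<in> X" and y: "y \<in> X" and prox: "proximal X T x y"
  shows "(x, y) \<in> RP d X T"
proof -
  obtain n0 where n0: "(\<lambda>k. dist (pw (n0 k) x) (pw (n0 k) y)) \<longlonglongrightarrow> 0" using prox by (auto simp: proximal_def)
  have close: "\<exists>m. dist (pw m x) (pw m y) < e" if "e > 0" for e
  proof -
    have "\<forall>\<^sub>F k in sequentially. dist (pw (n0 k) x) (pw (n0 k) y) < e"
      by (rule order_tendstoD(2)[OF n0 that])
    then show ?thesis using eventually_sequentially by (auto simp: eventually_sequentially)
  qed
  have "\<exists>n. \<forall>\<omega>. \<omega> \<subseteq> {..<D} \<and> \<omega> \<noteq> {} \<longrightarrow> dist (pw (\<Sum>i\<in>\<omega>. n i) x) (pw (\<Sum>i\<in>\<omega>. n i) y) < \<delta>"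
    if \<delta>: "\<delta> > 0" for \<delta> and D :: nat
  proof (induction D)
    case (Suc D)
    then obtain n :: "nat \<Rightarrow> int" where n: "\<And>\<omega>. \<omega> \<subseteq> {..<D} \<Longrightarrow> \<omega> \<noteq> {} \<Longrightarrow> dist (pw (\<Sum>i\<in>\<omega>. n i) x) (pw (\<Sum>i\<in>\<omega>. n i) y) < \<delta>"
      by blast
    have "\<exists>e>0. \<forall>\<omega>\<in>A. \<forall>u\<in>X. \<forall>v\<in>X. dist u v < e \<longrightarrow> dist (pw (\<Sum>i\<in>\<omega>. n i) u) (pw (\<Sum>i\<in>\<omega>. n i) v) < \<delta>"
      if "finite A" for A
      using that
    proof induction
      case empty show ?case by (intro exI[of _ 1]) simp
    next
      case (insert \<omega> A)
      then obtain e where e: "e > 0" "\<forall>\<omega>\<in>A. \<forall>u\<in>X. \<forall>v\<in>X. dist u v < e \<longrightarrow> dist (pw (\<Sum>i\<in>\<omega>. n i) u) (pw (\<Sum>i\<in>\<omega>. n i) v) < \<delta>" by blast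
      have "uniformly_continuous_on X (pw (\<Sum>i\<in>\<omega>. n i))" by (rule compact_uniformly_continuous[OF continuous_on_pw compact_X])
      then obtain e' where e': "e' > 0" "\<forall>u\<in>X. \<forall>v\<in>X. dist u v < e' \<longrightarrow> dist (pw (\<Sum>i\<in>\<omega>. n i) u) (pw (\<Sum>i\<in>\<omega>. n i) v) < \<delta>"
        using \<delta> unfolding uniformly_continuous_on_def by meson
      show ?case using e e' by (intro exI[of _ "min e e'"]) auto
    qed
    \<comment> \<open>The family includes the empty set, which covers the vertex \<open>{D}\<close>
      later.\<close>
    from this[of "Pow {..<D}"] obtain e where e: "e > 0"
      "\<And>\<omega> u v. \<omega> \<subseteq> {..<D} \<Longrightarrow> u \<in> X \<Longrightarrow> v \<in> X \<Longrightarrow> dist u v < e \<Longrightarrow> dist (pw (\<Sum>i\<in>\<omega>. n i) u) (pw (\<Sum>i\<in>\<omega>. n i) v) < \<delta>"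
      by auto
    obtain m where m: "dist (pw m x) (pw m y) < e" using close[OF e(1)] by blast
    have "dist (pw (\<Sum>i\<in>\<omega>. (n(D := m)) i) x) (pw (\<Sum>i\<in>\<omega>. (n(D := m)) i) y) < \<delta>"
      if w: "\<omega> \<subseteq> {..<Suc D}" "\<omega> \<noteq> {}" for \<omega>
    proof (cases "D \<in> \<omega>")
      case False
      then have "\<omega> \<subseteq> {..<D}" using w(1) by (auto simp: less_Suc_eq)
      moreover have "(\<Sum>i\<in>\<omega>. (n(D := m)) i) = (\<Sum>i\<in>\<omega>. n i)" by (rule sum.cong) (use False in auto)
      ultimately show ?thesis using n w(2) by metis
    next
      case True
      have w': "\<omega> - {D} \<subseteq> {..<D}" using w(1) by (auto simp: less_Suc_eq)
      have "finite \<omega>" using w(1) finite_subset by blast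
      then have "(\<Sum>i\<in>\<omega>. (n(D := m)) i) = m + (\<Sum>i\<in>\<omega> - {D}. (n(D := m)) i)" using True by (simp add: sum.remove)
      also have "(\<Sum>i\<in>\<omega> - {D}. (n(D := m)) i) = (\<Sum>i\<in>\<omega> - {D}. n i)" by (rule sum.cong) auto
      finally have "(\<Sum>i\<in>\<omega>. (n(D := m)) i) = (\<Sum>i\<in>\<omega> - {D}. n i) + m" by simp
      then show ?thesis using e(2)[OF w' pw_closed[OF x] pw_closed[OF y] m] pw_add[OF x] pw_add[OF y] by metis
    qed
    then show ?case by blast
  qed (intro exI[of _ "\<lambda>_. 0"], simp)
  then have ex: "\<exists>n. \<forall>\<omega>. \<omega> \<subseteq> {..<d} \<and> \<omega> \<noteq> {} \<longrightarrow> dist (pw (\<Sum>i\<in>\<omega>. n i) x) (pw (\<Sum>i\<in>\<omega>. n i) y) < \<delta>" if "\<delta> > 0" for \<delta>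
    using that by blast
  have "\<exists>x'\<in>X. \<exists>y'\<in>X. \<exists>n :: nat \<Rightarrow> int. dist x x' < \<delta> \<and> dist y y' < \<delta> \<and>
        (\<forall>\<epsilon> :: nat \<Rightarrow> int. (\<forall>i<d. \<epsilon> i \<in> {0, 1}) \<and> (\<exists>i<d. \<epsilon> i \<noteq> 0) \<longrightarrow>
           dist (pw (\<Sum>i<d. n i * \<epsilon> i) x') (pw (\<Sum>i<d. n i * \<epsilon> i) y') < \<delta>)" if \<delta>: "\<delta> > 0" for \<delta>
  proof -
    obtain n where n: "\<And>\<omega>. \<omega> \<subseteq> {..<d} \<Longrightarrow> \<omega> \<noteq> {} \<Longrightarrow> dist (pw (\<Sum>i\<in>\<omega>. n i) x) (pw (\<Sum>i\<in>\<omega>. n i) y) < \<delta>"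
      using ex[OF \<delta>] by blast
    have "dist (pw (\<Sum>i<d. n i * \<epsilon> i) x) (pw (\<Sum>i<d. n i * \<epsilon> i) y) < \<delta>"
      if e: "\<forall>i<d. \<epsilon> i \<in> {0, 1}" "\<exists>i<d. \<epsilon> i \<noteq> 0" for \<epsilon> :: "nat \<Rightarrow> int"
    proof -
      define \<omega> where "\<omega> = {i. i < d \<and> \<epsilon> i = 1}"
      have w: "\<omega> \<subseteq> {..<d}" "\<omega> \<noteq> {}" using e by (auto simp: \<omega>_def)
      have "(\<Sum>i<d. n i * \<epsilon> i) = (\<Sum>i<d. if i \<in> \<omega> then n i else 0)"
        by (rule sum.cong) (use e(1) in \<open>auto simp: \<omega>_def\<close>)
      also have "\<dots> = (\<Sum>i\<in>\<omega>. n i)" using w(1) by (simp add: sum.If_cases Int_absorb1)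
      finally show ?thesis using n[OF w] by simp
    qed
    then show ?thesis using x y \<delta> by (intro bexI[of _ x] bexI[of _ y] exI[of _ n]) auto
  qed
  then show ?thesis using x y by (simp add: RP_def)
qed

lemma proximal_Aut_trivial:
  assumes \<phi>: "\<phi> \<in> carrier AutX" and x: "x \<in> X" and prox: "proximal X T x (\<phi> x)"
  shows "\<phi> = \<one>\<^bsub>AutX\<^esub>"
proof -
  interpret group AutX by (rule AutX_group)
  note A = AutD[OF \<phi>]
  obtain n where n: "(\<lambda>k. dist (pw (n k) x) (pw (n k) (\<phi> x))) \<longlonglongrightarrow> 0" using prox by (auto simp: proximal_def)
  have mem: "\<forall>k. pw (n k) x \<in> X" using pw_closed[OF x] by blast
  obtain z r where z: "z \<in> X" "strict_mono r" "((\<lambda>k. pw (n k) x) \<circ> r) \<longlonglongrightarrow> z"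
    using compact_X[unfolded compact_def, THEN spec, THEN mp, OF mem] by blast
  have "((\<lambda>k. \<phi> (pw (n k) x)) \<circ> r) \<longlonglongrightarrow> \<phi> z"
    using continuous_on_tendsto_compose[OF A(3) z(3) z(1)] mem by (simp add: o_def)
  then have "(\<lambda>k. dist (pw (n (r k)) x) (\<phi> (pw (n (r k)) x))) \<longlonglongrightarrow> dist z (\<phi> z)"
    using z(3) by (auto simp: o_def intro!: tendsto_dist)
  moreover have "(\<lambda>k. dist (pw (n (r k)) x) (\<phi> (pw (n (r k)) x))) \<longlonglongrightarrow> 0"
    using LIMSEQ_subseq_LIMSEQ[OF n z(2)] A(6)[OF x] by (simp add: o_def)
  ultimately have "dist z (\<phi> z) = 0" using LIMSEQ_unique by blast
  then have fix_z: "\<phi> z = z" by simp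
  have fix_orbit: "\<phi> (pw m z) = pw m z" for m using A(6)[OF z(1)] fix_z by simp
  have "\<phi> y = y" if y: "y \<in> X" for y
  proof (rule ccontr)
    assume "\<phi> y \<noteq> y"
    then have d: "dist (\<phi> y) y / 2 > 0" by simp
    obtain e where e: "e > 0" "\<And>u. u \<in> X \<Longrightarrow> dist u y < e \<Longrightarrow> dist (\<phi> u) (\<phi> y) < dist (\<phi> y) y / 2"
      using A(3) y d unfolding continuous_on_iff by meson
    obtain m where m: "dist (pw m z) y < min e (dist (\<phi> y) y / 2)"
      using orbit_dense[OF z(1) y, of "min e (dist (\<phi> y) y / 2)"] e(1) d by auto
    have "dist (\<phi> (pw m z)) (\<phi> y) < dist (\<phi> y) y / 2" using e(2)[OF pw_closed[OF z(1)]] m by simp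
    then have "dist (pw m z) (\<phi> y) < dist (\<phi> y) y / 2" by (simp add: fix_orbit)
    moreover have "dist (\<phi> y) y \<le> dist (pw m z) (\<phi> y) + dist (pw m z) y" by (rule dist_triangle3)
    ultimately show False using m by linarith
  qed
  then show ?thesis using Aut_one by (intro Aut_eqI \<phi>) auto
qed

end

theorem corollary5p8:
  fixes X :: "'a::metric_space set" and T :: "'a \<Rightarrow> 'a"
    and Y :: "'b topology" and S :: "'b \<Rightarrow> 'b"
    and \<pi> :: "'a \<Rightarrow> 'b" and d :: nat
  assumes "d \<ge> 1"
    and "tds (top_of_set X) T" and "minimal (top_of_set X) T"
    and "inverse_limit_of_minimal_nilsystems TYPE('g) d Y S"
    and "proximal_extension X T Y S \<pi>"
  shows "(\<exists>\<Phi> \<in> hom (Aut (top_of_set X) T) (Aut (nilfactor_space d X T) (nilfactor_map d X T)).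
            inj_on \<Phi> (carrier (Aut (top_of_set X) T))) \<and>
         nilpotent d (Aut (top_of_set X) T)"
proof -
  interpret minimal_system X T by unfold_locales (rule assms)+
  interpret group AutX by (rule AutX_group)
  \<comment> \<open>One regionally proximal pair of the form \<open>(x, \<phi> x)\<close> already
    forces \<open>\<phi>\<close> to be the identity; injectivity and nilpotency both reduce to
    this.\<close>
  have trivial: "\<phi> = \<one>\<^bsub>AutX\<^esub>" if \<phi>: "\<phi> \<in> carrier AutX" and x: "x \<in> X" and rp: "(x, \<phi> x) \<in> RP d X T" for \<phi> x
  proof (rule proximal_Aut_trivial[OF \<phi> x])
    have "\<pi> x = \<pi> (\<phi> x)"
      using RP_inverse_limit_factor[OF rp assms(4)] assms(5) by (simp add: proximal_extension_def)
    then show "proximal X T x (\<phi> x)"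
      using assms(5) x AutD(1)[OF \<phi> x] by (simp add: proximal_extension_def)
  qed
  have \<pi>T: "\<pi> (T x) = S (\<pi> x)" if "x \<in> X" for x
    using assms(5) that by (auto simp: proximal_extension_def factor_map_def)
  \<comment> \<open>As the fibre relation of a factor map, \<open>RP\<close> is a
    \<open>T\<close>-invariant equivalence relation, which is what \<open>class_map\<close> relies
    on. Proximal fibres give the inclusion from right to left.\<close>
  have RP_iff: "(x, y) \<in> RP d X T \<longleftrightarrow> x \<in> X \<and> y \<in> X \<and> \<pi> x = \<pi> y" for x y
    using RP_inverse_limit_factor[OF _ assms(4)] assms(5) proximal_imp_RP RP_subset
    unfolding proximal_extension_def by blast
  have class_map: "nilfactor_map d X T (RP d X T `` {x}) = RP d X T `` {T x}" if x: "x \<in> X" for x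
    unfolding nilfactor_map_def
  proof (intro subset_antisym subsetI)
    fix z assume "z \<in> RP d X T `` (T ` (RP d X T `` {x}))"
    then show "z \<in> RP d X T `` {T x}" using x \<pi>T T_closed by (auto simp: RP_iff)
  next
    fix z assume "z \<in> RP d X T `` {T x}"
    then show "z \<in> RP d X T `` (T ` (RP d X T `` {x}))" using RP_refl[OF x] by blast
  qed
  note ind = induced_Aut[OF _ class_map]
  have "induced d \<in> hom AutX (AutZ d)"
    using ind induced_mult by (simp add: hom_def Pi_def)
  moreover have "inj_on (induced d) (carrier AutX)"
  proof (rule inj_onI)
    fix \<phi> \<psi> assume \<phi>: "\<phi> \<in> carrier AutX" and \<psi>: "\<psi> \<in> carrier AutX" and eq: "induced d \<phi> = induced d \<psi>"
    show "\<phi> = \<psi>"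
    \<comment> \<open>The empty space counts as minimal; its automorphisms agree because they are
      extensional.\<close>
    proof (cases "X = {}")
      case True then show ?thesis by (intro Aut_eqI \<phi> \<psi>) simp
    next
      case False
      then obtain x where x: "x \<in> X" by blast
      have "RP d X T `` {\<phi> x} = RP d X T `` {\<psi> x}"
        using induced_class[OF \<phi> x] induced_class[OF \<psi> x] eq by metis
      then have rp: "(\<psi> x, \<phi> x) \<in> RP d X T" using RP_refl[OF AutD(1)[OF \<phi> x]] by blast
      define \<theta> where "\<theta> = \<phi> \<otimes>\<^bsub>AutX\<^esub> inv\<^bsub>AutX\<^esub> \<psi>"
      have \<theta>: "\<theta> \<in> carrier AutX" using \<phi> \<psi> by (simp add: \<theta>_def)
      have "\<theta> (\<psi> x) = \<phi> x"
        using Aut_mult[OF \<phi> inv_closed[OF \<psi>] AutD(1)[OF \<psi> x]] Aut_inv(1)[OF \<psi> x] by (simp add: \<theta>_def)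
      then have "\<theta> = \<one>\<^bsub>AutX\<^esub>" using trivial[OF \<theta> AutD(1)[OF \<psi> x]] rp by simp
      then show ?thesis using \<phi> \<psi> unfolding \<theta>_def by (metis inv_equality inv_inv inv_closed)
    qed
  qed
  moreover have "nilpotent d AutX"
  proof -
    have one: "\<psi> = \<one>\<^bsub>AutX\<^esub>" if \<psi>: "\<psi> \<in> lower_central AutX d" for \<psi>
    proof (cases "X = {}")
      case True
      show ?thesis
      proof (rule Aut_eqI[OF _ one_closed])
        show "\<psi> \<in> carrier AutX" using \<psi> lower_central_carrier by blast
      qed (use True in blast)
    next
      case False
      then obtain x where x: "x \<in> X" by blast
      \<comment> \<open>By the shifted indexing \<open>lower_central AutX d\<close> is the
        \<open>(d+1)\<close>-st term, which matches codimension \<open>Suc d\<close>; in a cube of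
        dimension \<open>Suc d\<close> such a face is one vertex.\<close>
      have "cube (Suc d) (face {..<Suc d} \<psi> (\<lambda>_. x))"
        by (rule cube_face_lower_central[OF \<psi> _ _ cube_const[OF x]]) auto
      then have "cube (Suc d) (\<lambda>\<omega>. if \<omega> = {..<Suc d} then \<psi> x else x)"
        by (rule cube_cong) (auto simp: face_def)
      then have "(x, \<psi> x) \<in> RP d X T" by (rule RP_of_cube)
      then show ?thesis using trivial[OF subsetD[OF lower_central_carrier \<psi>] x] by blast
    qed
    moreover have "\<one>\<^bsub>AutX\<^esub> \<in> lower_central AutX d"
      by (rule subgroup.one_closed[OF normal_imp_subgroup[OF lower_central_normal]])
    ultimately have "lower_central AutX d = {\<one>\<^bsub>AutX\<^esub>}" using one by (intro subset_antisym subsetI) (blast intro: one | simp)+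
    then show ?thesis unfolding nilpotent_def by (intro conjI is_group)
  qed
  ultimately show ?thesis by blast
qed

end
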